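(* Let $OE(n)$ denote the number of partitions of $n$ in which the parts alternate in parity starting with the smallest part odd (odd-even partitions of $n$). Then \[ OE(n)\sim \frac{1}{2\sqrt{5}\, n^{3/4}}\, e^{\pi\sqrt{n/5}} \] as $n\to\infty$.
   Context: A partition of a positive integer $n$ is a nonincreasing sequence of positive integers summing to $n$. Equivalently, $1+\sum_{n\ge1} OE(n)q^n=\sum_{m\ge0}\frac{q^{m(m+1)/2}}{(q^2;q^2)_m}$, where $(a;q)_m=\prod_{j=1}^m(1-aq^{j-1})$. *)

theory Defs
  imports Complex_Main "HOL-Library.Landau_Symbols"
begin

definition partitions_of :: "nat \<Rightarrow> nat list set" where
  "partitions_of n =
     {xs. sorted_wrt (\<ge>) xs \<and> (\<forall>x\<in>set xs. 0 < x) \<and> sum_list xs = n}"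

text \<open>
  The parts are listed in nonincreasing order, so the smallest part is the last one. The empty
  partition of \<open>0\<close> counts as odd-even; this is the term \<open>m = 0\<close> of the generating function
  \<open>(\<Sum>m. q ^ (m * (m + 1) div 2) / (\<Prod>j=1..m. 1 - q ^ (2 * j)))\<close>.
\<close>
definition odd_even :: "nat list \<Rightarrow> bool" where
  "odd_even xs \<longleftrightarrow>
     (xs \<noteq> [] \<longrightarrow> odd (last xs)) \<and>
     (\<forall>i. Suc i < length xs \<longrightarrow> (even (xs ! i) \<longleftrightarrow> odd (xs ! Suc i)))"

definition OE :: "nat \<Rightarrow> nat" where
  "OE n = card {xs \<in> partitions_of n. odd_even xs}"

lemma finite_partitions_of: "finite (partitions_of n)"
proof (rule finite_subset)
  show "partitions_of n \<subseteq> {xs. set xs \<subseteq> {..n} \<and> length xs \<le> n}"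
  proof
    fix xs assume "xs \<in> partitions_of n"
    then have pos: "\<forall>x\<in>set xs. 0 < x" and n: "sum_list xs = n"
      by (auto simp: partitions_of_def)
    have "length xs \<le> sum_list xs"
      using pos by (induction xs) auto
    moreover have "set xs \<subseteq> {..n}"
      using n member_le_sum_list by auto
    ultimately show "xs \<in> {xs. set xs \<subseteq> {..n} \<and> length xs \<le> n}"
      using n by simp
  qed
qed (simp add: finite_lists_length_le)

end

(*
  Subtracting the staircase (m, ..., 2, 1) shows that odd-even partitions of n with m parts
  correspond to partitions of (n - m(m+1)/2)/2 into at most m parts.  Their number is a Fourier
  coefficient, on the circle of radius e^(-s), of 1/((1-Q)...(1-Q^m)); as Q = q^2 is the variable, the
  only dominant singularity left is Q = 1, and the parity of n enters only through the residue of m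
  mod 4.  With s = pi/sqrt(5n) for all m, each coefficient is a positive weight times the probability
  that a sum of independent multiples of geometric variables takes a prescribed value.  The weight is
  Gaussian in m around saddle/s, where e^(-saddle/2) is (sqrt 5 - 1)/2 (Euler-Maclaurin,
  Stirling, and Li_2 at that point), and the probability obeys a local limit theorem.  Dominated
  convergence turns the sum over each residue class of m mod 4 into a quarter of a Gaussian integral.
*)
theory Submission
  imports Defs "HOL-Probability.Probability" "HOL-Real_Asymp.Real_Asymp"
begin

section \<open>Odd-even partitions of fixed length\<close>

text \<open>The full generating function is a sum, not a product, but for fixed \<open>m\<close> the
  integrand divided by its value at t = 0 is a characteristic function: its modulus is at most 1 and
  its decay can be bounded uniformly in m. The common radius is adapted to the peak only, since
  pi^2/(10 s^2) = n/2. Away from the peak the target value and the mean of the geometric sum drift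
  apart linearly in m, which yields a second Gaussian factor of the same width 1/sqrt s as the
  weight. The exponent pi sqrt (n/5) = pi^2/(5s) comes in equal halves from e^(sN) together with the
  staircase shift and from the peak value pi^2/10 of the free energy. The powers are s^(1/2) for the
  weight, s^(3/2) for the local probability and s^(-1/2) for the number of relevant m, in total
  s^(3/2), of order n^(-3/4). The obstacle is domination over all m: decay of the characteristic
  function is proved only for s m >= 1/2, and for smaller m the trivial bound 1 is paid for by the
  Gaussian decay of the weight.\<close>

definition odd_even_lists :: "nat \<Rightarrow> int \<Rightarrow> nat list set" where
  "odd_even_lists m k =
     {xs. sorted_wrt (\<ge>) xs \<and> (\<forall>x\<in>set xs. 0 < x) \<and> odd_even xs \<and> length xs = m \<and> int (sum_list xs) = k}"

lemma odd_even_iff_successively: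
  "odd_even xs \<longleftrightarrow> (xs \<noteq> [] \<longrightarrow> odd (last xs)) \<and> successively (\<lambda>x y. even x \<longleftrightarrow> odd y) xs"
  by (simp add: odd_even_def successively_conv_nth)

text \<open>Totals are integers so that the recursion can subtract without truncation. Negative
  totals are where the comparison with circle integrals gets its anchor.\<close>

lemma odd_even_lists_neg: "k < 0 \<Longrightarrow> odd_even_lists m k = {}"
  by (auto simp: odd_even_lists_def)

lemma odd_even_lists_0: "odd_even_lists 0 k = (if k = 0 then {[]} else {})"
  by (auto simp: odd_even_lists_def odd_even_def)

lemma finite_odd_even_lists: "finite (odd_even_lists m k)"
  by (rule finite_subset[OF _ finite_partitions_of[of "nat k"]])
     (auto simp: odd_even_lists_def partitions_of_def)

text \<open>Split on the smallest part. If it is 1, deleting it and lowering the others by 1 flips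
  their parities, so the new smallest part is odd again. If it is at least 3, lowering every part by
  2 keeps all parities and positivity.\<close>

lemma odd_even_lists_Suc:
  "odd_even_lists (Suc m) k =
     (\<lambda>ys. map Suc ys @ [1]) ` odd_even_lists m (k - int (Suc m)) \<union>
     map ((+) 2) ` odd_even_lists (Suc m) (k - 2 * int (Suc m))" (is "?L = ?A \<union> ?B")
proof (intro equalityI subsetI)
  fix xs assume xs: "xs \<in> ?L"
  then obtain zs l where zs: "xs = zs @ [l]"
    by (cases xs rule: rev_cases) (auto simp: odd_even_lists_def)
  have l: "odd l" and alt: "successively (\<lambda>x y. even x \<longleftrightarrow> odd y) (zs @ [l])"
    and srt: "sorted_wrt (\<ge>) (zs @ [l])" and len: "length zs = m"
    and sm: "int (sum_list (zs @ [l])) = k" and pos: "\<forall>x\<in>set (zs @ [l]). 0 < x"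
    using xs by (auto simp: odd_even_lists_def odd_even_iff_successively zs)
  have ge: "\<And>x. x \<in> set zs \<Longrightarrow> x \<ge> l"
    using srt by (auto simp: sorted_wrt_append)
  show "xs \<in> ?A \<union> ?B"
  proof (cases "l = 1")
    case True
    define ys where "ys = map (\<lambda>x. x - 1) zs"
    have evl: "zs \<noteq> [] \<Longrightarrow> even (last zs)" and altz: "successively (\<lambda>x y. even x \<longleftrightarrow> odd y) zs"
      using alt l by (auto simp: successively_append_iff)
    have srtz: "sorted_wrt (\<ge>) zs" using srt by (auto simp: sorted_wrt_append)
    have ge_last: "x \<ge> last zs" if "x \<in> set zs" for x
    proof -
      have "zs \<noteq> []" using that by auto
      then have "zs = butlast zs @ [last zs]" by simp
      with srtz that show ?thesis
        by (metis append_Nil2 in_set_conv_decomp order_refl set_ConsD sorted_wrt_append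
            Un_iff empty_iff empty_set list.set_intros(1) set_append)
    qed
    \<comment> \<open>The second smallest part is positive and even, so lowering by 1 is not
      truncated and leaves positive parts.\<close>
    have ge2: "x \<ge> 2" if "x \<in> set zs" for x
    proof -
      have ne: "zs \<noteq> []" using that by auto
      then have "last zs > 0" "even (last zs)" using evl pos by auto
      then have "last zs \<ge> 2" by presburger
      then show ?thesis using ge_last[OF that] by linarith
    qed
    have zy: "zs = map Suc ys"
      unfolding ys_def map_map comp_def
      by (rule map_idI[symmetric]) (use ge2 in force)
    have "ys \<in> odd_even_lists m (k - int (Suc m))"
    proof -
      have "sorted_wrt (\<ge>) ys" using srtz by (simp add: zy sorted_wrt_map)
      moreover have "\<forall>x\<in>set ys. 0 < x" using ge2 by (force simp: ys_def)
      moreover have "odd_even ys" using evl altz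
        by (auto simp: odd_even_iff_successively zy successively_map last_map elim: successively_mono)
      moreover have "int (sum_list ys) = k - int (Suc m)"
      proof -
        have "sum_list (map Suc ys) = sum_list ys + length ys" by (induction ys) auto
        then show ?thesis using sm len True by (simp add: zy)
      qed
      ultimately show ?thesis using len by (simp add: odd_even_lists_def ys_def)
    qed
    then show ?thesis using zs zy True by auto
  next
    case False
    then have l3: "l \<ge> 3" using l by presburger
    define ys where "ys = map (\<lambda>x. x - 2) xs"
    have ge3: "x \<ge> 3" if "x \<in> set xs" for x
      using that ge l3 by (auto simp: zs dest: order_trans[OF l3])
    have zy: "xs = map ((+) 2) ys"
      unfolding ys_def map_map comp_def
      by (rule map_idI[symmetric]) (use ge3 in force)
    have "ys \<in> odd_even_lists (Suc m) (k - 2 * int (Suc m))"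
    proof -
      have "sorted_wrt (\<ge>) ys" using srt by (simp add: zy sorted_wrt_map flip: zs)
      moreover have "\<forall>x\<in>set ys. 0 < x" using ge3 by (force simp: ys_def)
      moreover have "odd_even ys" using xs
        by (auto simp: odd_even_lists_def odd_even_iff_successively zy successively_map last_map)
      moreover have "int (sum_list ys) = k - 2 * int (Suc m)"
      proof -
        have "sum_list (map ((+) 2) ys) = sum_list ys + 2 * length ys" by (induction ys) auto
        then show ?thesis using xs by (simp add: zy odd_even_lists_def)
      qed
      ultimately show ?thesis using len by (simp add: odd_even_lists_def ys_def zs)
    qed
    then show ?thesis using zy by auto
  qed
next
  fix xs assume "xs \<in> ?A \<union> ?B"
  then show "xs \<in> ?L"
  proof
    assume "xs \<in> ?A"
    then obtain ys where ys: "xs = map Suc ys @ [1]" "ys \<in> odd_even_lists m (k - int (Suc m))"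
      by auto
    have "sum_list (map Suc ys) = sum_list ys + length ys" by (induction ys) auto
    with ys show ?thesis
      by (cases "ys = []")
         (auto simp: odd_even_lists_def odd_even_iff_successively sorted_wrt_append sorted_wrt_map
          successively_append_iff successively_map last_map)
  next
    assume "xs \<in> ?B"
    then obtain ys where ys: "xs = map ((+) 2) ys" "ys \<in> odd_even_lists (Suc m) (k - 2 * int (Suc m))"
      by auto
    have "sum_list (map ((+) 2) ys) = sum_list ys + 2 * length ys" by (induction ys) auto
    with ys show ?thesis
      by (auto simp: odd_even_lists_def odd_even_iff_successively sorted_wrt_map
          successively_map last_map)
  qed
qed

text \<open>The two kinds of lists are told apart by whether the last entry is 1. With k = m(m+1)/2
  + 2N this becomes the recursion for partitions of N into at most m parts, so the staircase
  bijection itself is never constructed.\<close>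

lemma card_odd_even_lists_Suc:
  "card (odd_even_lists (Suc m) k) =
     card (odd_even_lists m (k - int (Suc m))) + card (odd_even_lists (Suc m) (k - 2 * int (Suc m)))"
proof -
  have "last (map ((+) 2) ys) \<noteq> 1" if "ys \<noteq> []" for ys :: "nat list"
    using that by (simp add: last_map)
  then have disj: "(\<lambda>ys. map Suc ys @ [1]) ` odd_even_lists m (k - int (Suc m)) \<inter>
     map ((+) 2) ` odd_even_lists (Suc m) (k - 2 * int (Suc m)) = {}"
    by (auto simp: odd_even_lists_def) (metis append_is_Nil_conv last_snoc list.discI map_is_Nil_conv)
  have "inj_on (\<lambda>ys. map Suc ys @ [1]) A" for A
    by (auto intro!: inj_onI dest: map_injective)
  moreover have "inj_on (map ((+) (2::nat))) A" for A
    by (auto intro!: inj_onI)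
  ultimately show ?thesis
    by (subst odd_even_lists_Suc, subst card_Un_disjoint)
       (simp_all only: disj finite_odd_even_lists finite_imageI card_image)
qed

text \<open>Counted from the smallest part the parities are odd, even, odd, ..., so the sum has the
  parity of m(m+1)/2. The claim about the head serves the induction: it supplies the parity of each
  newly prepended part.\<close>

lemma odd_even_parity:
  assumes "odd_even xs"
  shows "(xs \<noteq> [] \<longrightarrow> (odd (hd xs) \<longleftrightarrow> odd (length xs))) \<and>
         (even (sum_list xs) \<longleftrightarrow> length xs mod 4 \<in> {0, 3})"
  using assms
proof (induction xs)
  case (Cons x xs)
  show ?case
  proof (cases xs)
    case (Cons a list)
    then have "odd_even xs" and x: "even x \<longleftrightarrow> odd (hd xs)"
      using Cons.prems by (auto simp: odd_even_iff_successively)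
    have ne: "xs \<noteq> []" using Cons by simp
    note IH = Cons.IH[OF \<open>odd_even xs\<close>]
    have "odd x \<longleftrightarrow> odd (Suc (length xs))" using IH ne x by simp
    moreover have "even (sum_list (x # xs)) \<longleftrightarrow> (even x \<longleftrightarrow> even (sum_list xs))" by simp
    moreover have "length xs mod 4 = 0 \<and> even (length xs) \<or> length xs mod 4 = 1 \<and> odd (length xs) \<or>
        length xs mod 4 = 2 \<and> even (length xs) \<or> length xs mod 4 = 3 \<and> odd (length xs)"
      by presburger
    ultimately show ?thesis using IH ne
      by (elim disjE conjE) (simp_all add: mod_Suc)
  qed (use Cons.prems in \<open>simp_all add: odd_even_def\<close>)
qed simp

lemma length_le_sum_list: "\<forall>x\<in>set xs. 0 < x \<Longrightarrow> length xs \<le> sum_list xs" for xs :: "nat list"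
  by (induction xs) auto

lemma OE_eq_sum_card:
  "OE n = (\<Sum>m\<in>{m. m \<le> n \<and> (even n \<longleftrightarrow> m mod 4 \<in> {0, 3})}. card (odd_even_lists m (int n)))"
proof -
  have "{xs \<in> partitions_of n. odd_even xs} =
      (\<Union>m\<in>{m. m \<le> n \<and> (even n \<longleftrightarrow> m mod 4 \<in> {0, 3})}. odd_even_lists m (int n))"
    using odd_even_parity length_le_sum_list by (fastforce simp: partitions_of_def odd_even_lists_def)
  then show ?thesis
    unfolding OE_def
    by (simp only:) (subst card_UN_disjoint, auto simp: finite_odd_even_lists, auto simp: odd_even_lists_def)
qed

section \<open>Circle integrals\<close>

definition qfac :: "nat \<Rightarrow> complex \<Rightarrow> complex" where
  "qfac m z = (\<Prod>j=1..m. 1 - exp (of_nat j * z))"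

text \<open>Cauchy's formula on |Q| = e^(-s) for the coefficient of Q^N in 1/(Q;Q)_m, where
  \<open>qfac\<close> is the q-Pochhammer symbol at Q = e^z. \<open>N\<close> is real because it
  will be evaluated at \<open>saddle_N s m\<close>, which need not be an integer.\<close>

definition circle_coeff :: "real \<Rightarrow> nat \<Rightarrow> real \<Rightarrow> complex" where
  "circle_coeff s m N =
     integral {-pi..pi} (\<lambda>t. exp (- of_real N * Complex (- s) t) / qfac m (Complex (- s) t))
       / (2 * pi)"

lemma qfac_0 [simp]: "qfac 0 z = 1"
  and qfac_Suc: "qfac (Suc m) z = qfac m z * (1 - exp (of_nat (Suc m) * z))"
  by (simp_all add: qfac_def)

lemma qfac_nonzero: "Re z < 0 \<Longrightarrow> qfac m z \<noteq> 0"
proof -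
  assume z: "Re z < 0"
  have "exp (of_nat j * z) \<noteq> 1" if "j \<ge> 1" for j
  proof -
    have "norm (exp (of_nat j * z)) < 1"
      using that z by (simp add: norm_exp_eq_Re mult_pos_neg)
    then show ?thesis by (metis less_irrefl norm_one)
  qed
  then show ?thesis by (auto simp: qfac_def)
qed

lemma continuous_on_Complex [continuous_intros]:
  "continuous_on A f \<Longrightarrow> continuous_on A g \<Longrightarrow> continuous_on A (\<lambda>x. Complex (f x) (g x))"
  by (simp add: Complex_eq continuous_intros)

lemma continuous_on_qfac [continuous_intros]:
  "continuous_on A f \<Longrightarrow> continuous_on A (\<lambda>x. qfac m (f x))"
  unfolding qfac_def by (intro continuous_intros)

lemma circle_integrand_continuous:
  assumes "s > 0"
  shows "continuous_on A (\<lambda>t. exp (- of_real N * Complex (- s) t) / qfac m (Complex (- s) t))"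
  using assms by (intro continuous_intros) (auto simp: qfac_nonzero)

text \<open>This is 1/(Q;Q)_(m+1) = 1/(Q;Q)_m + Q^(m+1)/(Q;Q)_(m+1) under the integral; the power of
  Q in the last term shifts \<open>N\<close>.\<close>

lemma circle_coeff_rec:
  assumes s: "s > 0"
  shows "circle_coeff s (Suc m) N = circle_coeff s m N + circle_coeff s (Suc m) (N - real (Suc m))"
proof -
  define g where "g m N t = exp (- of_real N * Complex (- s) t) / qfac m (Complex (- s) t)" for m N t
  have int: "g m N integrable_on {-pi..pi}" for m N
    unfolding g_def by (intro integrable_continuous_interval circle_integrand_continuous s)
  have eq: "g (Suc m) N t = g m N t + g (Suc m) (N - real (Suc m)) t" for t
  proof -
    define z where "z = Complex (- s) t"
    have "qfac (Suc m) z \<noteq> 0" "qfac m z \<noteq> 0"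
      using s by (auto intro!: qfac_nonzero simp: z_def)
    moreover have "exp (- of_real (N - real (Suc m)) * z) = exp (- of_real N * z) * exp (of_nat (Suc m) * z)"
      by (simp add: algebra_simps flip: exp_add)
    ultimately show ?thesis
      unfolding g_def z_def[symmetric] by (simp add: qfac_Suc field_simps del: of_nat_Suc)
  qed
  have "integral {-pi..pi} (g (Suc m) N) = integral {-pi..pi} (g m N) + integral {-pi..pi} (g (Suc m) (N - real (Suc m)))"
    unfolding eq by (intro Henstock_Kurzweil_Integration.integral_add int)
  moreover have "circle_coeff s m N = integral {-pi..pi} (g m N) / (2 * pi)" for m N
    by (simp add: circle_coeff_def g_def[abs_def])
  ultimately show ?thesis
    by (simp only: add_divide_distrib)
qed

lemma circle_coeff_0: "circle_coeff s 0 (of_int k) = (if k = 0 then 1 else 0)"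
proof (cases "k = 0")
  case True
  then show ?thesis by (simp add: circle_coeff_def scaleR_conv_of_real)
next
  case False
  define F where "F t = exp (- of_int k * Complex (- s) t) / (- of_int k * \<i>)" for t :: real
  have "((\<lambda>t. exp (- of_int k * Complex (- s) t)) has_integral (F pi - F (-pi))) {-pi..pi}"
  proof (rule fundamental_theorem_of_calculus)
    fix t :: real
    have "((\<lambda>z. exp (- of_int k * (- of_real s + \<i> * z)) / (- of_int k * \<i>)) has_field_derivative
        exp (- of_int k * (- of_real s + \<i> * of_real t))) (at (of_real t))"
      using False by (auto intro!: derivative_eq_intros simp: field_simps)
    from has_vector_derivative_real_field[OF this, of "{-pi..pi}"]
    show "(F has_vector_derivative exp (- of_int k * Complex (- s) t)) (at t within {-pi..pi})"
      by (simp add: F_def[abs_def] Complex_eq)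
  qed simp
  moreover have "F pi = F (-pi)"
  proof -
    have "exp (- of_int k * Complex (- s) pi) =
        exp (- of_int k * Complex (- s) (-pi)) * exp (2 * of_int (- k) * pi * \<i>)"
      by (simp add: Complex_eq algebra_simps flip: exp_add)
    also have "exp (2 * of_int (- k) * pi * \<i>) = 1"
      using exp_integer_2pi[of "of_int (- k)"] by simp
    finally show ?thesis by (simp add: F_def)
  qed
  ultimately show ?thesis using False
    by (simp add: circle_coeff_def integral_unique)
qed

text \<open>The bound decays as \<open>N\<close> tends to minus infinity, which removes the periodic
  ambiguity left by the recursion.\<close>

lemma circle_coeff_bounded:
  assumes s: "s > 0"
  obtains B where "\<And>N. norm (circle_coeff s m N) \<le> B * exp (s * N)"
proof -
  have "compact ((\<lambda>t. 1 / qfac m (Complex (- s) t)) ` {-pi..pi})"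
    using s by (intro compact_continuous_image continuous_intros) (auto simp: qfac_nonzero)
  then have "bounded ((\<lambda>t. 1 / qfac m (Complex (- s) t)) ` {-pi..pi})"
    by (rule compact_imp_bounded)
  then obtain B where B: "\<And>t. t \<in> {-pi..pi} \<Longrightarrow> norm (1 / qfac m (Complex (- s) t)) \<le> B"
    unfolding bounded_iff by blast
  have "norm (circle_coeff s m N) \<le> B * exp (s * N)" for N
  proof -
    have "norm (integral {-pi..pi} (\<lambda>t. exp (- of_real N * Complex (- s) t) / qfac m (Complex (- s) t)))
       \<le> (B * exp (s * N)) * (pi - (-pi))"
    proof (rule integral_bound)
      fix t assume t: "t \<in> {-pi..pi}"
      have "norm (exp (- of_real N * Complex (- s) t) / qfac m (Complex (- s) t)) =
          exp (s * N) * norm (1 / qfac m (Complex (- s) t))"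
        by (simp add: norm_divide norm_exp_eq_Re mult.commute)
      then show "norm (exp (- of_real N * Complex (- s) t) / qfac m (Complex (- s) t)) \<le> B * exp (s * N)"
        using B[OF t] by (simp add: mult.commute)
    qed (use circle_integrand_continuous[OF s] in auto)
    then show ?thesis by (simp add: circle_coeff_def norm_divide norm_mult field_simps)
  qed
  then show ?thesis by (rule that)
qed

text \<open>Both sides satisfy the same recursion, so their difference is periodic in \<open>N\<close>; it also tends
  to \<open>0\<close> as \<open>N\<close> tends to minus infinity.\<close>
lemma card_eq_circle_coeff:
  assumes s: "s > 0"
  shows "of_nat (card (odd_even_lists m (int (m * (m + 1) div 2) + 2 * N))) = circle_coeff s m (of_int N)"
proof (induction m arbitrary: N)
  case 0
  then show ?case using circle_coeff_0[of s N] by (simp add: odd_even_lists_0)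
next
  case (Suc m)
  define d where "d N = of_nat (card (odd_even_lists (Suc m) (int (Suc m * (Suc m + 1) div 2) + 2 * N)))
     - circle_coeff s (Suc m) (of_int N)" for N
  have shift: "d N = d (N - int (Suc m))" for N
  proof -
    have tri: "int (Suc m * (Suc m + 1) div 2) = int (m * (m + 1) div 2) + int (Suc m)"
      by simp
    have "card (odd_even_lists (Suc m) (int (Suc m * (Suc m + 1) div 2) + 2 * N)) =
      card (odd_even_lists m (int (m * (m + 1) div 2) + 2 * N)) +
      card (odd_even_lists (Suc m) (int (Suc m * (Suc m + 1) div 2) + 2 * (N - int (Suc m))))"
      by (subst card_odd_even_lists_Suc) (simp only: tri, simp add: algebra_simps)
    moreover have "circle_coeff s (Suc m) (of_int N) = circle_coeff s m (of_int N) +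
        circle_coeff s (Suc m) (of_int (N - int (Suc m)))"
      using circle_coeff_rec[OF s, of m "of_int N"] by simp
    ultimately show ?thesis unfolding d_def by (simp only: Suc.IH of_nat_add add_diff_cancel_left)
  qed
  have shiftk: "d N = d (N - int k * int (Suc m))" for k
  proof (induction k)
    case (Suc k)
    then show ?case using shift[of "N - int k * int (Suc m)"]
      by (simp add: algebra_simps)
  qed simp
  obtain B where B: "\<And>N. norm (circle_coeff s (Suc m) N) \<le> B * exp (s * N)"
    using circle_coeff_bounded[OF s] by blast
  define p where "p k = N - int k * int (Suc m)" for k
  have "eventually (\<lambda>k. norm (d N) \<le> B * exp (s * real_of_int (p k))) sequentially"
    \<comment> \<open>For such \<open>k\<close> the shift outweighs both |N| and the triangular
      number, so the total is negative and there is nothing to count.\<close>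
    using eventually_ge_at_top[of "nat \<bar>N\<bar> + Suc m * (Suc m + 1)"]
  proof eventually_elim
    case (elim k)
    have "k * 1 \<le> k * Suc m" by (intro mult_left_mono) auto
    then have "int k \<le> int k * int (Suc m)" by (metis mult.right_neutral of_nat_le_iff of_nat_mult)
    moreover have "int (Suc m * (Suc m + 1) div 2) \<le> int (Suc m * (Suc m + 1))"
      by (simp only: of_nat_le_iff div_le_dividend)
    moreover have "int k \<ge> \<bar>N\<bar> + int (Suc m * (Suc m + 1))" using elim by linarith
    ultimately have "int (Suc m * (Suc m + 1) div 2) + 2 * p k < 0"
      using p_def[of k] by (smt (verit) mult_pos_pos of_nat_0_less_iff zero_less_Suc add_pos_pos zero_less_one)
    then have "d (p k) = - circle_coeff s (Suc m) (of_int (p k))"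
      by (simp add: d_def odd_even_lists_neg)
    then show ?case using shiftk[of k] B[of "of_int (p k)"] by (simp add: p_def)
  qed
  moreover have "(\<lambda>k. B * exp (s * real_of_int (p k))) \<longlonglongrightarrow> 0"
  proof -
    have "B * exp (s * real_of_int (p k)) = B * exp (s * of_int N) * exp (- (s * real (Suc m))) ^ k" for k
      by (simp add: p_def algebra_simps flip: exp_add exp_of_nat_mult)
    moreover have "(\<lambda>k. exp (- (s * real (Suc m))) ^ k) \<longlonglongrightarrow> 0"
      using s by (intro LIMSEQ_power_zero) simp
    then have "(\<lambda>k. B * exp (s * of_int N) * exp (- (s * real (Suc m))) ^ k) \<longlonglongrightarrow> 0"
      by (rule tendsto_mult_right_zero)
    ultimately show ?thesis by (simp only:)
  qed
  ultimately have "norm (d N) \<le> 0"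
    by (intro tendsto_lowerbound[where F = sequentially]) auto
  then show ?case by (simp add: d_def)
qed

section \<open>The dilogarithm at the golden ratio\<close>

definition dilog :: "real \<Rightarrow> real" where
  "dilog x = (\<Sum>n. x ^ Suc n / real (Suc n) ^ 2)"

lemma summable_inverse_Suc_squares: "summable (\<lambda>n. 1 / real (Suc n) ^ 2)"
  using inverse_squares_sums by (simp add: sums_iff add.commute)

lemma dilog_0 [simp]: "dilog 0 = 0"
  by (simp add: dilog_def)

lemma dilog_1: "dilog 1 = pi\<^sup>2 / 6"
  using inverse_squares_sums by (simp add: sums_iff dilog_def add.commute)

lemma continuous_on_dilog: "continuous_on {-1..1} dilog"
proof -
  have "uniform_limit {-1..1} (\<lambda>N x. \<Sum>n<N. x ^ Suc n / real (Suc n) ^ 2) dilog sequentially"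
    unfolding dilog_def[abs_def]
  proof (rule Weierstrass_m_test)
    fix n and x :: real
    assume "x \<in> {-1..1}"
    then have "\<bar>x\<bar> ^ Suc n \<le> 1" by (intro power_le_one) auto
    then show "norm (x ^ Suc n / real (Suc n) ^ 2) \<le> 1 / real (Suc n) ^ 2"
      by (simp add: abs_mult power_abs divide_right_mono)
  qed (rule summable_inverse_Suc_squares)
  then show ?thesis
    by (rule uniform_limit_theorem[rotated]) (auto intro!: always_eventually continuous_intros)
qed

lemma DERIV_dilog:
  assumes "\<bar>x\<bar> < 1" "x \<noteq> 0"
  shows "(dilog has_real_derivative (- ln (1 - x) / x)) (at x)"
proof -
  have "((\<lambda>x. \<Sum>n. 1 / real (Suc n) ^ 2 * x ^ Suc n) has_real_derivative
      (\<Sum>n. 1 / real (Suc n) ^ 2 * real (Suc n) * x ^ n)) (at x)"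
  proof (rule DERIV_power_series')
    fix x :: real assume "x \<in> {-1<..<1}"
    then have x: "\<bar>x\<bar> < 1" by auto
    show "summable (\<lambda>n. 1 / real (Suc n) ^ 2 * real (Suc n) * x ^ n)"
    proof (rule summable_comparison_test')
      show "summable (\<lambda>n. \<bar>x\<bar> ^ n)" using x by (intro summable_geometric) simp
      show "norm (1 / real (Suc n) ^ 2 * real (Suc n) * x ^ n) \<le> \<bar>x\<bar> ^ n" for n
        by (simp add: abs_mult power_abs power2_eq_square divide_le_eq) (simp add: mult_le_cancel_left1 algebra_simps)
    qed
  qed (use assms in auto)
  moreover have "(\<Sum>n. 1 / real (Suc n) ^ 2 * real (Suc n) * x ^ n) = - ln (1 - x) / x"
  proof -
    have "summable (\<lambda>n. x ^ n / real (Suc n))"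
    proof (rule summable_comparison_test')
      show "summable (\<lambda>n. \<bar>x\<bar> ^ n)" using assms by (intro summable_geometric) simp
      show "norm (x ^ n / real (Suc n)) \<le> \<bar>x\<bar> ^ n" for n
        by (simp add: abs_mult power_abs divide_le_eq) (simp add: mult_le_cancel_left1 algebra_simps)
    qed
    from suminf_mult[OF this, of "- x"]
    have "- x * (\<Sum>n. x ^ n / real (Suc n)) = (\<Sum>n. - x * (x ^ n / real (Suc n)))"
      by (simp only:)
    \<comment> \<open>\<open>ln_series\<close> expands ln around 1 with alternating signs; at the
      point 1 - x these signs cancel against those of the powers of -x.\<close>
    also have "\<dots> = (\<Sum>n. (-1) ^ n * (1 / real (n + 1)) * ((1 - x) - 1) ^ Suc n)"
    proof (rule suminf_cong)
      fix n
      have "(-1 :: real) ^ n * (-1) ^ n = 1"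
        by (simp flip: power_mult_distrib)
      then have "(-1) ^ n * (- x) ^ Suc n = - x * x ^ n"
        by (subst power_minus) (simp add: mult.assoc[symmetric])
      then show "- x * (x ^ n / real (Suc n)) = (-1) ^ n * (1 / real (n + 1)) * ((1 - x) - 1) ^ Suc n"
        by auto
    qed
    also have "\<dots> = ln (1 - x)"
      using ln_series[of "1 - x"] assms by simp
    finally have "(\<Sum>n. x ^ n / real (Suc n)) = - ln (1 - x) / x"
      using assms by (simp add: field_simps)
    moreover have "1 / real (Suc n) ^ 2 * real (Suc n) * x ^ n = x ^ n / real (Suc n)" for n
      by (simp add: power2_eq_square del: of_nat_Suc)
    ultimately show ?thesis by (simp only:)
  qed
  ultimately show ?thesis
    by (simp add: dilog_def[abs_def] mult.commute)
qed

lemma eq_lim_at_right_if_deriv_zero: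
  fixes h :: "real \<Rightarrow> real"
  assumes der: "\<And>x. x \<in> {a<..<b} \<Longrightarrow> (h has_real_derivative 0) (at x)"
    and lim: "(h \<longlongrightarrow> L) (at_right a)" and x: "x \<in> {a<..<b}"
  shows "h x = L"
proof -
  have ab: "a < b" using x by auto
  have "eventually (\<lambda>t. h t = h x) (at_right a)"
    using eventually_at_right_real[OF ab]
    by eventually_elim (use x der ab in \<open>auto intro: DERIV_isconst3[OF ab]\<close>)
  then have "(h \<longlongrightarrow> h x) (at_right a)" by (rule tendsto_eventually)
  with lim show ?thesis by (metis tendsto_unique trivial_limit_at_right_real)
qed

text \<open>Duplication formula: the derivatives match because 1 - x^2 = (1 - x)(1 + x).\<close>

lemma dilog_minus:
  assumes x: "0 < x" "x < 1"
  shows "dilog x + dilog (- x) = dilog (x\<^sup>2) / 2"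
proof -
  define h where "h x = dilog x + dilog (- x) - dilog (x\<^sup>2) / 2" for x
  have der: "(h has_real_derivative 0) (at x)" if "x \<in> {0<..<1}" for x
  proof -
    from that have sq: "\<bar>x\<^sup>2\<bar> < 1" by (simp add: power_less_one_iff abs_square_less_1)
    have l: "ln (1 - x\<^sup>2) = ln (1 - x) + ln (1 + x)"
    proof -
      have "1 - x\<^sup>2 = (1 - x) * (1 + x)" by (simp add: power2_eq_square algebra_simps)
      then show ?thesis using that by (simp add: ln_mult)
    qed
    have "(h has_real_derivative (- ln (1 - x) / x + - ln (1 - (- x)) / (- x) * (- 1)
        - - ln (1 - x\<^sup>2) / x\<^sup>2 * (2 * x) / 2)) (at x)"
      unfolding h_def[abs_def] using that sq
      by (auto intro!: derivative_eq_intros DERIV_chain2[OF DERIV_dilog])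
    then show ?thesis
      by (rule DERIV_cong) (use that l in \<open>simp add: field_simps power2_eq_square\<close>)
  qed
  have lim: "((\<lambda>t. h t) \<longlongrightarrow> h 0) (at_right 0)"
  proof -
    have "continuous_on {0..1} h"
      unfolding h_def[abs_def]
      by (intro continuous_intros continuous_on_compose2[OF continuous_on_dilog])
         (auto simp: power_le_one abs_square_le_1 intro!: order_trans[OF _ zero_le_power2])
    then have "(h \<longlongrightarrow> h 0) (at 0 within {0..1})" by (force simp: continuous_on)
    then show ?thesis by (simp add: at_within_Icc_at_right)
  qed
  have "h x = h 0"
    by (rule eq_lim_at_right_if_deriv_zero[OF der lim]) (use x in auto)
  then show ?thesis by (simp add: h_def)
qed

text \<open>Euler's reflection formula. The constant is Li_2(1), since ln x ln (1 - x) tends to 0 at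
  0.\<close>

lemma dilog_reflect:
  assumes x: "0 < x" "x < 1"
  shows "dilog x + dilog (1 - x) = pi\<^sup>2 / 6 - ln x * ln (1 - x)"
proof -
  define h where "h x = dilog x + dilog (1 - x) + ln x * ln (1 - x)" for x
  have der: "(h has_real_derivative 0) (at x)" if "x \<in> {0<..<1}" for x
  proof -
    have "(h has_real_derivative (- ln (1 - x) / x + - ln (1 - (1 - x)) / (1 - x) * (- 1)
        + (1 / x * ln (1 - x) + ln x * (1 / (1 - x) * (- 1))))) (at x)"
      unfolding h_def[abs_def] using that
      by (auto intro!: derivative_eq_intros DERIV_chain2[OF DERIV_dilog])
    then show ?thesis
      by (rule DERIV_cong) (use that in \<open>simp add: field_simps\<close>)
  qed
  have lim: "((\<lambda>t. h t) \<longlongrightarrow> dilog 0 + dilog 1 + 0) (at_right 0)"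
  proof -
    have "continuous_on {0..1} (\<lambda>t. dilog t + dilog (1 - t))"
      by (intro continuous_intros continuous_on_compose2[OF continuous_on_dilog]) auto
    then have "((\<lambda>t. dilog t + dilog (1 - t)) \<longlongrightarrow> dilog 0 + dilog 1) (at 0 within {0..1})"
      by (force simp: continuous_on)
    then have "((\<lambda>t. dilog t + dilog (1 - t)) \<longlongrightarrow> dilog 0 + dilog 1) (at_right 0)"
      by (simp add: at_within_Icc_at_right)
    moreover have "((\<lambda>t::real. ln t * ln (1 - t)) \<longlongrightarrow> 0) (at_right 0)"
      by real_asymp
    ultimately show ?thesis unfolding h_def by (rule tendsto_add)
  qed
  have "h x = dilog 0 + dilog 1 + 0"
    by (rule eq_lim_at_right_if_deriv_zero[OF der lim]) (use x in auto)
  then show ?thesis by (simp add: h_def dilog_1)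
qed

text \<open>Landen's identity, resting on 1 - x/(x - 1) = 1/(1 - x). The range x < 1/2 keeps x/(x -
  1) inside (-1, 0), where the series can be differentiated.\<close>

lemma dilog_landen:
  assumes x: "0 < x" "x < 1/2"
  shows "dilog x + dilog (x / (x - 1)) = - (ln (1 - x))\<^sup>2 / 2"
proof -
  define h where "h x = dilog x + dilog (x / (x - 1)) + (ln (1 - x))\<^sup>2 / 2" for x
  have der: "(h has_real_derivative 0) (at x)" if "x \<in> {0<..<1/2}" for x
  proof -
    have w: "\<bar>x / (x - 1)\<bar> < 1" "x / (x - 1) \<noteq> 0" "1 - x / (x - 1) = 1 / (1 - x)"
      using that by (auto simp: field_simps abs_if)
    have rat: "- L / x + L / (x / (x - 1)) * (- 1 / (x - 1)\<^sup>2) + L * (1 / (1 - x) * (- 1)) = 0" for L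
    proof -
      define u where "u = x - 1"
      have nz: "u \<noteq> 0" "x \<noteq> 0" and u: "1 - x = - u" "x = u + 1" using that by (auto simp: u_def)
      have "L / (x / u) * (- 1 / u\<^sup>2) = - (L / (x * u))"
        using nz by (simp add: field_simps power2_eq_square)
      moreover have "- L / x - L / (x * u) + L / u = 0"
        using nz by (simp add: divide_simps) (simp add: u(2) algebra_simps)
      ultimately show ?thesis unfolding u_def[symmetric] u(1) by simp
    qed
    have "((\<lambda>x. x / (x - 1)) has_real_derivative (- 1 / (x - 1)\<^sup>2)) (at x)"
      using that by (auto intro!: derivative_eq_intros simp: power2_eq_square)
    note dw = DERIV_chain2[OF DERIV_dilog[OF w(1,2)] this]
    have dl: "((\<lambda>x. (ln (1 - x))\<^sup>2 / 2) has_real_derivative ln (1 - x) * (1 / (1 - x) * (- 1))) (at x)"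
      using that by (auto intro!: derivative_eq_intros simp: field_simps)
    have "(h has_real_derivative (- ln (1 - x) / x + - ln (1 - x / (x - 1)) / (x / (x - 1)) * (- 1 / (x - 1)\<^sup>2)
        + ln (1 - x) * (1 / (1 - x) * (- 1)))) (at x)"
      unfolding h_def[abs_def] using that
      by (intro DERIV_add dw dl DERIV_dilog) auto
    moreover have "ln (1 - x / (x - 1)) = - ln (1 - x)"
      using that by (simp add: w(3) ln_div)
    ultimately show ?thesis using rat[of "ln (1 - x)"] by (simp only: minus_minus)
  qed
  have lim: "((\<lambda>t. h t) \<longlongrightarrow> h 0) (at_right 0)"
  proof -
    have "continuous_on {0..1/2} h"
      unfolding h_def[abs_def]
      by (intro continuous_intros continuous_on_compose2[OF continuous_on_dilog])
         (auto simp: field_simps)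
    then have "(h \<longlongrightarrow> h 0) (at 0 within {0..1/2})" by (force simp: continuous_on)
    then show ?thesis by (simp add: at_within_Icc_at_right)
  qed
  have "h x = h 0"
    by (rule eq_lim_at_right_if_deriv_zero[where b = "1/2", OF der lim]) (use x in auto)
  then show ?thesis by (simp add: h_def)
qed

text \<open>For y^2 = 1 - y the arguments close up: y^2/(y^2 - 1) = -y and 1 - y = y^2. Landen,
  reflection and duplication then form a linear system in Li_2 at y, -y and y^2, which determines
  the last one.\<close>

lemma dilog_golden:
  assumes "0 < y" "y\<^sup>2 = 1 - y"
  shows "dilog (y\<^sup>2) = pi\<^sup>2 / 15 - (ln y)\<^sup>2"
proof -
  have y1: "y < 1" using assms by (smt (verit) zero_less_power)
  have "y > 1/2"
  proof (rule ccontr)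
    assume "\<not> y > 1/2"
    then have "y\<^sup>2 \<le> (1/2)\<^sup>2" using assms by (intro power_mono) auto
    then show False using assms \<open>\<not> y > 1/2\<close> by (simp add: power2_eq_square)
  qed
  then have y2: "y\<^sup>2 < 1/2" "0 < y\<^sup>2" using assms y1 by auto
  have "y\<^sup>2 / (y\<^sup>2 - 1) = - y"
    using assms(1) by (subst (2) assms(2)) (simp add: power2_eq_square)
  then have "dilog (y\<^sup>2) + dilog (- y) = - (ln y)\<^sup>2 / 2"
    using dilog_landen[OF y2(2,1)] assms by simp
  moreover have "dilog y + dilog (y\<^sup>2) = pi\<^sup>2 / 6 - ln y * ln (y\<^sup>2)"
    using dilog_reflect[of y] y1 assms by simp
  moreover have "ln (y\<^sup>2) = 2 * ln y" using assms(1) ln_realpow[of y 2] by simp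
  moreover have "dilog y + dilog (- y) = dilog (y\<^sup>2) / 2"
    using dilog_minus[of y] y1 assms by simp
  ultimately show ?thesis by (simp add: power2_eq_square)
qed

section \<open>Stirling's formula and Riemann sums\<close>

text \<open>The increments of d_m = ln m! - (m + 1/2) ln m + m are O(1/m^2), so d_m converges. Its
  limit c is also the limit of 2 d_m - d_(2m), which is expressed by Wallis' product.\<close>

lemma stirling_ln:
  "(\<lambda>m. ln (fact m) - (real m * ln (real m) - real m + ln (2 * pi * real m) / 2)) \<longlonglongrightarrow> 0"
proof -
  define d where "d m = ln (fact m) - (real m + 1/2) * ln (real m) + real m" for m
  have diff: "d (m + 1) - d m = 1 - (real m + 1/2) * ln (1 + 1 / real m)" if "m > 0" for m
  proof -
    have f: "ln (fact (m + 1) :: real) = ln (real m + 1) + ln (fact m)"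
      by (simp add: ln_mult add.commute)
    have l: "ln (1 + 1 / real m) = ln (real m + 1) - ln (real m)"
    proof -
      have "1 + 1 / real m = (real m + 1) / real m" using that by (simp add: field_simps)
      then show ?thesis using that by (simp add: ln_div)
    qed
    have "d (m + 1) - d m = (ln (real m + 1) + ln (fact m)) - (real m + 3/2) * ln (real m + 1) + 1
        - ln (fact m) + (real m + 1/2) * ln (real m)"
      using f by (simp add: d_def add.commute[of 1])
    then show ?thesis unfolding l by (simp add: field_simps)
  qed
  have "summable (\<lambda>m. 1 - (real m + 1/2) * ln (1 + 1 / real m))"
  proof (rule summable_comparison_test_bigo)
    show "summable (\<lambda>m. norm (1 / real m ^ 2))"
      using inverse_power_summable[of 2, where 'a = real] by (simp add: inverse_eq_divide)
    show "(\<lambda>m. 1 - (real m + 1/2) * ln (1 + 1 / real m)) \<in> O(\<lambda>m. 1 / real m ^ 2)"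
      by real_asymp
  qed
  then have "summable (\<lambda>m. d (m + 1) - d m)"
    by (rule summable_cong[THEN iffD2, rotated])
       (rule eventually_mono[OF eventually_gt_at_top[of 0]], simp only: diff)
  then have "convergent (\<lambda>n. \<Sum>m<n. d (Suc m) - d m)"
    by (simp add: summable_iff_convergent)
  then have "convergent (\<lambda>n. d n - d 0)"
    by (simp add: sum_lessThan_telescope)
  then have "convergent d"
    by (simp add: convergent_diff_const_right_iff)
  then obtain c where c: "d \<longlonglongrightarrow> c" by (auto simp: convergent_def)
  have c2: "(\<lambda>m. 2 * d m - d (2 * m)) \<longlonglongrightarrow> 2 * c - c"
    by (intro tendsto_intros c filterlim_compose[OF c]) real_asymp
  \<comment> \<open>Partial Wallis product. The next fact writes it through 4^m (m!)^2/(2m)!, the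
    reciprocal of the normalised central binomial coefficient.\<close>
  define W where "W m = (\<Prod>k=1..m. (4*real k^2) / (4*real k^2 - 1))" for m
  have W: "W m = (4 ^ m * fact m ^ 2 / fact (2 * m)) ^ 2 / (2 * real m + 1)" for m
  proof (induction m)
    case (Suc m)
    have "W (Suc m) = W m * (4 * real (Suc m)^2 / (4 * real (Suc m)^2 - 1))"
      by (simp add: W_def)
    also have "4 * real (Suc m)^2 - 1 = (2 * real m + 1) * (2 * real m + 3)"
      by (simp add: power2_eq_square algebra_simps)
    finally have W': "W (Suc m) = (4 ^ m * fact m ^ 2 / fact (2 * m)) ^ 2 / (2 * real m + 1) *
        (4 * real (Suc m)^2 / ((2 * real m + 1) * (2 * real m + 3)))"
      by (simp add: Suc.IH)
    define a where "a = 4 ^ m * fact m ^ 2 / (fact (2 * m) :: real)"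
    have "4 ^ Suc m * fact (Suc m) ^ 2 / (fact (2 * Suc m) :: real) =
        a * (4 * real (Suc m) ^ 2 / ((2 * real m + 1) * (2 * real m + 2)))"
    proof -
      have sq: "(fact (Suc m) :: real) ^ 2 = real (Suc m) ^ 2 * fact m ^ 2"
        by (simp only: fact_Suc power_mult_distrib)
      have f2: "(fact (2 * Suc m) :: real) = (2 * real m + 1) * (2 * real m + 2) * fact (2 * m)"
        by (simp add: algebra_simps)
      show ?thesis unfolding sq f2 a_def by (simp add: mult_ac)
    qed
    also have "4 * real (Suc m) ^ 2 / ((2 * real m + 1) * (2 * real m + 2)) = 2 * real (Suc m) / (2 * real m + 1)"
      by (simp add: divide_simps power2_eq_square) (simp add: algebra_simps)
    finally have fin: "4 ^ Suc m * fact (Suc m) ^ 2 / (fact (2 * Suc m) :: real) =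
        a * (2 * real (Suc m) / (2 * real m + 1))" .
    show ?case
      unfolding W' fin unfolding a_def[symmetric]
      by (simp add: power2_eq_square divide_simps) (simp add: algebra_simps)
  qed (simp add: W_def)
  have lnW: "(\<lambda>m. ln (W m)) \<longlonglongrightarrow> ln (pi / 2)"
    using wallis unfolding W_def by (intro tendsto_ln) auto
  have ln2: "(\<lambda>m. ln (2 * real m + 1) / 2 - ln (real m) / 2) \<longlonglongrightarrow> ln 2 / 2"
    by real_asymp
  have "(\<lambda>m. ln (W m) / 2 + (ln (2 * real m + 1) / 2 - ln (real m) / 2) + ln 2 / 2)
      \<longlonglongrightarrow> ln (pi / 2) / 2 + ln 2 / 2 + ln 2 / 2"
    by (intro tendsto_add tendsto_divide lnW ln2 tendsto_const) simp_all
  also have "ln (pi / 2) / 2 + ln 2 / 2 + ln 2 / 2 = ln (2 * pi) / 2"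
    by (simp add: ln_div ln_mult field_simps)
  finally have "(\<lambda>m. 2 * d m - d (2 * m)) \<longlonglongrightarrow> ln (2 * pi) / 2"
  proof (rule Lim_transform_eventually)
    show "eventually (\<lambda>m. ln (W m) / 2 + (ln (2 * real m + 1) / 2 - ln (real m) / 2) + ln 2 / 2 =
        2 * d m - d (2 * m)) sequentially"
      using eventually_gt_at_top[of 0]
    proof eventually_elim
      case (elim m)
      have "ln (W m) = 2 * (real m * ln 4 + 2 * ln (fact m) - ln (fact (2 * m))) - ln (2 * real m + 1)"
        by (simp add: W ln_div ln_mult ln_realpow)
      moreover have "ln (4 :: real) = 2 * ln 2"
        using ln_realpow[of 2 2] by simp
      moreover have "ln (2 * real m) = ln 2 + ln (real m)" using elim by (simp add: ln_mult)
      ultimately show ?case by (simp add: d_def algebra_simps)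
    qed
  qed
  with c2 have "c = ln (2 * pi) / 2" using LIMSEQ_unique by fastforce
  with c have "(\<lambda>m. d m - ln (2 * pi) / 2) \<longlonglongrightarrow> 0" by (simp add: LIM_zero)
  then show ?thesis
  proof (rule Lim_transform_eventually)
    show "eventually (\<lambda>m. d m - ln (2 * pi) / 2 =
       ln (fact m) - (real m * ln (real m) - real m + ln (2 * pi * real m) / 2)) sequentially"
      using eventually_gt_at_top[of 0]
      by eventually_elim (simp add: d_def ln_mult algebra_simps add_divide_distrib)
  qed
qed

section \<open>Quadrature with explicit errors\<close>

lemma MVT_deriv:
  fixes f f' :: "real \<Rightarrow> real"
  assumes "a < b" "continuous_on {a..b} f"
    and der: "\<And>t. a < t \<Longrightarrow> t < b \<Longrightarrow> (f has_real_derivative f' t) (at t)"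
  obtains t where "a < t" "t < b" "f b - f a = (b - a) * f' t"
proof -
  have "\<exists>l z. a < z \<and> z < b \<and> DERIV f z :> l \<and> f b - f a = (b - a) * l"
    using assms by (intro MVT) (auto simp: real_differentiable_def)
  then show ?thesis using that der by (metis DERIV_unique)
qed

text \<open>The error is bounded by the oscillation of \<open>g'\<close> on the cell and not by a
  second derivative: for monotone \<open>g'\<close> the oscillations of consecutive cells
  telescope.\<close>

lemma trapezoid_cell:
  fixes K g g' :: "real \<Rightarrow> real"
  assumes ab: "a < b" and contK: "continuous_on {a..b} K" and contg: "continuous_on {a..b} g"
    and K: "\<And>t. a < t \<Longrightarrow> t < b \<Longrightarrow> (K has_real_derivative g t) (at t)"
    and g: "\<And>t. a < t \<Longrightarrow> t < b \<Longrightarrow> (g has_real_derivative g' t) (at t)"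
    and bd: "\<And>t. a < t \<Longrightarrow> t < b \<Longrightarrow> lo \<le> g' t \<and> g' t \<le> hi"
  shows "\<bar>K b - K a - (b - a) * (g a + g b) / 2\<bar> \<le> (hi - lo) * (b - a)\<^sup>2 / 2"
proof -
  \<comment> \<open>Trapezoidal error with a moving right end. One mean value theorem for it and
    another for \<open>g\<close> leave only a difference of two values of \<open>g'\<close>.\<close>
  define \<psi> where "\<psi> t = K t - (t - a) * (g a + g t) / 2" for t
  have cont: "continuous_on {a..b} \<psi>"
    unfolding \<psi>_def by (intro continuous_intros contK contg) auto
  have der: "(\<psi> has_real_derivative (g t - ((g a + g t) + (t - a) * g' t) / 2)) (at t)" if "a < t" "t < b" for t
    unfolding \<psi>_def[abs_def]
    using that by (auto intro!: derivative_eq_intros K g simp: field_simps)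
  obtain t where t: "a < t" "t < b" and eq: "\<psi> b - \<psi> a = (b - a) * (g t - ((g a + g t) + (t - a) * g' t) / 2)"
    using MVT_deriv[OF ab cont der] by blast
  obtain r where r: "a < r" "r < t" "g t - g a = (t - a) * g' r"
    by (rule MVT_deriv[of a t g g']) (use t g in \<open>auto intro: continuous_on_subset[OF contg]\<close>)
  have "\<psi> b - \<psi> a = (b - a) * ((t - a) * (g' r - g' t) / 2)"
  proof -
    have e: "g t - ((g a + g t) + (t - a) * g' t) / 2 = (g t - g a) / 2 - (t - a) * g' t / 2"
      by (simp add: field_simps)
    show ?thesis unfolding eq e r(3) by (simp add: field_simps)
  qed
  moreover have "\<bar>(b - a) * ((t - a) * (g' r - g' t) / 2)\<bar> \<le> (b - a) * ((b - a) * (hi - lo) / 2)"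
  proof -
    have "\<bar>g' r - g' t\<bar> \<le> hi - lo" using bd[of r] bd[of t] r t by auto
    then have "(t - a) * \<bar>g' r - g' t\<bar> \<le> (b - a) * (hi - lo)"
      using t by (intro mult_mono) auto
    then show ?thesis using ab t by (simp add: abs_mult)
  qed
  moreover have "\<psi> b - \<psi> a = K b - K a - (b - a) * (g a + g b) / 2"
    by (simp add: \<psi>_def)
  moreover have "(b - a) * ((b - a) * (hi - lo) / 2) = (hi - lo) * (b - a)\<^sup>2 / 2"
    by (simp add: power2_eq_square)
  ultimately show ?thesis by (simp only:)
qed

text \<open>Each increment of \<open>F\<close> lies between two rectangles, and the two rectangle
  sums differ by at most s times the total drop of \<open>f\<close>, which is at most 1.
  \<open>F\<close> is only required to be continuous at 0, because the integrands are singular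
  quotients there.\<close>

lemma riemann_sum_antimono:
  fixes F f :: "real \<Rightarrow> real"
  assumes s: "s > 0" and cont: "continuous_on {0..} F"
    and F: "\<And>t. t > 0 \<Longrightarrow> (F has_real_derivative f t) (at t)"
    and anti: "\<And>t u. 0 < t \<Longrightarrow> t \<le> u \<Longrightarrow> f u \<le> f t"
    and bd: "\<And>t. 0 < t \<Longrightarrow> 0 \<le> f t \<and> f t \<le> 1"
  shows "\<bar>s * (\<Sum>j=1..m. f (s * real j)) - (F (s * real m) - F 0)\<bar> \<le> s"
proof -
  \<comment> \<open>At 0 the upper bound 1 stands in for \<open>f 0\<close>, which for a quotient
    such as u/(e^u - 1) would be 0/0 = 0 and break monotonicity.\<close>
  define fe where "fe j = (if j = 0 then 1 else f (s * real j))" for j :: nat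
  have cell: "s * fe (Suc j) \<le> F (s * real (Suc j)) - F (s * real j) \<and>
      F (s * real (Suc j)) - F (s * real j) \<le> s * fe j" for j
  proof -
    obtain t where t: "s * real j < t" "t < s * real (Suc j)"
      "F (s * real (Suc j)) - F (s * real j) = (s * real (Suc j) - s * real j) * f t"
    proof (rule MVT_deriv[of "s * real j" "s * real (Suc j)" F f])
      show "continuous_on {s * real j..s * real (Suc j)} F"
        by (rule continuous_on_subset[OF cont]) (use s in \<open>auto intro: order_trans[of 0 "s * real j"]\<close>)
      show "(F has_real_derivative f t) (at t)" if "s * real j < t" for t
        by (rule F) (use that s in \<open>auto intro: le_less_trans[of 0 "s * real j"]\<close>)
    qed (use s in auto)
    have "0 < t" using t(1) s by (auto intro: le_less_trans[of 0 "s * real j"])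
    then have "f (s * real (Suc j)) \<le> f t" "f t \<le> fe j"
      using t s bd[of t] anti[of t "s * real (Suc j)"] anti[of "s * real j" t] by (auto simp: fe_def)
    then show ?thesis using s t(3) by (simp add: fe_def algebra_simps)
  qed
  have "s * (\<Sum>j=1..m. f (s * real j)) \<le> F (s * real m) - F 0"
  proof (induction m)
    case (Suc m)
    then show ?case using cell[of m] by (simp add: fe_def distrib_left)
  qed simp
  moreover have "F (s * real m) - F 0 \<le> s * (\<Sum>j=1..m. f (s * real j)) + s * (1 - fe m)"
  proof (induction m)
    case (Suc m)
    then show ?case using cell[of m] by (simp add: fe_def algebra_simps split: if_splits)
  qed (simp add: fe_def)
  moreover have "fe m \<ge> 0" using bd s by (auto simp: fe_def)
  then have "s * (1 - fe m) \<le> s" using s by (simp add: algebra_simps)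
  ultimately show ?thesis using s by linarith
qed

section \<open>Bose-type integrands and their antiderivatives\<close>

definition planck :: "real \<Rightarrow> real" where
  "planck u = u / (exp u - 1)"

text \<open>A geometric variable of ratio e^(-u) has mean 1/(e^u - 1) and variance e^u/(e^u - 1)^2;
  \<open>planck\<close> and \<open>planck2\<close> are the mean and the variance of u times this
  variable.\<close>

definition planck2 :: "real \<Rightarrow> real" where
  "planck2 u = u\<^sup>2 * exp u / (exp u - 1)\<^sup>2"

lemma planck_bounds: "u > 0 \<Longrightarrow> 0 \<le> planck u \<and> planck u \<le> 1"
  using exp_ge_add_one_self[of u] by (simp add: planck_def divide_le_eq del: exp_ge_add_one_self)

lemma planck_antimono:
  assumes "0 < t" "t \<le> u"
  shows "planck u \<le> planck t"
proof (rule DERIV_nonpos_imp_nonincreasing[OF assms(2)])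
  fix x assume "t \<le> x"
  then have x: "x > 0" using assms by simp
  have "(planck has_real_derivative ((exp x - 1) - x * exp x) / (exp x - 1)\<^sup>2) (at x)"
    unfolding planck_def[abs_def] using x
    by (auto intro!: derivative_eq_intros simp: power2_eq_square)
  moreover have "(exp x - 1) - x * exp x \<le> 0"
  proof -
    have "(1 - x) * exp x \<le> exp (- x) * exp x"
      using exp_ge_add_one_self[of "- x"] by (intro mult_right_mono) auto
    then show ?thesis by (simp add: algebra_simps flip: exp_add)
  qed
  ultimately show "\<exists>y. (planck has_real_derivative y) (at x) \<and> y \<le> 0"
    by (meson divide_nonpos_nonneg zero_le_power2)
qed

text \<open>In this form the bound by 1 is sinh v >= v, and monotonicity is that of v/sinh
  v.\<close>

lemma planck2_eq_sinh: "u > 0 \<Longrightarrow> planck2 u = (u / (2 * sinh (u / 2)))\<^sup>2"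
proof -
  assume u: "u > 0"
  define e where "e = exp (u / 2)"
  have e: "e > 1" "exp u = e * e" "sinh (u / 2) = (e - 1 / e) / 2"
    using u by (auto simp: e_def sinh_def exp_minus field_simps simp flip: exp_add)
  have "e * e > 1" using e(1) by (metis less_1_mult)
  then show ?thesis using e(1) unfolding planck2_def e(2,3)
    by (simp add: divide_simps power2_eq_square) (simp add: algebra_simps)
qed

lemma le_sinh: "u \<ge> 0 \<Longrightarrow> u \<le> sinh (u :: real)"
proof -
  assume "u \<ge> 0"
  then have "sinh 0 - 0 \<le> sinh u - u"
    by (intro DERIV_nonneg_imp_nondecreasing[of 0 u "\<lambda>u. sinh u - u"])
       (auto intro!: exI derivative_eq_intros simp: cosh_real_ge_1)
  then show ?thesis by simp
qed

lemma planck2_bounds: "u > 0 \<Longrightarrow> 0 \<le> planck2 u \<and> planck2 u \<le> 1"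
  using le_sinh[of "u / 2"] by (simp add: planck2_eq_sinh abs_square_le_1 divide_le_eq)

lemma planck2_antimono:
  assumes "0 < t" "t \<le> u"
  shows "planck2 u \<le> planck2 t"
proof -
  have "u / (2 * sinh (u / 2)) \<le> t / (2 * sinh (t / 2))"
  proof (rule DERIV_nonpos_imp_nonincreasing[OF assms(2)])
    fix x assume "t \<le> x"
    then have x: "x > 0" using assms by simp
    have "((\<lambda>x. x / (2 * sinh (x / 2))) has_real_derivative
        (2 * sinh (x / 2) - x * cosh (x / 2)) / (2 * sinh (x / 2))\<^sup>2) (at x)"
      using x by (auto intro!: derivative_eq_intros simp: power2_eq_square)
    moreover have "2 * sinh (x / 2) - x * cosh (x / 2) \<le> 2 * sinh (0 / 2) - 0 * cosh (0 / 2)"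
      by (rule DERIV_nonpos_imp_nonincreasing[of 0 x "\<lambda>x. 2 * sinh (x / 2) - x * cosh (x / 2)"])
         (use x in \<open>auto intro!: exI derivative_eq_intros\<close>)
    ultimately show "\<exists>y. ((\<lambda>x. x / (2 * sinh (x / 2))) has_real_derivative y) (at x) \<and> y \<le> 0"
      by (intro exI conjI) (auto intro: divide_nonpos_nonneg)
  qed
  moreover have "0 \<le> u / (2 * sinh (u / 2))" using assms by simp
  ultimately show ?thesis using assms by (simp add: planck2_eq_sinh power_mono)
qed

text \<open>An antiderivative of ln (1 - e^(-u)) that stays continuous at 0; its increment from 0 to
  s m is the leading term of s ln (Q;Q)_m at Q = e^(-s).\<close>

definition bose :: "real \<Rightarrow> real" where
  "bose u = dilog (exp (- u))"

lemma continuous_on_bose: "continuous_on {0..} bose"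
proof -
  have "-1 \<le> exp (- x)" for x :: real using exp_gt_zero[of "- x"] by linarith
  then show ?thesis
    unfolding bose_def[abs_def]
    by (intro continuous_on_compose2[OF continuous_on_dilog] continuous_intros) auto
qed

lemma bose_0: "bose 0 = pi\<^sup>2 / 6"
  by (simp add: bose_def dilog_1)

lemma DERIV_bose: "u > 0 \<Longrightarrow> (bose has_real_derivative ln (1 - exp (- u))) (at u)"
proof -
  assume u: "u > 0"
  have "((\<lambda>u. exp (- u)) has_real_derivative exp (- u) * (- 1)) (at u)"
    by (auto intro!: derivative_eq_intros)
  moreover have "(dilog has_real_derivative (- ln (1 - exp (- u)) / exp (- u))) (at (exp (- u)))"
    using u by (intro DERIV_dilog) auto
  ultimately show ?thesis
    using DERIV_chain2 unfolding bose_def[abs_def] by fastforce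
qed

text \<open>Integration by parts: 1/(e^u - 1) is the derivative of ln (1 - e^(-u)), which in turn is
  the derivative of \<open>bose\<close>.\<close>

definition planck_int :: "real \<Rightarrow> real" where
  "planck_int u = u * ln (1 - exp (- u)) - bose u"

lemma DERIV_planck_int: "u > 0 \<Longrightarrow> (planck_int has_real_derivative planck u) (at u)"
  unfolding planck_int_def[abs_def]
  by (rule derivative_eq_intros DERIV_bose refl | simp)+
     (auto simp: planck_def exp_minus field_simps)

lemma continuous_on_planck_int: "continuous_on {0..} planck_int"
proof -
  have "continuous (at u within {0..}) (\<lambda>u. u * ln (1 - exp (- u)))" if "u \<ge> 0" for u :: real
  proof (cases "u = 0")
    case True
    have "((\<lambda>u::real. u * ln (1 - exp (- u))) \<longlongrightarrow> 0) (at_right 0)" by real_asymp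
    then show ?thesis using True by (simp add: continuous_within at_within_Ici_at_right)
  next
    case False
    with that have "isCont (\<lambda>u. u * ln (1 - exp (- u))) u"
      by (intro continuous_intros) auto
    then show ?thesis by (rule continuous_at_imp_continuous_at_within)
  qed
  then have "continuous_on {0..} (\<lambda>u::real. u * ln (1 - exp (- u)))"
    by (simp add: continuous_on_eq_continuous_within)
  then show ?thesis
    unfolding planck_int_def[abs_def] by (rule continuous_on_diff[OF _ continuous_on_bose])
qed

text \<open>Comes from \<open>planck2\<close> u = \<open>planck\<close> u - u times the derivative
  of \<open>planck\<close> at u, integrated by parts.\<close>

definition planck2_int :: "real \<Rightarrow> real" where
  "planck2_int u = 2 * planck_int u - u * planck u"

lemma DERIV_planck2_int: "u > 0 \<Longrightarrow> (planck2_int has_real_derivative planck2 u) (at u)"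
proof -
  assume u: "u > 0"
  have "(planck has_real_derivative ((exp u - 1) - u * exp u) / (exp u - 1)\<^sup>2) (at u)"
    unfolding planck_def[abs_def] using u
    by (auto intro!: derivative_eq_intros simp: power2_eq_square)
  then have "(planck2_int has_real_derivative 2 * planck u -
      (1 * planck u + ((exp u - 1) - u * exp u) / (exp u - 1)\<^sup>2 * u)) (at u)"
    unfolding planck2_int_def[abs_def]
    by (intro DERIV_diff DERIV_cmult DERIV_mult DERIV_planck_int u DERIV_ident)
  moreover have "2 * planck u - (1 * planck u + ((exp u - 1) - u * exp u) / (exp u - 1)\<^sup>2 * u) = planck2 u"
  proof -
    have "exp u - 1 \<noteq> 0" using u by simp
    then show ?thesis unfolding planck_def planck2_def
      by (simp add: divide_simps power2_eq_square) (simp add: algebra_simps)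
  qed
  ultimately show ?thesis by simp
qed

lemma continuous_on_planck2_int: "continuous_on {0..} planck2_int"
proof -
  have "continuous (at u within {0..}) (\<lambda>u. u * planck u)" if "u \<ge> 0" for u :: real
  proof (cases "u = 0")
    case True
    have "((\<lambda>u::real. u * (u / (exp u - 1))) \<longlongrightarrow> 0) (at_right 0)" by real_asymp
    then show ?thesis using True by (simp add: continuous_within at_within_Ici_at_right planck_def)
  next
    case False
    with that have "isCont (\<lambda>u. u * planck u) u"
      unfolding planck_def by (intro continuous_intros) auto
    then show ?thesis by (rule continuous_at_imp_continuous_at_within)
  qed
  then have "continuous_on {0..} (\<lambda>u::real. u * planck u)"
    by (simp add: continuous_on_eq_continuous_within)
  then show ?thesis
    unfolding planck2_int_def[abs_def]
    by (rule continuous_on_diff[OF continuous_on_mult_left[OF continuous_on_planck_int]])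
qed

text \<open>Dividing \<open>1 - exp (- u)\<close> by \<open>u\<close> removes the logarithmic singularity at \<open>0\<close>.\<close>
definition regln :: "real \<Rightarrow> real" where
  "regln u = (if u = 0 then 0 else ln ((1 - exp (- u)) / u))"

definition regln_int :: "real \<Rightarrow> real" where
  "regln_int u = bose u - (u * ln u - u)"

definition regln_deriv :: "real \<Rightarrow> real" where
  "regln_deriv u = 1 / (exp u - 1) - 1 / u"

lemma continuous_on_regln: "continuous_on {0..} regln"
proof -
  have "continuous (at u within {0..}) regln" if "u \<ge> 0" for u :: real
  proof (cases "u = 0")
    case True
    have "((\<lambda>u::real. ln ((1 - exp (- u)) / u)) \<longlongrightarrow> 0) (at_right 0)" by real_asymp
    then have "(regln \<longlongrightarrow> 0) (at_right 0)"
      by (rule Lim_transform_eventually)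
         (use eventually_at_right_less[of 0] in \<open>auto simp: regln_def elim: eventually_mono\<close>)
    then show ?thesis using True by (simp add: continuous_within at_within_Ici_at_right regln_def)
  next
    case False
    with that have u: "u > 0" by simp
    then have "isCont (\<lambda>u. ln ((1 - exp (- u)) / u)) u"
      by (intro continuous_intros) auto
    moreover have "eventually (\<lambda>v. ln ((1 - exp (- v)) / v) = regln v) (nhds u)"
      using eventually_nhds_in_open[of "{0<..}" u] u
      by (auto simp: regln_def elim: eventually_mono)
    ultimately have "isCont regln u"
      by (simp add: isCont_cong)
    then show ?thesis by (rule continuous_at_imp_continuous_at_within)
  qed
  then show ?thesis by (simp add: continuous_on_eq_continuous_within)
qed

lemma continuous_on_regln_int: "continuous_on {0..} regln_int"
proof -
  have "continuous (at u within {0..}) (\<lambda>u. u * ln u)" if "u \<ge> 0" for u :: real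
  proof (cases "u = 0")
    case True
    have "((\<lambda>u::real. u * ln u) \<longlongrightarrow> 0) (at_right 0)" by real_asymp
    then show ?thesis using True by (simp add: continuous_within at_within_Ici_at_right)
  next
    case False
    with that have "isCont (\<lambda>u. u * ln u) u"
      by (intro continuous_intros) auto
    then show ?thesis by (rule continuous_at_imp_continuous_at_within)
  qed
  then have "continuous_on {0..} (\<lambda>u::real. u * ln u)"
    by (simp add: continuous_on_eq_continuous_within)
  then show ?thesis
    unfolding regln_int_def[abs_def]
    by (rule continuous_on_diff[OF continuous_on_bose continuous_on_diff[OF _ continuous_on_id]])
qed

lemma DERIV_regln_int: "u > 0 \<Longrightarrow> (regln_int has_real_derivative regln u) (at u)"
proof -
  assume u: "u > 0"
  then have "(regln_int has_real_derivative (ln (1 - exp (- u)) - ((1 * ln u + 1 / u * u) - 1))) (at u)"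
    unfolding regln_int_def[abs_def]
    by (intro DERIV_diff DERIV_mult DERIV_bose DERIV_ident DERIV_ln_divide)
  then show ?thesis using u by (simp add: regln_def ln_div)
qed

lemma DERIV_regln: "u > 0 \<Longrightarrow> (regln has_real_derivative regln_deriv u) (at u)"
proof -
  assume u: "u > 0"
  then have "((\<lambda>u. ln (1 - exp (- u)) - ln u) has_real_derivative regln_deriv u) (at u)"
    by (auto intro!: derivative_eq_intros simp: regln_deriv_def exp_minus field_simps)
  then show ?thesis
    by (rule DERIV_cong_ev[THEN iffD1, rotated 3])
       (use u eventually_nhds_in_open[of "{0<..}" u] in \<open>auto simp: regln_def ln_div elim: eventually_mono\<close>)
qed

text \<open>The derivative equals (1 - \<open>planck2\<close> x)/x^2, so convexity of
  \<open>regln\<close> is the same inequality as the bound of \<open>planck2\<close> by 1.\<close>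

lemma regln_deriv_mono:
  assumes "0 < t" "t \<le> u"
  shows "regln_deriv t \<le> regln_deriv u"
proof (rule DERIV_nonneg_imp_nondecreasing[OF assms(2)])
  fix x assume "t \<le> x"
  then have x: "x > 0" using assms by simp
  then have ne: "exp x - 1 \<noteq> 0" by simp
  have "(regln_deriv has_real_derivative (1 / x\<^sup>2 - exp x / (exp x - 1)\<^sup>2)) (at x)"
    unfolding regln_deriv_def[abs_def] using x
    by (auto intro!: derivative_eq_intros simp: power2_eq_square)
  moreover have "1 / x\<^sup>2 - exp x / (exp x - 1)\<^sup>2 = (1 - planck2 x) / x\<^sup>2"
    using x ne by (simp add: planck2_def diff_divide_distrib)
  ultimately show "\<exists>y. (regln_deriv has_real_derivative y) (at x) \<and> 0 \<le> y"
    using planck2_bounds[OF x] by (metis diff_ge_0_iff_ge divide_nonneg_nonneg zero_le_power2)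
qed

lemma regln_deriv_bounds:
  assumes "u > 0"
  shows "-1 \<le> regln_deriv u" "regln_deriv u \<le> 0"
proof -
  have "u \<le> exp u - 1" using exp_ge_add_one_self[of u] by linarith
  then show "regln_deriv u \<le> 0"
    using assms by (simp add: regln_deriv_def field_simps)
  have "(1 - u) * exp u \<le> exp (- u) * exp u"
    using exp_ge_add_one_self[of "- u"] by (intro mult_right_mono) auto
  then have "(1 - u) * exp u \<le> 1" by (simp flip: exp_add)
  then show "-1 \<le> regln_deriv u"
    using assms by (simp add: regln_deriv_def field_simps)
qed

text \<open>Euler-Maclaurin with the endpoint correction. Since \<open>regln_deriv\<close> increases
  within [-1, 0], the cell errors telescope to at most s^2/2; dividing by s leaves a bound that does
  not depend on m.\<close>

lemma sum_regln:
  assumes s: "s > 0"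
  shows "\<bar>(\<Sum>j=1..m. regln (s * real j)) -
     ((regln_int (s * real m) - regln_int 0) / s + regln (s * real m) / 2)\<bar> \<le> s / 2"
proof -
  \<comment> \<open>The value -1 is a lower bound for the slope on the first cell;
    \<open>regln_deriv 0\<close> would be 0 through division by zero.\<close>
  define ge where "ge j = (if j = 0 then - 1 else regln_deriv (s * real j))" for j :: nat
  define R where "R m = regln_int (s * real m) - regln_int 0 -
      s * ((\<Sum>j=1..m. regln (s * real j)) - regln (s * real m) / 2)" for m
  have cell: "\<bar>regln_int (s * real (Suc j)) - regln_int (s * real j) -
      s * (regln (s * real j) + regln (s * real (Suc j))) / 2\<bar> \<le> (ge (Suc j) - ge j) * s\<^sup>2 / 2" for j
  proof -
    have d: "s * real (Suc j) - s * real j = s" by (simp add: algebra_simps)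
    have ge0: "0 \<le> s * real j" using s by simp
    have "\<bar>regln_int (s * real (Suc j)) - regln_int (s * real j) -
      (s * real (Suc j) - s * real j) * (regln (s * real j) + regln (s * real (Suc j))) / 2\<bar>
      \<le> (ge (Suc j) - ge j) * (s * real (Suc j) - s * real j)\<^sup>2 / 2"
    proof (rule trapezoid_cell[where g' = regln_deriv])
      show "continuous_on {s * real j..s * real (Suc j)} regln_int"
        by (rule continuous_on_subset[OF continuous_on_regln_int]) (use ge0 in auto)
      show "continuous_on {s * real j..s * real (Suc j)} regln"
        by (rule continuous_on_subset[OF continuous_on_regln]) (use ge0 in auto)
      fix t assume t: "s * real j < t" "t < s * real (Suc j)"
      then have "t > 0" using ge0 by linarith
      then show "(regln_int has_real_derivative regln t) (at t)"
        "(regln has_real_derivative regln_deriv t) (at t)"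
        by (simp_all add: DERIV_regln DERIV_regln_int)
      show "ge j \<le> regln_deriv t \<and> regln_deriv t \<le> ge (Suc j)"
        using regln_deriv_bounds[OF \<open>t > 0\<close>] regln_deriv_mono[of "s * real j" t] t \<open>t > 0\<close> s
          regln_deriv_mono[of t "s * real (Suc j)"] by (auto simp: ge_def)
    qed (use s in auto)
    then show ?thesis unfolding d .
  qed
  have "\<bar>R m\<bar> \<le> (ge m + 1) * s\<^sup>2 / 2"
  proof (induction m)
    case (Suc m)
    have "R (Suc m) = R m + (regln_int (s * real (Suc m)) - regln_int (s * real m) -
      s * (regln (s * real m) + regln (s * real (Suc m))) / 2)"
      by (simp add: R_def field_simps)
    moreover have "(ge (Suc m) + 1) * s\<^sup>2 / 2 = (ge m + 1) * s\<^sup>2 / 2 + (ge (Suc m) - ge m) * s\<^sup>2 / 2"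
      by (simp add: field_simps)
    ultimately show ?case using cell[of m] Suc.IH by linarith
  qed (simp add: R_def ge_def regln_def)
  also have "ge m \<le> 0" using regln_deriv_bounds(2)[of "s * real m"] s by (auto simp: ge_def)
  then have "(ge m + 1) * s\<^sup>2 / 2 \<le> 1 * s\<^sup>2 / 2"
    by (intro divide_right_mono mult_right_mono) auto
  finally have "\<bar>R m\<bar> / s \<le> 1 * s\<^sup>2 / 2 / s" using s by (intro divide_right_mono) auto
  moreover have "(\<Sum>j=1..m. regln (s * real j)) -
     ((regln_int (s * real m) - regln_int 0) / s + regln (s * real m) / 2) = - R m / s"
    using s by (simp add: R_def field_simps)
  ultimately show ?thesis using s by (simp add: power2_eq_square)
qed

text \<open>Write ln (1 - e^(-sj)) as \<open>regln\<close> at sj plus ln j + ln s. The first part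
  obeys the trapezoidal rule, the logarithms of j sum to ln m!, and the terms of size m ln m cancel.
  The Stirling error \<open>E\<close> stays explicit, so the estimate holds for each s and m
  separately.\<close>

lemma sum_ln_qfac:
  assumes s: "s > 0" and m: "m > 0"
  defines "E \<equiv> \<lambda>m. ln (fact m) - (real m * ln (real m) - real m + ln (2 * pi * real m) / 2)"
  shows "\<bar>(\<Sum>j=1..m. ln (1 - exp (- (s * real j)))) -
     ((bose (s * real m) - pi\<^sup>2 / 6) / s + ln (2 * pi / s) / 2 + ln (1 - exp (- (s * real m))) / 2)\<bar>
     \<le> s / 2 + \<bar>E m\<bar>"
proof -
  have "(\<Sum>j=1..m. ln (1 - exp (- (s * real j)))) = (\<Sum>j=1..m. regln (s * real j) + (ln (real j) + ln s))"
    using s by (intro sum.cong refl) (auto simp: regln_def ln_div ln_mult)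
  also have "\<dots> = (\<Sum>j=1..m. regln (s * real j)) + ln (fact m) + real m * ln s"
  proof -
    have "ln (fact m) = (\<Sum>j=1..m. ln (real j))"
      by (induction m) (simp_all add: ln_mult add.commute flip: of_nat_Suc)
    then show ?thesis by (simp add: sum.distrib)
  qed
  finally have 1: "(\<Sum>j=1..m. ln (1 - exp (- (s * real j)))) = \<dots>" .
  define u where "u = s * real m"
  have u: "u > 0" and lm: "ln (real m) = ln u - ln s" and ms: "real m = u / s"
    using s m by (auto simp: u_def ln_mult)
  have 2: "(regln_int u - regln_int 0) / s + regln u / 2 + (real m * ln (real m) - real m + ln (2 * pi * real m) / 2)
    + real m * ln s = (bose u - pi\<^sup>2 / 6) / s + ln (2 * pi / s) / 2 + ln (1 - exp (- u)) / 2"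
  proof -
    have a: "(regln_int u - regln_int 0) / s = (bose u - pi\<^sup>2 / 6) / s - real m * ln u + real m"
      using s by (simp add: regln_int_def bose_0 ms field_simps)
    have r: "regln u = ln (1 - exp (- u)) - ln u" using u by (simp add: regln_def ln_div)
    have l: "ln (2 * pi * real m) = ln (2 * pi / s) + ln u"
      using s u by (simp add: ms ln_div ln_mult)
    show ?thesis
      by (simp only: a r l lm) (simp add: algebra_simps add_divide_distrib diff_divide_distrib)
  qed
  show ?thesis
    using sum_regln[OF s, of m] unfolding 1 u_def[symmetric] 2[symmetric] E_def by linarith
qed

section \<open>The saddle point\<close>

lemma seq_between_tendsto:
  fixes u r :: "nat \<Rightarrow> real"
  assumes "u \<longlonglongrightarrow> c" "\<And>n. \<bar>r n - c\<bar> \<le> \<bar>u n - c\<bar>"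
  shows "r \<longlonglongrightarrow> c"
proof -
  have "(\<lambda>n. \<bar>u n - c\<bar>) \<longlonglongrightarrow> 0"
    using assms(1) by (simp add: tendsto_rabs_zero_iff LIM_zero)
  then have "(\<lambda>n. r n - c) \<longlonglongrightarrow> 0"
    by (rule Lim_null_comparison[rotated]) (use assms(2) in auto)
  then show ?thesis by (rule LIM_zero_cancel)
qed

lemma scaled_seq_tendsto:
  fixes u s :: "nat \<Rightarrow> real"
  assumes "\<And>n. s n > 0" "s \<longlonglongrightarrow> 0" "(\<lambda>n. (u n - c) / sqrt (s n)) \<longlonglongrightarrow> x"
  shows "u \<longlonglongrightarrow> c"
proof -
  have "(\<lambda>n. (u n - c) / sqrt (s n) * sqrt (s n)) \<longlonglongrightarrow> x * sqrt 0"
    by (intro tendsto_intros assms)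
  moreover have "(u n - c) / sqrt (s n) * sqrt (s n) = u n - c" for n
    using assms(1)[of n] by simp
  ultimately have "(\<lambda>n. u n - c) \<longlonglongrightarrow> 0" by simp
  then show ?thesis by (rule LIM_zero_cancel)
qed

lemma taylor1_scaled:
  fixes u s :: "nat \<Rightarrow> real" and f f' :: "real \<Rightarrow> real"
  assumes s: "\<And>n. s n > 0" "s \<longlonglongrightarrow> 0" and u: "(\<lambda>n. (u n - c) / sqrt (s n)) \<longlonglongrightarrow> x"
    and pos: "\<And>n. u n > 0" "c > 0"
    and f: "\<And>t. t > 0 \<Longrightarrow> (f has_real_derivative f' t) (at t)" and cont: "isCont f' c"
  shows "(\<lambda>n. (f (u n) - f c) / sqrt (s n)) \<longlonglongrightarrow> f' c * x"
proof -
  have "\<exists>r. \<bar>r - c\<bar> \<le> \<bar>u n - c\<bar> \<and> f (u n) - f c = f' r * (u n - c)" for n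
  proof (cases "u n = c")
    case False
    define a b where "a = min (u n) c" and "b = max (u n) c"
    have ab: "a < b" "a > 0" using False pos by (auto simp: a_def b_def)
    have "continuous_on {a..b} f"
      by (rule DERIV_continuous_on[of _ _ f'], rule has_field_derivative_at_within, rule f) (use ab in auto)
    then obtain r where "a < r" "r < b" "f b - f a = (b - a) * f' r"
      using ab f by (auto elim!: MVT_deriv[of a b f f'])
    then show ?thesis
      by (intro exI[of _ r]) (auto simp: a_def b_def min_def max_def algebra_simps split: if_splits)
  qed (auto intro: exI[of _ c])
  then obtain r where r: "\<And>n. \<bar>r n - c\<bar> \<le> \<bar>u n - c\<bar>" "\<And>n. f (u n) - f c = f' (r n) * (u n - c)"
    by metis
  have "r \<longlonglongrightarrow> c"
    by (rule seq_between_tendsto[OF scaled_seq_tendsto[OF s u] r(1)])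
  then have "(\<lambda>n. f' (r n) * ((u n - c) / sqrt (s n))) \<longlonglongrightarrow> f' c * x"
    by (intro tendsto_intros u isCont_tendsto_compose[OF cont])
  then show ?thesis by (simp add: r(2))
qed

text \<open>At a critical point the linear term drops out, so a deviation of order sqrt s in the
  argument becomes one of order s in the value.\<close>

lemma taylor2_scaled:
  fixes u s :: "nat \<Rightarrow> real" and f f' f'' :: "real \<Rightarrow> real"
  assumes s: "\<And>n. s n > 0" "s \<longlonglongrightarrow> 0" and u: "(\<lambda>n. (u n - c) / sqrt (s n)) \<longlonglongrightarrow> x"
    and pos: "\<And>n. u n > 0" "c > 0"
    and f: "\<And>t. t > 0 \<Longrightarrow> (f has_real_derivative f' t) (at t)"
    and f': "\<And>t. t > 0 \<Longrightarrow> (f' has_real_derivative f'' t) (at t)"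
    and cont: "isCont f'' c" and crit: "f' c = 0"
  shows "(\<lambda>n. (f (u n) - f c) / s n) \<longlonglongrightarrow> f'' c / 2 * x\<^sup>2"
proof -
  have "\<exists>r. \<bar>r - c\<bar> \<le> \<bar>u n - c\<bar> \<and> f (u n) - f c = f'' r / 2 * (u n - c)\<^sup>2" for n
  proof (cases "u n = c")
    case False
    define a b where "a = min (u n) c" and "b = max (u n) c"
    have ab: "a < b" "a > 0" using False pos by (auto simp: a_def b_def)
    define diff where "diff m = (if m = 0 then f else if m = 1 then f' else f'')" for m :: nat
    have "\<exists>t. (if u n < c then u n < t \<and> t < c else c < t \<and> t < u n) \<and>
        f (u n) = (\<Sum>m<2. diff m c / fact m * (u n - c) ^ m) + diff 2 t / fact 2 * (u n - c) ^ 2"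
    proof (rule Taylor[of 2 diff f a b c "u n"])
      show "\<forall>m t. m < 2 \<and> a \<le> t \<and> t \<le> b \<longrightarrow> DERIV (diff m) t :> diff (Suc m) t"
        using ab f f' by (auto simp: diff_def)
    qed (use False in \<open>auto simp: diff_def a_def b_def\<close>)
    then obtain t where "if u n < c then u n < t \<and> t < c else c < t \<and> t < u n"
      "f (u n) = (\<Sum>m<2. diff m c / fact m * (u n - c) ^ m) + diff 2 t / fact 2 * (u n - c) ^ 2"
      by blast
    then show ?thesis
      by (intro exI[of _ t]) (auto simp: diff_def crit numeral_2_eq_2 split: if_splits)
  qed (auto intro: exI[of _ c])
  then obtain r where r: "\<And>n. \<bar>r n - c\<bar> \<le> \<bar>u n - c\<bar>" "\<And>n. f (u n) - f c = f'' (r n) / 2 * (u n - c)\<^sup>2"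
    by metis
  have "r \<longlonglongrightarrow> c"
    by (rule seq_between_tendsto[OF scaled_seq_tendsto[OF s u] r(1)])
  then have "(\<lambda>n. f'' (r n) / 2 * ((u n - c) / sqrt (s n))\<^sup>2) \<longlonglongrightarrow> f'' c / 2 * x\<^sup>2"
    by (intro tendsto_intros u isCont_tendsto_compose[OF cont]) auto
  moreover have "f'' (r n) / 2 * ((u n - c) / sqrt (s n))\<^sup>2 = (f (u n) - f c) / s n" for n
    using s(1)[of n] by (simp add: r(2) power_divide)
  ultimately show ?thesis by (simp only:)
qed

section \<open>The critical point and its special values\<close>

definition golden :: real where "golden = (sqrt 5 - 1) / 2"

definition saddle :: real where "saddle = - 2 * ln golden"

lemma golden_pos: "golden > 0" and golden_less_1: "golden < 1" and golden_sq: "golden\<^sup>2 = 1 - golden"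
proof -
  have s: "sqrt 5 * sqrt 5 = (5 :: real)" by simp
  have "2 < sqrt (5 :: real)" by (rule real_less_rsqrt) simp
  then show "golden > 0" by (simp add: golden_def)
  have "sqrt (5 :: real) < 3" by (rule real_less_lsqrt) auto
  then show "golden < 1" by (simp add: golden_def)
  show "golden\<^sup>2 = 1 - golden"
    using s by (simp add: golden_def power2_eq_square field_simps)
qed

text \<open>The number 1/2 is the threshold for s m above which decay of the characteristic function
  is established; the peak has to lie strictly above it.\<close>

lemma saddle_gt: "saddle > 1 / 2"
proof -
  have "sqrt (5 :: real) < 5 / 2" by (rule real_less_lsqrt) (auto simp: power2_eq_square)
  then have "golden < 3 / 4" by (simp add: golden_def)
  then have "ln golden < - (1 / 4)" using ln_le_minus_one[OF golden_pos] by linarith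
  then show ?thesis by (simp add: saddle_def)
qed

lemma saddle_pos: "saddle > 0" using saddle_gt by linarith

lemma exp_minus_saddle: "exp (- saddle) = golden\<^sup>2"
  using golden_pos exp_of_nat_mult[of 2 "ln golden"] by (simp add: saddle_def)

text \<open>The critical equation of \<open>free_energy\<close>: with y = e^(-u/2) it reads 1 - y^2
  = y.\<close>

lemma ln_saddle: "ln (1 - exp (- saddle)) = - saddle / 2"
  unfolding exp_minus_saddle golden_sq by (simp add: saddle_def)

lemma inverse_exp_saddle: "1 / (exp saddle - 1) = golden"
proof -
  have "exp saddle = 1 / golden\<^sup>2"
    using exp_minus_saddle by (metis exp_minus inverse_eq_divide inverse_inverse_eq)
  moreover have "1 / golden\<^sup>2 - 1 = 1 / golden"
  proof -
    have "1 - golden\<^sup>2 = golden" by (simp add: golden_sq)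
    then have "(1 - golden\<^sup>2) / golden\<^sup>2 = golden / golden\<^sup>2" by simp
    then show ?thesis using golden_pos by (simp add: diff_divide_distrib power2_eq_square)
  qed
  ultimately show ?thesis by simp
qed

text \<open>Leading exponent, multiplied by s, of e^(-s m^2/4)/(Q;Q)_m at Q = e^(-s), as a function
  of u = s m.\<close>

definition free_energy :: "real \<Rightarrow> real" where
  "free_energy u = pi\<^sup>2 / 6 - bose u - u\<^sup>2 / 4"

lemma free_energy_saddle: "free_energy saddle = pi\<^sup>2 / 10"
proof -
  have "bose saddle = pi\<^sup>2 / 15 - (ln golden)\<^sup>2"
    unfolding bose_def exp_minus_saddle by (rule dilog_golden[OF golden_pos golden_sq])
  then show ?thesis by (simp add: free_energy_def saddle_def power2_eq_square)
qed

lemma planck_saddle: "planck saddle = saddle * golden"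
  using inverse_exp_saddle by (simp add: planck_def divide_inverse)

lemma planck_int_0: "planck_int 0 = - pi\<^sup>2 / 6"
  by (simp add: planck_int_def bose_0)

lemma planck_int_saddle: "planck_int saddle = pi\<^sup>2 / 10 - saddle\<^sup>2 / 4 - pi\<^sup>2 / 6"
  using free_energy_saddle unfolding planck_int_def ln_saddle free_energy_def
  by (simp add: power2_eq_square)

text \<open>Limit of s^3 times the variance of the geometric sum near the peak, i.e. the integral of
  \<open>planck2\<close> from 0 to \<open>saddle\<close>.\<close>

definition var_lim :: real where "var_lim = pi\<^sup>2 / 5 - saddle\<^sup>2 * sqrt 5 / 2"

lemma planck2_int_saddle: "planck2_int saddle - planck2_int 0 = var_lim"
  unfolding planck2_int_def planck_int_saddle planck_int_0 planck_saddle var_lim_def golden_def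
  by (simp add: power2_eq_square field_simps)

text \<open>The sign is not apparent from the closed form; it is read off from the integral of the
  positive function \<open>planck2\<close>.\<close>

lemma var_lim_pos: "var_lim > 0"
proof -
  obtain t where t: "0 < t" "planck2_int saddle - planck2_int 0 = (saddle - 0) * planck2 t"
    by (rule MVT_deriv[of 0 saddle planck2_int planck2])
       (use saddle_pos DERIV_planck2_int continuous_on_subset[OF continuous_on_planck2_int] in auto)
  have "planck2 t > 0" using t(1) by (simp add: planck2_eq_sinh)
  then have "saddle * planck2 t > 0" using saddle_pos by simp
  then show ?thesis using t(2) by (simp add: planck2_int_saddle)
qed

text \<open>Value of the circle integrand at t = 0: e^(sN)/(Q;Q)_m with Q = e^(-s) and N = pi^2/(10
  s^2) - m(m+1)/4.\<close>

definition weight :: "real \<Rightarrow> nat \<Rightarrow> real" where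
  "weight s m = exp (pi\<^sup>2 / (10 * s) - s * real m * (real m + 1) / 4) / (\<Prod>j=1..m. 1 - exp (- (s * real j)))"

lemma weight_pos: "s > 0 \<Longrightarrow> weight s m > 0"
  unfolding weight_def by (intro divide_pos_pos prod_pos) auto

lemma ln_weight:
  assumes "s > 0"
  shows "ln (weight s m) = pi\<^sup>2 / (10 * s) - s * real m * (real m + 1) / 4 - (\<Sum>j=1..m. ln (1 - exp (- (s * real j))))"
proof -
  have "ln (\<Prod>j=1..m. 1 - exp (- (s * real j))) = (\<Sum>j=1..m. ln (1 - exp (- (s * real j))))"
    using assms by (intro ln_prod) auto
  moreover have "(\<Prod>j=1..m. 1 - exp (- (s * real j))) > 0"
    using assms by (intro prod_pos) auto
  ultimately show ?thesis by (simp add: weight_def ln_div)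
qed

text \<open>The second derivative at \<open>saddle\<close> is -\<open>golden\<close> - 1/2 = -(sqrt
  5)/2.\<close>

lemma free_energy_second_order:
  fixes s u :: "nat \<Rightarrow> real"
  assumes s: "\<And>n. s n > 0" "s \<longlonglongrightarrow> 0" and u: "(\<lambda>n. (u n - saddle) / sqrt (s n)) \<longlonglongrightarrow> x"
    and pos: "\<And>n. u n > 0"
  shows "(\<lambda>n. (free_energy (u n) - pi\<^sup>2 / 10) / s n) \<longlonglongrightarrow> - sqrt 5 / 4 * x\<^sup>2"
proof -
  define f' where "f' u = - ln (1 - exp (- u)) - u / 2" for u :: real
  define f'' where "f'' u = - 1 / (exp u - 1) - 1 / 2" for u :: real
  have "(\<lambda>n. (free_energy (u n) - free_energy saddle) / s n) \<longlonglongrightarrow> f'' saddle / 2 * x\<^sup>2"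
  proof (rule taylor2_scaled[OF s u pos saddle_pos])
    fix t :: real assume t: "t > 0"
    show "(free_energy has_real_derivative f' t) (at t)"
      unfolding free_energy_def[abs_def] f'_def
      by (auto intro!: derivative_eq_intros DERIV_bose t)
    show "(f' has_real_derivative f'' t) (at t)"
      unfolding f'_def[abs_def] f''_def using t
      by (auto intro!: derivative_eq_intros simp: exp_minus field_simps)
  next
    show "isCont f'' saddle" unfolding f''_def using saddle_pos by (intro continuous_intros) auto
    show "f' saddle = 0" by (simp add: f'_def ln_saddle)
  qed
  moreover have "f'' saddle / 2 = - sqrt 5 / 4"
    using inverse_exp_saddle by (simp add: f''_def golden_def field_simps)
  ultimately show ?thesis by (simp only: free_energy_saddle)
qed

text \<open>In the logarithm pi^2/(10 s) occurs twice, from e^(sN) and from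
  \<open>free_energy\<close> at \<open>saddle\<close>. The term -ln (2 pi/s)/2 supplies sqrt s, and
  the bounded terms in u/4 and ln (1 - e^(-u))/2 cancel by the critical equation.\<close>

lemma weight_asymp:
  fixes s :: "nat \<Rightarrow> real" and m :: "nat \<Rightarrow> nat"
  assumes s: "\<And>n. s n > 0" "s \<longlonglongrightarrow> 0" and m: "\<And>n. m n > 0"
    and u: "(\<lambda>n. (s n * real (m n) - saddle) / sqrt (s n)) \<longlonglongrightarrow> x"
  shows "(\<lambda>n. weight (s n) (m n) * exp (- (pi\<^sup>2 / (5 * s n))) / sqrt (s n))
    \<longlonglongrightarrow> exp (- (sqrt 5 / 4 * x\<^sup>2)) / sqrt (2 * pi)"
proof -
  define U where "U n = s n * real (m n)" for n
  have Upos: "U n > 0" for n using s m by (simp add: U_def)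
  define E where "E = (\<lambda>m. ln (fact m) - (real m * ln (real m) - real m + ln (2 * pi * real m) / 2))"
  define S where "S n = (\<Sum>j=1..m n. ln (1 - exp (- (s n * real j))))" for n
  define A where "A n = (bose (U n) - pi\<^sup>2 / 6) / s n + ln (2 * pi / s n) / 2 + ln (1 - exp (- U n)) / 2" for n
  have Ulim: "U \<longlonglongrightarrow> saddle"
    by (rule scaled_seq_tendsto[OF s]) (use u in \<open>simp add: U_def\<close>)
  have minf: "filterlim m at_top sequentially"
  proof -
    have "filterlim (\<lambda>n. inverse (s n)) at_top sequentially"
      by (rule filterlim_inverse_at_top[OF s(2)]) (simp add: s(1))
    then have "filterlim (\<lambda>n. U n * inverse (s n)) at_top sequentially"
      by (rule filterlim_tendsto_pos_mult_at_top[OF Ulim saddle_pos])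
    moreover have "U n * inverse (s n) = real (m n)" for n
      using s(1)[of n] by (simp add: U_def)
    ultimately have "filterlim (\<lambda>n. real (m n)) at_top sequentially" by (simp only:)
    then show ?thesis
      unfolding filterlim_at_top by (metis (mono_tags, lifting) eventually_mono of_nat_le_iff)
  qed
  have SA: "(\<lambda>n. S n - A n) \<longlonglongrightarrow> 0"
  proof (rule Lim_null_comparison)
    show "eventually (\<lambda>n. norm (S n - A n) \<le> s n / 2 + \<bar>E (m n)\<bar>) sequentially"
      using sum_ln_qfac[OF s(1) m] by (simp add: S_def A_def U_def E_def)
    have "(\<lambda>n. s n / 2 + \<bar>E (m n)\<bar>) \<longlonglongrightarrow> 0 / 2 + \<bar>0\<bar>"
      using filterlim_compose[OF stirling_ln minf] unfolding E_def
      by (intro tendsto_intros s) auto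
    then show "(\<lambda>n. s n / 2 + \<bar>E (m n)\<bar>) \<longlonglongrightarrow> 0" by simp
  qed
  have FE: "(\<lambda>n. (free_energy (U n) - pi\<^sup>2 / 10) / s n) \<longlonglongrightarrow> - sqrt 5 / 4 * x\<^sup>2"
    by (rule free_energy_second_order[OF s _ Upos]) (use u in \<open>simp add: U_def\<close>)
  have RE: "(\<lambda>n. - (U n / 4) - ln (1 - exp (- U n)) / 2 - ln (2 * pi) / 2)
      \<longlonglongrightarrow> - (saddle / 4) - ln (1 - exp (- saddle)) / 2 - ln (2 * pi) / 2"
    using saddle_pos by (intro tendsto_intros Ulim) auto
  have "(\<lambda>n. (free_energy (U n) - pi\<^sup>2 / 10) / s n +
      (- (U n / 4) - ln (1 - exp (- U n)) / 2 - ln (2 * pi) / 2) - (S n - A n)) \<longlonglongrightarrow>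
      - sqrt 5 / 4 * x\<^sup>2 + (- (saddle / 4) - ln (1 - exp (- saddle)) / 2 - ln (2 * pi) / 2) - 0"
    by (rule tendsto_diff[OF tendsto_add[OF FE RE] SA])
  also have "(\<lambda>n. (free_energy (U n) - pi\<^sup>2 / 10) / s n +
      (- (U n / 4) - ln (1 - exp (- U n)) / 2 - ln (2 * pi) / 2) - (S n - A n)) =
      (\<lambda>n. ln (weight (s n) (m n)) - pi\<^sup>2 / (5 * s n) - ln (s n) / 2)"
  proof
    fix n
    have sn: "s n > 0" by (rule s)
    have e: "s n * real (m n) * (real (m n) + 1) / 4 = (U n)\<^sup>2 / 4 / s n + U n / 4"
      using sn by (simp add: U_def field_simps power2_eq_square)
    have l: "ln (2 * pi / s n) = ln (2 * pi) - ln (s n)" using sn by (simp add: ln_div)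
    show "(free_energy (U n) - pi\<^sup>2 / 10) / s n +
      (- (U n / 4) - ln (1 - exp (- U n)) / 2 - ln (2 * pi) / 2) - (S n - A n) =
      ln (weight (s n) (m n)) - pi\<^sup>2 / (5 * s n) - ln (s n) / 2"
      unfolding ln_weight[OF sn] e A_def l free_energy_def S_def[symmetric]
      by (simp add: diff_divide_distrib add_divide_distrib)
  qed
  finally have lim: "(\<lambda>n. ln (weight (s n) (m n)) - pi\<^sup>2 / (5 * s n) - ln (s n) / 2) \<longlonglongrightarrow>
     - (sqrt 5 / 4 * x\<^sup>2) - ln (2 * pi) / 2"
    by (simp add: ln_saddle)
  have "exp (ln (weight (s n) (m n)) - pi\<^sup>2 / (5 * s n) - ln (s n) / 2) =
      weight (s n) (m n) * exp (- (pi\<^sup>2 / (5 * s n))) / sqrt (s n)" for n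
  proof -
    have "ln (weight (s n) (m n)) - pi\<^sup>2 / (5 * s n) - ln (s n) / 2 =
        ln (weight (s n) (m n)) + - (pi\<^sup>2 / (5 * s n)) - ln (sqrt (s n))"
      using s(1)[of n] by (simp add: ln_sqrt)
    then show ?thesis
      using s(1)[of n] weight_pos[OF s(1), of n "m n"] by (simp only: exp_diff exp_add) simp
  qed
  moreover have "exp (- (sqrt 5 / 4 * x\<^sup>2) - ln (2 * pi) / 2) = exp (- (sqrt 5 / 4 * x\<^sup>2)) / sqrt (2 * pi)"
  proof -
    have "ln (2 * pi) / 2 = ln (sqrt (2 * pi))" by (simp add: ln_sqrt)
    then show ?thesis by (simp only: exp_diff) simp
  qed
  ultimately show ?thesis using tendsto_exp[OF lim] by simp
qed

text \<open>With one radius for all m, the target N misses the mean of the geometric sum by an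
  amount linear in the deviation x. The standard deviation has order s^(-3/2), so on this scale the
  shift survives in the limit.\<close>

lemma mean_asymp:
  fixes s :: "nat \<Rightarrow> real" and m :: "nat \<Rightarrow> nat"
  assumes s: "\<And>n. s n > 0" "s \<longlonglongrightarrow> 0" and m: "\<And>n. m n > 0"
    and u: "(\<lambda>n. (s n * real (m n) - saddle) / sqrt (s n)) \<longlonglongrightarrow> x"
  shows "(\<lambda>n. (pi\<^sup>2 / (10 * (s n)\<^sup>2) - real (m n) * (real (m n) + 1) / 4 -
      (\<Sum>j=1..m n. real j / (exp (s n * real j) - 1))) * (s n * sqrt (s n)))
    \<longlonglongrightarrow> - (saddle * sqrt 5 / 2) * x"
proof -
  define U where "U n = s n * real (m n)" for n
  have Upos: "U n > 0" for n using s m by (simp add: U_def)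
  have Ulim: "U \<longlonglongrightarrow> saddle"
    by (rule scaled_seq_tendsto[OF s]) (use u in \<open>simp add: U_def\<close>)
  \<comment> \<open>Leading term of s^2 (N - mean) as a function of u = s m. The constant pi^2/10 is
    what makes it vanish at \<open>saddle\<close>.\<close>
  define \<Psi> where "\<Psi> u = pi\<^sup>2 / 10 - u\<^sup>2 / 4 - planck_int u - pi\<^sup>2 / 6" for u
  define e where "e n = s n * (\<Sum>j=1..m n. planck (s n * real j)) - (planck_int (U n) - planck_int 0)" for n
  have e: "\<bar>e n\<bar> \<le> s n" for n
    unfolding e_def U_def
    by (rule riemann_sum_antimono[OF s(1) continuous_on_planck_int DERIV_planck_int planck_antimono planck_bounds])
  have "(\<lambda>n. (\<Psi> (U n) - \<Psi> saddle) / sqrt (s n)) \<longlonglongrightarrow> (- saddle / 2 - planck saddle) * x"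
  proof (rule taylor1_scaled[OF s _ Upos saddle_pos])
    show "(\<lambda>n. (U n - saddle) / sqrt (s n)) \<longlonglongrightarrow> x" using u by (simp add: U_def)
    show "(\<Psi> has_real_derivative (- t / 2 - planck t)) (at t)" if "t > 0" for t
      unfolding \<Psi>_def[abs_def] using that by (auto intro!: derivative_eq_intros DERIV_planck_int)
    show "isCont (\<lambda>t. - t / 2 - planck t) saddle"
      unfolding planck_def using saddle_pos by (intro continuous_intros) auto
  qed
  moreover have "\<Psi> saddle = 0"
    by (simp add: \<Psi>_def planck_int_saddle)
  moreover have "- saddle / 2 - planck saddle = - (saddle * sqrt 5 / 2)"
    by (simp add: planck_saddle golden_def field_simps)
  \<comment> \<open>Two corrections of order sqrt s: the linear part of m(m+1)/4 and the Riemann sum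
    error.\<close>
  moreover have "(\<lambda>n. sqrt (s n) * (U n / 4) + e n / sqrt (s n)) \<longlonglongrightarrow> sqrt 0 * (saddle / 4) + 0"
  proof (intro tendsto_add tendsto_mult tendsto_real_sqrt s tendsto_divide Ulim tendsto_const)
    have "(\<lambda>n. sqrt (s n)) \<longlonglongrightarrow> sqrt 0" by (intro tendsto_intros s)
    then have "(\<lambda>n. sqrt (s n)) \<longlonglongrightarrow> 0" by simp
    moreover have "norm (e n / sqrt (s n)) \<le> sqrt (s n)" for n
      using e[of n] s(1)[of n] by (simp add: divide_le_eq)
    ultimately show "(\<lambda>n. e n / sqrt (s n)) \<longlonglongrightarrow> 0"
      using Lim_null_comparison[of "\<lambda>n. e n / sqrt (s n)" "\<lambda>n. sqrt (s n)"] by (simp add: always_eventually)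
  qed simp
  ultimately have "(\<lambda>n. (\<Psi> (U n) - 0) / sqrt (s n) - (sqrt (s n) * (U n / 4) + e n / sqrt (s n)))
      \<longlonglongrightarrow> - (saddle * sqrt 5 / 2) * x - (sqrt 0 * (saddle / 4) + 0)"
    by (intro tendsto_diff) (simp_all only:)
  moreover have "(\<Psi> (U n) - 0) / sqrt (s n) - (sqrt (s n) * (U n / 4) + e n / sqrt (s n)) =
      (pi\<^sup>2 / (10 * (s n)\<^sup>2) - real (m n) * (real (m n) + 1) / 4 -
      (\<Sum>j=1..m n. real j / (exp (s n * real j) - 1))) * (s n * sqrt (s n))" for n
  proof -
    define r where "r = sqrt (s n)"
    have r: "r > 0" "s n = r * r" using s(1)[of n] by (auto simp: r_def)
    define T where "T = (\<Sum>j=1..m n. real j / (exp (s n * real j) - 1))"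
    have "(\<Sum>j=1..m n. planck (s n * real j)) = s n * T"
      by (simp add: T_def planck_def sum_distrib_left)
    then have e': "e n = s n * (s n * T) - (planck_int (U n) + pi\<^sup>2 / 6)"
      by (simp add: e_def planck_int_0)
    have U: "U n = r * r * real (m n)" by (simp add: U_def r(2))
    show ?thesis
      unfolding T_def[symmetric] r_def[symmetric] e' \<Psi>_def unfolding U r(2) using r(1)
      by (simp add: field_simps power2_eq_square)
  qed
  ultimately show ?thesis by simp
qed

lemma var_asymp:
  fixes s :: "nat \<Rightarrow> real" and m :: "nat \<Rightarrow> nat"
  assumes s: "\<And>n. s n > 0" "s \<longlonglongrightarrow> 0"
    and U: "(\<lambda>n. s n * real (m n)) \<longlonglongrightarrow> saddle"
  shows "(\<lambda>n. s n * (\<Sum>j=1..m n. planck2 (s n * real j))) \<longlonglongrightarrow> var_lim"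
proof -
  define e where "e n = s n * (\<Sum>j=1..m n. planck2 (s n * real j)) -
     (planck2_int (s n * real (m n)) - planck2_int 0)" for n
  have e: "\<bar>e n\<bar> \<le> s n" for n
    unfolding e_def
    by (rule riemann_sum_antimono[OF s(1) continuous_on_planck2_int DERIV_planck2_int planck2_antimono planck2_bounds])
  then have "e \<longlonglongrightarrow> 0"
    using Lim_null_comparison[of e s] s(2) by (simp add: always_eventually)
  moreover have "isCont planck2_int saddle"
    using DERIV_isCont[OF DERIV_planck2_int[OF saddle_pos]] .
  then have "(\<lambda>n. planck2_int (s n * real (m n))) \<longlonglongrightarrow> planck2_int saddle"
    by (rule isCont_tendsto_compose[OF _ U])
  ultimately have "(\<lambda>n. e n + (planck2_int (s n * real (m n)) - planck2_int 0)) \<longlonglongrightarrow>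
      0 + (planck2_int saddle - planck2_int 0)"
    by (intro tendsto_intros)
  then show ?thesis by (simp add: e_def planck2_int_saddle)
qed

section \<open>Characteristic functions of sums of geometric variables\<close>

lemma jordan_sin:
  fixes x :: real
  assumes "0 \<le> x" "x \<le> pi / 2"
  shows "2 * x / pi \<le> sin x"
proof (rule ccontr)
  define f where "f x = sin x - 2 * x / pi" for x :: real
  assume "\<not> 2 * x / pi \<le> sin x"
  then have neg: "f x < 0" by (simp add: f_def)
  have f0: "f 0 = 0" "f (pi / 2) = 0" by (auto simp: f_def)
  have "x \<noteq> 0" "x \<noteq> pi / 2" using neg f0 by (metis less_irrefl)+
  then have x: "0 < x" "x < pi / 2" using assms by auto
  have der: "(f has_real_derivative (cos t - 2 / pi)) (at t)" for t
    unfolding f_def[abs_def] by (auto intro!: derivative_eq_intros)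
  \<comment> \<open>A point below the chord forces a negative slope before it and a positive one
    after it, although cos decreases.\<close>
  obtain a where a: "0 < a" "a < x" "f x - f 0 = (x - 0) * (cos a - 2 / pi)"
    using MVT2[OF x(1), of f "\<lambda>t. cos t - 2 / pi"] der by blast
  obtain b where b: "x < b" "b < pi / 2" "f (pi / 2) - f x = (pi / 2 - x) * (cos b - 2 / pi)"
    using MVT2[OF x(2), of f "\<lambda>t. cos t - 2 / pi"] der by blast
  have "cos a - 2 / pi < 0" using a neg f0 x by (simp add: mult_less_0_iff)
  moreover have "(pi / 2 - x) * (cos b - 2 / pi) > 0" using b(3) neg f0 by linarith
  then have "cos b - 2 / pi > 0" by (rule zero_less_mult_pos) (use x in simp)
  moreover have "cos b \<le> cos a" using a b by (intro cos_monotone_0_pi_le) auto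
  ultimately show False by linarith
qed

lemma abs_sin_half_ge:
  fixes t :: real
  assumes "\<bar>t\<bar> \<le> pi"
  shows "\<bar>t\<bar> / pi \<le> \<bar>sin (t / 2)\<bar>"
proof -
  have "2 * (\<bar>t\<bar> / 2) / pi \<le> sin (\<bar>t\<bar> / 2)"
    using assms by (intro jordan_sin) auto
  also have "sin (\<bar>t\<bar> / 2) \<le> \<bar>sin (t / 2)\<bar>" by (simp add: abs_if)
  finally show ?thesis by simp
qed

lemma one_minus_cos_ge:
  fixes t :: real
  assumes "\<bar>t\<bar> \<le> pi"
  shows "2 * t\<^sup>2 / pi\<^sup>2 \<le> 1 - cos t"
proof -
  have "(\<bar>t\<bar> / pi)\<^sup>2 \<le> \<bar>sin (t / 2)\<bar>\<^sup>2"
    using abs_sin_half_ge[OF assms] by (intro power_mono) auto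
  then show ?thesis using cos_double_sin[of "t / 2"] by (simp add: power_divide)
qed

text \<open>Multiplication by 2 sin (t/2) telescopes the sum, as for the Dirichlet kernel; the bound
  is uniform in \<open>J\<close>.\<close>

lemma sum_cos_le:
  fixes t :: real
  assumes "\<bar>t\<bar> \<le> pi" "t \<noteq> 0"
  shows "(\<Sum>j=1..J. cos (real j * t)) \<le> pi / (2 * \<bar>t\<bar>)"
proof -
  have tel: "2 * sin (t / 2) * (\<Sum>j=1..J. cos (real j * t)) = sin (real J * t + t / 2) - sin (t / 2)"
  proof (induction J)
    case (Suc J)
    have "2 * sin (t / 2) * cos (real (Suc J) * t) = sin (real (Suc J) * t + t / 2) - sin (real (Suc J) * t - t / 2)"
      by (simp add: sin_add sin_diff)
    moreover have "real (Suc J) * t - t / 2 = real J * t + t / 2" by (simp add: field_simps)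
    ultimately show ?case using Suc.IH by (simp add: algebra_simps)
  qed simp
  have pos: "\<bar>sin (t / 2)\<bar> > 0"
    using abs_sin_half_ge[OF assms(1)] assms(2) by (smt (verit) divide_pos_pos pi_gt_zero zero_less_abs_iff)
  define S where "S = (\<Sum>j=1..J. cos (real j * t))"
  have "2 * sin (t / 2) * (S + 1 / 2) = sin (real J * t + t / 2)"
    using tel by (simp add: S_def algebra_simps)
  then have "\<bar>2 * sin (t / 2) * (S + 1 / 2)\<bar> \<le> 1" by simp
  then have "2 * \<bar>sin (t / 2)\<bar> * \<bar>S + 1 / 2\<bar> \<le> 1" by (simp add: abs_mult)
  then have "\<bar>S + 1 / 2\<bar> \<le> 1 / (2 * \<bar>sin (t / 2)\<bar>)" using pos by (simp add: field_simps)
  also have "\<dots> \<le> 1 / (2 * (\<bar>t\<bar> / pi))"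
    using abs_sin_half_ge[OF assms(1)] assms(2) pos by (intro divide_left_mono mult_pos_pos) auto
  finally show ?thesis by (simp add: S_def)
qed

text \<open>Characteristic function of the sum of j X_j over j <= m, with independent geometric X_j
  of ratio e^(-sj).\<close>

definition geo_char :: "real \<Rightarrow> nat \<Rightarrow> real \<Rightarrow> complex" where
  "geo_char s m t = (\<Prod>j=1..m. (1 - complex_of_real (exp (- (s * real j)))) / (1 - complex_of_real (exp (- (s * real j))) * cis (real j * t)))"

lemma geo_factor_norm:
  fixes r a :: real
  assumes "0 \<le> r" "r < 1"
  shows "(norm ((1 - complex_of_real r) / (1 - complex_of_real r * cis a)))\<^sup>2 = 1 / (1 + 2 * r * (1 - cos a) / (1 - r)\<^sup>2)"
proof -
  have "(norm (1 - r * cis a))\<^sup>2 = (1 - r * cos a)\<^sup>2 + (r * sin a)\<^sup>2"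
    by (simp add: cmod_power2)
  also have "\<dots> = (1 - r)\<^sup>2 + 2 * r * (1 - cos a)"
  proof -
    have "(r * sin a)\<^sup>2 = r\<^sup>2 * (1 - (cos a)\<^sup>2)" by (simp add: power_mult_distrib sin_squared_eq)
    then show ?thesis by (simp add: power2_eq_square algebra_simps)
  qed
  finally have n: "(norm (1 - r * cis a))\<^sup>2 = (1 - r)\<^sup>2 + 2 * r * (1 - cos a)" .
  have "norm (1 - complex_of_real r) = 1 - r" using assms by (metis abs_of_nonneg diff_ge_0_iff_ge less_imp_le norm_of_real of_real_1 of_real_diff)
  then have "(norm ((1 - complex_of_real r) / (1 - complex_of_real r * cis a)))\<^sup>2 = (1 - r)\<^sup>2 / ((1 - r)\<^sup>2 + 2 * r * (1 - cos a))"
    by (simp add: norm_divide power_divide n)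
  also have "\<dots> = 1 / (1 + 2 * r * (1 - cos a) / (1 - r)\<^sup>2)"
  proof -
    have "(1 - r)\<^sup>2 > 0" using assms by simp
    moreover have "d + e = d * (1 + e / d)" if "d > 0" for d e :: real
      using that by (simp add: field_simps)
    ultimately have "(1 - r)\<^sup>2 + 2 * r * (1 - cos a) = (1 - r)\<^sup>2 * (1 + 2 * r * (1 - cos a) / (1 - r)\<^sup>2)"
      by blast
    then show ?thesis using \<open>(1 - r)\<^sup>2 > 0\<close> by simp
  qed
  finally show ?thesis .
qed

lemma geo_factor_norm_le_1:
  fixes r a :: real
  assumes "0 \<le> r" "r < 1"
  shows "norm ((1 - complex_of_real r) / (1 - complex_of_real r * cis a)) \<le> 1"
proof -
  have "2 * r * (1 - cos a) / (1 - r)\<^sup>2 \<ge> 0" using assms by simp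
  then have "(norm ((1 - complex_of_real r) / (1 - complex_of_real r * cis a)))\<^sup>2 \<le> 1\<^sup>2"
    unfolding geo_factor_norm[OF assms] by simp
  then show ?thesis by (rule power2_le_imp_le) simp
qed

text \<open>For sj <= 1/2 and r = e^(-sj) one has 1 - r <= sj and 2r >= 1, so (1 - cos)/(sj)^2 is a
  minorant of the exact quantity 2r(1 - cos)/(1 - r)^2.\<close>

lemma geo_factor_norm_le:
  fixes s t X :: real and j :: nat
  assumes s: "s > 0" "s * real j \<le> 1 / 2" and j: "j > 0"
    and X: "0 \<le> X" "X \<le> (1 - cos (real j * t)) / (s * real j)\<^sup>2"
  shows "(norm ((1 - complex_of_real (exp (- (s * real j)))) / (1 - complex_of_real (exp (- (s * real j))) * cis (real j * t))))\<^sup>2 \<le> 1 / (1 + X)"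
proof -
  define r where "r = exp (- (s * real j))"
  have sj: "s * real j > 0" using s j by simp
  have r: "0 \<le> r" "r < 1" using sj by (auto simp: r_def)
  have rge: "r \<ge> 1 - s * real j" using exp_ge_add_one_self[of "- (s * real j)"] by (simp add: r_def)
  have "X \<le> 2 * r * (1 - cos (real j * t)) / (1 - r)\<^sup>2"
  proof -
    have "(1 - r)\<^sup>2 \<le> (s * real j)\<^sup>2" using rge r by (intro power_mono) auto
    have "X \<le> (1 - cos (real j * t)) / (s * real j)\<^sup>2" by (rule X)
    also have "\<dots> \<le> (1 - cos (real j * t)) / (1 - r)\<^sup>2"
      using \<open>(1 - r)\<^sup>2 \<le> (s * real j)\<^sup>2\<close> r sj s(1) j by (intro divide_left_mono mult_pos_pos) auto
    also have "\<dots> \<le> (2 * r) * (1 - cos (real j * t)) / (1 - r)\<^sup>2"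
      using rge s(2) mult_right_mono[of 1 "2 * r" "1 - cos (real j * t)"] by (intro divide_right_mono) auto
    finally show ?thesis .
  qed
  then show ?thesis
    using geo_factor_norm[OF r, of "real j * t"] X(1)
    by (simp add: r_def[symmetric] exp_of_real[symmetric] del: exp_of_real) (auto intro!: divide_left_mono mult_pos_pos)
qed

lemma geo_char_norm_le_1:
  assumes "s > 0"
  shows "norm (geo_char s m t) \<le> 1"
proof -
  have "norm (geo_char s m t) \<le> (\<Prod>j=1..m. 1)"
    unfolding geo_char_def using assms
    by (intro order_trans[OF norm_prod_le] prod_mono conjI)
       (auto intro!: geo_factor_norm_le_1 simp flip: of_real_exp)
  then show ?thesis by simp
qed

text \<open>Only factors with sj <= 1/2 are exploited, the others being at most 1 in modulus. The
  minorant \<open>X\<close> is left free because the two ranges of t call for different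
  ones.\<close>

lemma geo_char_norm_sq_le:
  fixes s t :: real and X :: "nat \<Rightarrow> real"
  assumes s: "s > 0" "s * real J \<le> 1 / 2" and J: "J \<le> m"
    and X: "\<And>j. 1 \<le> j \<Longrightarrow> j \<le> J \<Longrightarrow> 0 \<le> X j \<and> X j \<le> (1 - cos (real j * t)) / (s * real j)\<^sup>2"
  shows "(norm (geo_char s m t))\<^sup>2 \<le> 1 / (\<Prod>j=1..J. 1 + X j)"
proof -
  define g where "g j = (1 - complex_of_real (exp (- (s * real j)))) / (1 - complex_of_real (exp (- (s * real j))) * cis (real j * t))" for j :: nat
  have "(norm (geo_char s m t))\<^sup>2 = (\<Prod>j=1..m. (norm (g j))\<^sup>2)"
    by (simp add: geo_char_def g_def prod_norm[symmetric] prod_power_distrib)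
  also have "\<dots> = (\<Prod>j=1..J. (norm (g j))\<^sup>2) * (\<Prod>j=J+1..m. (norm (g j))\<^sup>2)"
    using J by (subst prod.union_disjoint[symmetric]) (auto intro!: prod.cong)
  also have "\<dots> \<le> (\<Prod>j=1..J. 1 / (1 + X j)) * (\<Prod>j=J+1..m. 1)"
  proof (intro mult_mono prod_mono conjI)
    fix j assume j: "j \<in> {1..J}"
    have "s * real j \<le> s * real J" using j s by (intro mult_left_mono) auto
    then have "s * real j \<le> 1 / 2" using s by linarith
    then show "(norm (g j))\<^sup>2 \<le> 1 / (1 + X j)"
      unfolding g_def using j s X[of j] by (intro geo_factor_norm_le) auto
  next
    fix j assume j: "j \<in> {J+1..m}"
    have "norm (g j) \<le> 1"
      using j s geo_factor_norm_le_1[of "exp (- (s * real j))" "real j * t"]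
      by (simp add: g_def)
    then show "(norm (g j))\<^sup>2 \<le> 1" by (simp add: power_le_one)
  qed (use X in \<open>auto intro!: prod_nonneg\<close>)
  finally show ?thesis by (simp add: prod_dividef)
qed

text \<open>Turns a product of terms 1 + X into the exponential of a sum, for values X = 1 - cos in
  [0, 2].\<close>

lemma exp_half_le:
  fixes x :: real
  assumes "0 \<le> x" "x \<le> 2"
  shows "exp (x / 2) \<le> 1 + x"
proof -
  have "exp (x / 2) \<le> 1 + x / 2 + (x / 2)\<^sup>2" using assms by (intro exp_bound) auto
  also have "(x / 2)\<^sup>2 \<le> x / 2" using assms mult_right_mono[of x 2 x] by (simp add: power2_eq_square)
  finally show ?thesis by (simp add: field_simps)
qed

text \<open>The far range uses the Dirichlet kernel, the near range the quadratic lower bound for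
  \<open>1 - cos\<close>.\<close>
lemma geo_char_bound:
  fixes s t :: real
  assumes s: "0 < s" "s \<le> 1 / 8" and m: "1 / 2 \<le> s * real m" and t: "\<bar>t\<bar> \<le> pi"
  shows "norm (geo_char s m t) \<le> 27 * 32 ^ 3 * (1 + pi\<^sup>2) / (1 + t\<^sup>2 / s ^ 3)"
proof -
  define J where "J = nat \<lfloor>1 / (2 * s)\<rfloor>"
  have Jle: "real J \<le> 1 / (2 * s)" and Jge: "real J \<ge> 1 / (2 * s) - 1"
    unfolding J_def using s by (auto simp: of_nat_nat)
  have sJ: "s * real J \<le> 1 / 2" using Jle s by (simp add: field_simps)
  have "s * real J \<le> s * real m" using sJ m by linarith
  then have Jm: "J \<le> m" using s by simp
  have s8: "1 / (8 * s) \<ge> 1" using s by simp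
  have pi2: "pi\<^sup>2 \<le> 16" using pi_less_4 power_mono[of pi 4 2] by simp
  show ?thesis
  \<comment> \<open>Up to this threshold J |t| <= pi, so the quadratic minorant of 1 - cos is valid
    for every j <= J, and there j cancels.\<close>
  proof (cases "\<bar>t\<bar> \<le> 2 * pi * s")
    case True
    define z where "z = 2 * t\<^sup>2 / (pi\<^sup>2 * s\<^sup>2)"
    have z: "z \<ge> 0" by (simp add: z_def)
    have "(norm (geo_char s m t))\<^sup>2 \<le> 1 / (\<Prod>j=1..J. 1 + z)"
    proof (rule geo_char_norm_sq_le[OF s(1) sJ Jm])
      fix j assume j: "1 \<le> j" "j \<le> J"
      have "real j * \<bar>t\<bar> \<le> real J * (2 * pi * s)" using j True by (intro mult_mono) auto
      also have "\<dots> = (s * real J) * (2 * pi)" by simp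
      also have "\<dots> \<le> 1 / 2 * (2 * pi)" using sJ by (intro mult_right_mono) auto
      finally have "\<bar>real j * t\<bar> \<le> pi" by (simp add: abs_mult)
      from one_minus_cos_ge[OF this]
      have "2 * (real j * t)\<^sup>2 / pi\<^sup>2 / (s * real j)\<^sup>2 \<le> (1 - cos (real j * t)) / (s * real j)\<^sup>2"
        by (rule divide_right_mono) simp
      moreover have "2 * (real j * t)\<^sup>2 / pi\<^sup>2 / (s * real j)\<^sup>2 = z"
        using j s by (simp add: z_def power_mult_distrib)
      ultimately show "0 \<le> z \<and> z \<le> (1 - cos (real j * t)) / (s * real j)\<^sup>2" using z by simp
    qed
    also have "(\<Prod>j=1..J. 1 + z) = (1 + z) ^ J" by simp
    \<comment> \<open>The left side bounds a squared norm, so the exponent is halved before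
      Bernoulli's inequality is applied.\<close>
    also have "1 / (1 + z) ^ J \<le> 1 / ((1 + real (J div 2) * z)\<^sup>2)"
    proof (rule divide_left_mono)
      have "(1 + real (J div 2) * z)\<^sup>2 \<le> ((1 + z) ^ (J div 2))\<^sup>2"
        using z by (intro power_mono Bernoulli_inequality) auto
      also have "\<dots> = (1 + z) ^ (2 * (J div 2))" by (simp add: power_mult mult.commute flip: power_mult)
      also have "\<dots> \<le> (1 + z) ^ J" using z by (intro power_increasing) auto
      finally show "(1 + real (J div 2) * z)\<^sup>2 \<le> (1 + z) ^ J" .
    qed (use z in \<open>auto intro!: mult_pos_pos zero_less_power add_pos_nonneg\<close>)
    finally have "(norm (geo_char s m t))\<^sup>2 \<le> (1 / (1 + real (J div 2) * z))\<^sup>2"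
      by (simp add: power_divide)
    then have "norm (geo_char s m t) \<le> 1 / (1 + real (J div 2) * z)"
      by (rule power2_le_imp_le) (use z in auto)
    also have "\<dots> \<le> 1 / (1 / 64 * (1 + t\<^sup>2 / s ^ 3))"
    proof (rule divide_left_mono)
      have "J \<le> 2 * (J div 2) + 1" by linarith
      then have "real J \<le> 2 * real (J div 2) + 1" by linarith
      moreover have "1 / (2 * s) = 4 * (1 / (8 * s))" using s by simp
      ultimately have "real (J div 2) \<ge> 1 / (8 * s)" using Jge s8 by linarith
      then have "1 / (8 * s) * z \<le> real (J div 2) * z" using z by (intro mult_right_mono)
      moreover have "1 / (8 * s) * z = 1 / (4 * pi\<^sup>2) * (t\<^sup>2 / s ^ 3)"
        using s by (simp add: z_def power2_eq_square power3_eq_cube)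
      moreover have "1 / 64 * (t\<^sup>2 / s ^ 3) \<le> 1 / (4 * pi\<^sup>2) * (t\<^sup>2 / s ^ 3)"
        using pi2 s by (intro mult_right_mono divide_left_mono) auto
      ultimately show "1 / 64 * (1 + t\<^sup>2 / s ^ 3) \<le> 1 + real (J div 2) * z"
        by (simp only: distrib_left)
    qed (use z s in \<open>auto intro!: mult_pos_pos add_pos_nonneg\<close>)
    also have "\<dots> = 64 / (1 + t\<^sup>2 / s ^ 3)" by simp
    also have "\<dots> \<le> 27 * 32 ^ 3 * (1 + pi\<^sup>2) / (1 + t\<^sup>2 / s ^ 3)"
    proof (rule divide_right_mono)
      have "64 * 1 \<le> (27 * 32 ^ 3 :: real) * (1 + pi\<^sup>2)" by (intro mult_mono) auto
      then show "64 \<le> (27 * 32 ^ 3 :: real) * (1 + pi\<^sup>2)" by simp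
    qed (use s in auto)
    finally show ?thesis .
  next
    case False
    then have t0: "t \<noteq> 0" using s by auto
    define X where "X j = 1 - cos (real j * t)" for j :: nat
    have X: "0 \<le> X j" "X j \<le> 2" for j
      using cos_ge_minus_one[of "real j * t"] by (auto simp: X_def)
    \<comment> \<open>Beyond the threshold the cosines sum to at most 1/(4s), while J is nearly
      1/(2s); a fixed share of order 1/s remains.\<close>
    have "(\<Sum>j=1..J. X j) \<ge> 1 / (8 * s)"
    proof -
      have "pi / (2 * \<bar>t\<bar>) \<le> pi / (2 * (2 * pi * s))"
        using False s t0 by (intro divide_left_mono mult_pos_pos) auto
      then have "(\<Sum>j=1..J. cos (real j * t)) \<le> 1 / (4 * s)"
        using sum_cos_le[OF t t0, of J] by simp
      moreover have "(\<Sum>j=1..J. X j) = real J - (\<Sum>j=1..J. cos (real j * t))"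
        by (simp add: X_def sum_subtractf)
      moreover have "1 / (2 * s) - 1 - 1 / (4 * s) \<ge> 1 / (8 * s)" using s8 s by (simp add: field_simps)
      ultimately show ?thesis using Jge by linarith
    qed
    then have "exp (1 / (16 * s)) \<le> exp ((\<Sum>j=1..J. X j) / 2)" by simp
    also have "\<dots> = (\<Prod>j=1..J. exp (X j / 2))"
      by (simp add: exp_sum sum_divide_distrib)
    also have "\<dots> \<le> (\<Prod>j=1..J. 1 + X j)" using X by (intro prod_mono) (auto intro: exp_half_le)
    finally have P: "exp (1 / (16 * s)) \<le> (\<Prod>j=1..J. 1 + X j)" .
    have "(norm (geo_char s m t))\<^sup>2 \<le> 1 / (\<Prod>j=1..J. 1 + X j)"
    proof (rule geo_char_norm_sq_le[OF s(1) sJ Jm])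
      fix j assume j: "1 \<le> j" "j \<le> J"
      have "s * real j \<le> s * real J" using j s by (intro mult_left_mono) auto
      then have "s * real j \<le> 1" using sJ by linarith
      then have "(s * real j)\<^sup>2 \<le> 1" using s by (intro power_le_one) auto
      moreover have "(s * real j)\<^sup>2 > 0" using s j by simp
      ultimately show "0 \<le> X j \<and> X j \<le> (1 - cos (real j * t)) / (s * real j)\<^sup>2"
        using X(1)[of j] by (auto simp: X_def[symmetric] le_divide_eq mult_left_le)
    qed
    also have "\<dots> \<le> 1 / exp (1 / (16 * s))"
      using P by (intro divide_left_mono mult_pos_pos) (auto intro: less_le_trans[OF exp_gt_zero])
    also have "\<dots> = (exp (- (1 / (32 * s))))\<^sup>2"
    proof -
      have "1 / (16 * s) = 1 / (32 * s) + 1 / (32 * s)" using s by (simp add: field_simps)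
      then have "exp (1 / (16 * s)) = exp (1 / (32 * s)) * exp (1 / (32 * s))"
        by (simp only: exp_add)
      then show ?thesis by (simp add: exp_minus power2_eq_square field_simps)
    qed
    finally have "norm (geo_char s m t) \<le> exp (- (1 / (32 * s)))"
      by (rule power2_le_imp_le) simp
    \<comment> \<open>From e^y >= (y/3)^3 at y = 1/(32 s), whence the constant 27 * 32^3. A cube of
      s suffices because t^2/s^3 <= pi^2/s^3.\<close>
    also have "\<dots> \<le> 27 * (32 * s) ^ 3"
    proof -
      have "1 / (32 * s) / 3 \<le> exp (1 / (32 * s) / 3)"
        using exp_ge_add_one_self[of "1 / (32 * s) / 3"] by linarith
      then have "(1 / (32 * s) / 3) ^ 3 \<le> exp (1 / (32 * s) / 3) ^ 3"
        using s by (intro power_mono) auto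
      also have "\<dots> = exp (1 / (32 * s))" by (simp flip: exp_of_nat_mult)
      finally have "(1 / (32 * s) / 3) ^ 3 \<le> exp (1 / (32 * s))" .
      then have "inverse (exp (1 / (32 * s))) \<le> inverse ((1 / (32 * s) / 3) ^ 3)"
        using s by (intro le_imp_inverse_le) auto
      also have "\<dots> = 27 * (32 * s) ^ 3" using s by (simp add: power_divide power_mult_distrib)
      finally show ?thesis by (simp add: exp_minus)
    qed
    also have "\<dots> \<le> 27 * 32 ^ 3 * (1 + pi\<^sup>2) / (1 + t\<^sup>2 / s ^ 3)"
    proof -
      have "s ^ 3 \<le> 1" using s by (intro power_le_one) auto
      moreover have "t\<^sup>2 \<le> pi\<^sup>2" using t power_mono[of "\<bar>t\<bar>" pi 2] by simp
      ultimately have "s ^ 3 * (1 + t\<^sup>2 / s ^ 3) \<le> 1 + pi\<^sup>2"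
        using s by (simp add: distrib_left)
      then have "27 * 32 ^ 3 * (s ^ 3 * (1 + t\<^sup>2 / s ^ 3)) \<le> 27 * 32 ^ 3 * (1 + pi\<^sup>2)"
        by (intro mult_left_mono) auto
      then show ?thesis using s
        by (subst pos_le_divide_eq) (auto simp: power_mult_distrib mult.assoc intro!: add_pos_nonneg)
    qed
    finally show ?thesis .
  qed
qed

text \<open>Both expressions agree to second order with the polynomial \<open>P\<close>; the
  Gaussian has mean a and variance a(1 + a). Since a may be as large as 1/(sj), it is only the
  product a |\<alpha>| that is bounded by \<epsilon>, and K measures how far |\<alpha>| itself may
  exceed \<epsilon>.\<close>

lemma geo_factor_second_order:
  fixes a \<alpha> \<epsilon> K :: real
  assumes a: "0 \<le> a" and K: "1 \<le> K" and e: "0 \<le> \<epsilon>" "K * \<epsilon> \<le> 1 / 2"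
    and a\<alpha>: "a * \<bar>\<alpha>\<bar> \<le> \<epsilon>" and \<alpha>: "\<bar>\<alpha>\<bar> \<le> K * \<epsilon>"
  shows "norm (1 / (1 - a * (cis \<alpha> - 1)) - exp (\<i> * a * \<alpha> - a * (1 + a) * \<alpha>\<^sup>2 / 2)) \<le> 40 * K\<^sup>2 * \<epsilon> ^ 3"
proof -
  define \<zeta> where "\<zeta> = complex_of_real a * (cis \<alpha> - 1)"
  define b where "b = \<i> * complex_of_real (a * \<alpha>)"
  define c where "c = complex_of_real (a * \<alpha>\<^sup>2 / 2)"
  define d where "d = complex_of_real ((a * \<alpha>)\<^sup>2 / 2)"
  \<comment> \<open>On the geometric side b^2 arises from squaring \<zeta>; on the exponential side
    one half is -d and the other half comes from squaring w.\<close>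
  define P where "P = 1 + b - c + b\<^sup>2"
  have e1: "\<epsilon> \<le> 1 / 2" using K e mult_right_mono[of 1 K \<epsilon>] by linarith
  have e3: "0 \<le> \<epsilon> ^ 3" using e by simp
  have K2: "K \<le> K\<^sup>2" "1 \<le> K\<^sup>2" using K mult_left_mono[of 1 K K] one_le_power[OF K, of 2] by (auto simp: power2_eq_square)
  have nb: "norm b \<le> \<epsilon>" using a\<alpha> a by (simp add: b_def norm_mult abs_mult)
  have nc0: "a * \<alpha>\<^sup>2 \<le> K * \<epsilon>\<^sup>2"
  proof -
    have "(a * \<bar>\<alpha>\<bar>) * \<bar>\<alpha>\<bar> \<le> \<epsilon> * (K * \<epsilon>)" using a\<alpha> \<alpha> a e by (intro mult_mono) auto
    then show ?thesis by (simp add: power2_eq_square mult_ac)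
  qed
  have nc: "norm c \<le> K * \<epsilon>\<^sup>2 / 2" using nc0 a unfolding c_def norm_of_real by simp
  have cis2: "norm (cis \<alpha> - 1) \<le> \<bar>\<alpha>\<bar>" "norm (cis \<alpha> - 1 - \<i> * \<alpha>) \<le> \<alpha>\<^sup>2 / 2"
    "norm (cis \<alpha> - 1 - \<i> * \<alpha> + \<alpha>\<^sup>2 / 2) \<le> \<bar>\<alpha>\<bar> ^ 3 / 6"
    using iexp_approx1[of \<alpha> 0] iexp_approx1[of \<alpha> 1] iexp_approx1[of \<alpha> 2]
    by (simp_all add: cis_conv_exp numeral_2_eq_2 numeral_3_eq_3 power2_eq_square algebra_simps)
  have n\<zeta>: "norm \<zeta> \<le> \<epsilon>"
  proof -
    have "norm \<zeta> \<le> a * \<bar>\<alpha>\<bar>" using cis2(1) a by (simp add: \<zeta>_def norm_mult mult_left_mono)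
    then show ?thesis using a\<alpha> by simp
  qed
  have n1: "norm (\<zeta> - b) \<le> K * \<epsilon>\<^sup>2 / 2"
  proof -
    have "\<zeta> - b = a * (cis \<alpha> - 1 - \<i> * \<alpha>)" by (simp add: \<zeta>_def b_def algebra_simps)
    then have "norm (\<zeta> - b) \<le> a * (\<alpha>\<^sup>2 / 2)" using mult_left_mono[OF cis2(2) a] a by (simp add: norm_mult)
    then show ?thesis using nc0 by simp
  qed
  have n2: "norm (\<zeta> - b + c) \<le> K\<^sup>2 * \<epsilon> ^ 3"
  proof -
    have "\<zeta> - b + c = a * (cis \<alpha> - 1 - \<i> * \<alpha> + \<alpha>\<^sup>2 / 2)" by (simp add: \<zeta>_def b_def c_def algebra_simps)
    then have "norm (\<zeta> - b + c) \<le> a * (\<bar>\<alpha>\<bar> ^ 3 / 6)"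
      using mult_left_mono[OF cis2(3) a] a by (simp add: norm_mult)
    also have "\<dots> \<le> (a * \<bar>\<alpha>\<bar>) * \<bar>\<alpha>\<bar>\<^sup>2"
    proof -
      have "a * (\<bar>\<alpha>\<bar> ^ 3 / 6) = (a * \<bar>\<alpha>\<bar>) * \<bar>\<alpha>\<bar>\<^sup>2 / 6"
        by (simp only: power3_eq_cube power2_eq_square)
      moreover have "0 \<le> (a * \<bar>\<alpha>\<bar>) * \<bar>\<alpha>\<bar>\<^sup>2"
        using a by (intro mult_nonneg_nonneg) auto
      ultimately show ?thesis by linarith
    qed
    also have "\<dots> \<le> \<epsilon> * (K * \<epsilon>)\<^sup>2" using a\<alpha> \<alpha> a e by (intro mult_mono power_mono) auto
    finally show ?thesis by (simp add: power2_eq_square power3_eq_cube mult_ac)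
  qed
  have n3: "norm (\<zeta>\<^sup>2 - b\<^sup>2) \<le> K * \<epsilon> ^ 3"
  proof -
    have "norm (\<zeta>\<^sup>2 - b\<^sup>2) = norm (\<zeta> - b) * norm (\<zeta> + b)"
      by (simp add: power2_eq_square algebra_simps flip: norm_mult)
    also have "\<dots> \<le> (K * \<epsilon>\<^sup>2 / 2) * (2 * \<epsilon>)"
      using n1 norm_triangle_ineq[of \<zeta> b] n\<zeta> nb K by (intro mult_mono) auto
    finally show ?thesis by (simp add: power2_eq_square power3_eq_cube)
  qed
  have n4: "norm (1 / (1 - \<zeta>) - (1 + \<zeta> + \<zeta>\<^sup>2)) \<le> 2 * \<epsilon> ^ 3"
  proof -
    have half: "1 / 2 \<le> norm (1 - \<zeta>)"
      using norm_triangle_ineq2[of 1 \<zeta>] n\<zeta> e1 by simp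
    then have "1 - \<zeta> \<noteq> 0" by auto
    then have "1 / (1 - \<zeta>) - (1 + \<zeta> + \<zeta>\<^sup>2) = \<zeta> ^ 3 / (1 - \<zeta>)"
      by (simp add: field_simps power2_eq_square power3_eq_cube)
    then have "norm (1 / (1 - \<zeta>) - (1 + \<zeta> + \<zeta>\<^sup>2)) = norm \<zeta> ^ 3 / norm (1 - \<zeta>)"
      by (simp add: norm_divide norm_power)
    also have "\<dots> \<le> \<epsilon> ^ 3 / (1 / 2)"
      using half n\<zeta> e by (intro frac_le power_mono) auto
    finally show ?thesis by simp
  qed
  have L: "norm (1 / (1 - \<zeta>) - P) \<le> 4 * K\<^sup>2 * \<epsilon> ^ 3"
  proof -
    have "1 / (1 - \<zeta>) - P = (1 / (1 - \<zeta>) - (1 + \<zeta> + \<zeta>\<^sup>2)) + (\<zeta> - b + c) + (\<zeta>\<^sup>2 - b\<^sup>2)"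
      by (simp add: P_def)
    then have "norm (1 / (1 - \<zeta>) - P) \<le> 2 * \<epsilon> ^ 3 + K\<^sup>2 * \<epsilon> ^ 3 + K * \<epsilon> ^ 3"
      using n2 n3 n4 by (metis (no_types, lifting) add_mono norm_triangle_le)
    also have "\<dots> = (2 + K\<^sup>2 + K) * \<epsilon> ^ 3" by (simp add: algebra_simps)
    also have "\<dots> \<le> (4 * K\<^sup>2) * \<epsilon> ^ 3" using K2 e3 by (intro mult_right_mono) auto
    finally show ?thesis .
  qed
  define w where "w = b - c - d"
  have nd: "norm d \<le> \<epsilon>\<^sup>2 / 2"
  proof -
    have "(a * \<bar>\<alpha>\<bar>)\<^sup>2 \<le> \<epsilon>\<^sup>2" using a\<alpha> a by (intro power_mono) auto
    then show ?thesis by (simp add: d_def norm_divide norm_mult norm_power power_mult_distrib)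
  qed
  have db: "d = - b\<^sup>2 / 2" by (simp add: d_def b_def power_mult_distrib)
  have ncd: "norm (c + d) \<le> K * \<epsilon>\<^sup>2"
  proof -
    have "1 * \<epsilon>\<^sup>2 \<le> K * \<epsilon>\<^sup>2" using K by (intro mult_right_mono) auto
    then show ?thesis using norm_triangle_ineq[of c d] nc nd by linarith
  qed
  have ke: "K * \<epsilon>\<^sup>2 \<le> \<epsilon> / 2"
    using mult_right_mono[OF e(2) e(1)] by (simp add: power2_eq_square mult.assoc)
  have nw: "norm w \<le> 2 * \<epsilon>"
    using norm_triangle_ineq4[of b "c + d"] nb ncd ke e by (simp add: w_def algebra_simps)
  have n5: "norm (exp w - (1 + w + w\<^sup>2 / 2)) \<le> 16 * \<epsilon> ^ 3"
  proof -
    have "norm (exp w - (\<Sum>k\<le>2. w ^ k / fact k)) \<le> exp \<bar>Re w\<bar> * norm w ^ Suc 2 / fact 2"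
      by (rule Taylor_exp)
    also have "\<dots> \<le> 4 * (2 * \<epsilon>) ^ Suc 2 / fact 2"
    proof (intro divide_right_mono mult_mono power_mono)
      have "\<bar>Re w\<bar> \<le> 1" using abs_Re_le_cmod[of w] nw e1 by linarith
      then have "exp \<bar>Re w\<bar> \<le> exp 1" by simp
      then show "exp \<bar>Re w\<bar> \<le> 4" using exp_le by linarith
    qed (use nw in auto)
    finally show ?thesis by (simp add: numeral_2_eq_2 numeral_3_eq_3 add.assoc)
  qed
  have n6: "norm (w\<^sup>2 - b\<^sup>2) \<le> 3 * K * \<epsilon> ^ 3"
  proof -
    have "norm (w\<^sup>2 - b\<^sup>2) = norm (w - b) * norm (w + b)"
      by (simp add: power2_eq_square algebra_simps flip: norm_mult)
    also have "norm (w - b) = norm (c + d)"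
      using norm_minus_cancel[of "c + d"] by (simp add: w_def)
    also have "norm (c + d) * norm (w + b) \<le> (K * \<epsilon>\<^sup>2) * (3 * \<epsilon>)"
      using ncd norm_triangle_ineq[of w b] nw nb K by (intro mult_mono) auto
    finally show ?thesis by (simp add: power2_eq_square power3_eq_cube)
  qed
  have R: "norm (exp w - P) \<le> 18 * K\<^sup>2 * \<epsilon> ^ 3"
  proof -
    have "exp w - P = (exp w - (1 + w + w\<^sup>2 / 2)) + (w\<^sup>2 - b\<^sup>2) / 2"
      by (simp add: P_def w_def db diff_divide_distrib)
    then have "norm (exp w - P) \<le> norm (exp w - (1 + w + w\<^sup>2 / 2)) + norm ((w\<^sup>2 - b\<^sup>2) / 2)"
      by (simp only: norm_triangle_ineq)
    also have "\<dots> \<le> 16 * \<epsilon> ^ 3 + 3 * K * \<epsilon> ^ 3 / 2"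
      using n5 n6 by (simp add: norm_divide)
    also have "\<dots> = (16 + 3 / 2 * K) * \<epsilon> ^ 3" by (simp add: algebra_simps)
    also have "\<dots> \<le> (18 * K\<^sup>2) * \<epsilon> ^ 3" using K2 e3 by (intro mult_right_mono) auto
    finally show ?thesis .
  qed
  have "\<i> * a * \<alpha> - a * (1 + a) * \<alpha>\<^sup>2 / 2 = w"
    by (simp add: w_def b_def c_def d_def power2_eq_square algebra_simps add_divide_distrib)
  then have "1 / (1 - a * (cis \<alpha> - 1)) - exp (\<i> * a * \<alpha> - a * (1 + a) * \<alpha>\<^sup>2 / 2) =
      (1 / (1 - \<zeta>) - P) - (exp w - P)" by (simp add: \<zeta>_def)
  then have "norm (1 / (1 - a * (cis \<alpha> - 1)) - exp (\<i> * a * \<alpha> - a * (1 + a) * \<alpha>\<^sup>2 / 2)) \<le>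
      norm (1 / (1 - \<zeta>) - P) + norm (exp w - P)" by (simp only: norm_triangle_ineq4)
  also have "\<dots> \<le> 40 * K\<^sup>2 * \<epsilon> ^ 3"
    using L R mult_nonneg_nonneg[OF zero_le_power2[of K] e3] by linarith
  finally show ?thesis .
qed

text \<open>Dividing numerator and denominator by 1 - e^(-x) expresses the factor through the mean a
  = 1/(e^x - 1), the form expanded above.\<close>

lemma geo_factor_alt:
  fixes x \<alpha> :: real
  assumes "x > 0"
  shows "(1 - complex_of_real (exp (- x))) / (1 - complex_of_real (exp (- x)) * cis \<alpha>) =
     1 / (1 - complex_of_real (1 / (exp x - 1)) * (cis \<alpha> - 1))"
proof -
  define e where "e = complex_of_real (exp x)"
  have e: "e \<noteq> 0" "e - 1 \<noteq> 0"
    using assms by (auto simp: e_def complex_eq_iff)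
  have n: "1 - complex_of_real (exp (- x)) * cis \<alpha> \<noteq> 0"
  proof
    assume "1 - complex_of_real (exp (- x)) * cis \<alpha> = 0"
    then have "norm (complex_of_real (exp (- x)) * cis \<alpha>) = 1" by (metis eq_iff_diff_eq_0 norm_one)
    then show False using assms by (simp add: norm_mult del: of_real_exp)
  qed
  have r: "complex_of_real (exp (- x)) = 1 / e" by (simp add: e_def exp_minus inverse_eq_divide)
  have q: "complex_of_real (1 / (exp x - 1)) = 1 / (e - 1)" by (simp add: e_def)
  have n': "e - cis \<alpha> \<noteq> 0" using n e unfolding r by (auto simp: field_simps)
  have "1 - 1 / (e - 1) * (cis \<alpha> - 1) = (e - cis \<alpha>) / (e - 1)" using e by (simp add: field_simps)
  moreover have "1 - 1 / e = (e - 1) / e" "1 - 1 / e * cis \<alpha> = (e - cis \<alpha>) / e" using e by (auto simp: field_simps)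
  ultimately show ?thesis unfolding r q using e n' by simp
qed

lemma prod_cis: "finite A \<Longrightarrow> (\<Prod>j\<in>A. cis (f j)) = cis (\<Sum>j\<in>A. f j)"
  by (induction A rule: finite_induct) (auto simp: cis_mult)

lemma planck2_eq_occupation:
  assumes "x > 0"
  shows "1 / (exp x - 1) * (1 + 1 / (exp x - 1)) = planck2 x / x\<^sup>2"
proof -
  have "exp x - 1 \<noteq> 0" using assms by simp
  then show ?thesis using assms by (simp add: planck2_def divide_simps power2_eq_square)
qed

text \<open>The mean is removed first because its phase grows like s^(-1/2). Geometric and Gaussian
  factors have norm at most 1, so the products differ by at most the sum of the single errors: about
  \<open>saddle\<close>/s of them, each of order s^(3/2).\<close>

lemma geo_char_centered_limit:
  fixes s :: "nat \<Rightarrow> real" and m :: "nat \<Rightarrow> nat" and y :: real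
  assumes s: "\<And>n. s n > 0" "s \<longlonglongrightarrow> 0"
    and U: "(\<lambda>n. s n * real (m n)) \<longlonglongrightarrow> saddle"
  shows "(\<lambda>n. geo_char (s n) (m n) (s n * sqrt (s n) * y) *
      cis (- (s n * sqrt (s n) * y * (\<Sum>j=1..m n. real j / (exp (s n * real j) - 1)))))
    \<longlonglongrightarrow> complex_of_real (exp (- (var_lim * y\<^sup>2 / 2)))"
proof -
  define t where "t n = s n * sqrt (s n) * y" for n
  define a where "a n j = 1 / (exp (s n * real j) - 1)" for n and j :: nat
  define fac where "fac n j = (1 - complex_of_real (exp (- (s n * real j)))) /
      (1 - complex_of_real (exp (- (s n * real j))) * cis (real j * t n))" for n and j :: nat
  define z where "z n j = fac n j * cis (- (a n j * (real j * t n)))" for n and j :: nat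
  define q where "q n j = a n j * (1 + a n j) * (real j * t n)\<^sup>2 / 2" for n and j :: nat
  define w where "w n j = complex_of_real (exp (- q n j))" for n and j :: nat
  \<comment> \<open>Eventually s m < K, which bounds every angle |j t| by K \<epsilon>.\<close>
  define K where "K = saddle + 1"
  define \<epsilon> where "\<epsilon> n = sqrt (s n) * \<bar>y\<bar>" for n
  have K: "K \<ge> 1" using saddle_pos by (simp add: K_def)
  have s0: "(\<lambda>n. sqrt (s n)) \<longlonglongrightarrow> 0" using tendsto_real_sqrt[OF s(2)] by simp
  have \<epsilon>0: "\<epsilon> \<longlonglongrightarrow> 0" using tendsto_mult_left_zero[OF s0] by (simp add: \<epsilon>_def[abs_def])
  have apos: "a n j > 0" if "j \<ge> 1" for n j using that s(1)[of n] by (simp add: a_def)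
  have "eventually (\<lambda>n. s n * real (m n) < K) sequentially"
    by (rule order_tendstoD(2)[OF U]) (simp add: K_def)
  moreover have "eventually (\<lambda>n. K * \<epsilon> n < 1 / 2) sequentially"
    by (rule order_tendstoD(2)[OF tendsto_mult_right_zero[OF \<epsilon>0]]) simp
  ultimately have ev: "eventually (\<lambda>n. norm ((\<Prod>j=1..m n. z n j) - (\<Prod>j=1..m n. w n j)) \<le>
      40 * K\<^sup>2 * (s n * real (m n)) * sqrt (s n) * \<bar>y\<bar> ^ 3) sequentially"
  proof eventually_elim
    case (elim n)
    have sn: "s n > 0" by (rule s)
    have zw: "norm (z n j - w n j) \<le> 40 * K\<^sup>2 * \<epsilon> n ^ 3" if j: "j \<in> {1..m n}" for j
    proof -
      have sj: "s n * real j > 0" using j sn by simp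
      define \<alpha> where "\<alpha> = real j * t n"
      have abst: "\<bar>t n\<bar> = s n * \<epsilon> n" using sn by (simp add: t_def \<epsilon>_def abs_mult)
      have "a n j \<le> 1 / (s n * real j)"
      proof -
        have "s n * real j \<le> exp (s n * real j) - 1"
          using exp_ge_add_one_self[of "s n * real j"] by linarith
        then show ?thesis unfolding a_def by (rule frac_le[OF zero_le_one order_refl sj])
      qed
      then have "a n j * \<bar>\<alpha>\<bar> \<le> 1 / (s n * real j) * \<bar>\<alpha>\<bar>" by (intro mult_right_mono) auto
      also have "\<dots> = \<epsilon> n" using sj sn j by (simp add: \<alpha>_def abs_mult abst)
      finally have 1: "a n j * \<bar>\<alpha>\<bar> \<le> \<epsilon> n" .
      have "\<bar>\<alpha>\<bar> = (s n * real j) * \<epsilon> n" by (simp add: \<alpha>_def abs_mult abst)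
      also have "\<dots> \<le> K * \<epsilon> n"
      proof (rule mult_right_mono)
        have "s n * real j \<le> s n * real (m n)" using j sn by (intro mult_left_mono) auto
        then show "s n * real j \<le> K" using elim by linarith
      qed (use sn in \<open>simp add: \<epsilon>_def\<close>)
      finally have 2: "\<bar>\<alpha>\<bar> \<le> K * \<epsilon> n" .
      have f: "fac n j = 1 / (1 - a n j * (cis \<alpha> - 1))"
        unfolding fac_def \<alpha>_def[symmetric] geo_factor_alt[OF sj] by (simp add: a_def)
      have "exp (\<i> * a n j * \<alpha> - a n j * (1 + a n j) * \<alpha>\<^sup>2 / 2) = cis (a n j * \<alpha>) * w n j"
        by (simp add: w_def q_def cis_conv_exp \<alpha>_def exp_of_real[symmetric] mult.assoc flip: exp_add)
      then have "norm (fac n j - cis (a n j * \<alpha>) * w n j) \<le> 40 * K\<^sup>2 * \<epsilon> n ^ 3"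
        using geo_factor_second_order[of "a n j" K "\<epsilon> n" \<alpha>] apos[of j n] j K 1 2 elim(2) sn
        by (simp add: f \<epsilon>_def)
      moreover have "norm (z n j - w n j) = norm (cis (a n j * \<alpha>) * (z n j - w n j))"
        by (simp add: norm_mult)
      moreover have "cis (a n j * \<alpha>) * (z n j - w n j) = fac n j - cis (a n j * \<alpha>) * w n j"
        by (simp add: z_def \<alpha>_def algebra_simps cis_mult)
      ultimately show ?thesis by simp
    qed
    have "norm ((\<Prod>j=1..m n. z n j) - (\<Prod>j=1..m n. w n j)) \<le> (\<Sum>j=1..m n. norm (z n j - w n j))"
    proof (rule norm_prod_diff)
      fix j assume j: "j \<in> {1..m n}"
      show "norm (z n j) \<le> 1"
        unfolding z_def fac_def norm_mult norm_cis mult_1_right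
        using j sn by (intro geo_factor_norm_le_1) auto
      have "q n j \<ge> 0" using apos[of j n] j by (auto simp: q_def)
      then show "norm (w n j) \<le> 1" by (simp add: w_def norm_of_real del: of_real_exp)
    qed
    also have "\<dots> \<le> (\<Sum>j=1..m n. 40 * K\<^sup>2 * \<epsilon> n ^ 3)" by (intro sum_mono zw)
    also have "\<dots> = 40 * K\<^sup>2 * (s n * real (m n)) * sqrt (s n) * \<bar>y\<bar> ^ 3"
    proof -
      have "sqrt (s n) ^ 3 = s n * sqrt (s n)" using sn by (simp add: power3_eq_cube)
      then have "\<epsilon> n ^ 3 = s n * sqrt (s n) * \<bar>y\<bar> ^ 3"
        unfolding \<epsilon>_def power_mult_distrib by simp
      then show ?thesis by simp
    qed
    finally show ?case .
  qed
  have "(\<lambda>n. 40 * K\<^sup>2 * (s n * real (m n)) * sqrt (s n) * \<bar>y\<bar> ^ 3) \<longlonglongrightarrow> 40 * K\<^sup>2 * saddle * 0 * \<bar>y\<bar> ^ 3"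
    by (intro tendsto_intros U s0)
  then have "(\<lambda>n. 40 * K\<^sup>2 * (s n * real (m n)) * sqrt (s n) * \<bar>y\<bar> ^ 3) \<longlonglongrightarrow> 0"
    by simp
  then have diff: "(\<lambda>n. (\<Prod>j=1..m n. z n j) - (\<Prod>j=1..m n. w n j)) \<longlonglongrightarrow> 0"
    by (rule Lim_null_comparison[OF ev])
  have "(\<Prod>j=1..m n. w n j) = complex_of_real (exp (- (s n * (\<Sum>j=1..m n. planck2 (s n * real j)) * y\<^sup>2 / 2)))" for n
  proof -
    have sn: "s n > 0" by (rule s)
    have "q n j = s n * y\<^sup>2 / 2 * planck2 (s n * real j)" if "j \<in> {1..m n}" for j
    proof -
      have sj: "s n * real j > 0" using sn that by simp
      have "q n j = planck2 (s n * real j) / (s n * real j)\<^sup>2 * (real j * t n)\<^sup>2 / 2"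
        unfolding q_def a_def planck2_eq_occupation[OF sj] ..
      also have "(real j * t n)\<^sup>2 = (s n * real j)\<^sup>2 * (s n * y\<^sup>2)"
        using sn by (simp add: t_def power_mult_distrib)
      finally show ?thesis using sn that by auto
    qed
    then have "(\<Sum>j=1..m n. q n j) = s n * y\<^sup>2 / 2 * (\<Sum>j=1..m n. planck2 (s n * real j))"
      unfolding sum_distrib_left by (intro sum.cong refl)
    moreover have "(\<Prod>j=1..m n. w n j) = complex_of_real (exp (- (\<Sum>j=1..m n. q n j)))"
    proof -
      have "(\<Prod>j=1..m n. w n j) = complex_of_real (\<Prod>j=1..m n. exp (- q n j))"
        unfolding w_def by (rule of_real_prod[symmetric])
      also have "(\<Prod>j=1..m n. exp (- q n j)) = exp (\<Sum>j=1..m n. - q n j)"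
        by (rule exp_sum[symmetric]) simp
      finally show ?thesis unfolding sum_negf .
    qed
    ultimately show ?thesis by (simp add: mult_ac)
  qed
  moreover have "(\<lambda>n. complex_of_real (exp (- (s n * (\<Sum>j=1..m n. planck2 (s n * real j)) * y\<^sup>2 / 2)))) \<longlonglongrightarrow>
     complex_of_real (exp (- (var_lim * y\<^sup>2 / 2)))"
    by (intro tendsto_of_real tendsto_intros var_asymp[OF s U]) auto
  ultimately have "(\<lambda>n. ((\<Prod>j=1..m n. z n j) - (\<Prod>j=1..m n. w n j)) + (\<Prod>j=1..m n. w n j)) \<longlonglongrightarrow>
      0 + complex_of_real (exp (- (var_lim * y\<^sup>2 / 2)))"
    by (intro tendsto_add diff) simp
  moreover have "(\<Prod>j=1..m n. z n j) = geo_char (s n) (m n) (s n * sqrt (s n) * y) *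
      cis (- (s n * sqrt (s n) * y * (\<Sum>j=1..m n. real j / (exp (s n * real j) - 1))))" for n
  proof -
    have "(\<Prod>j=1..m n. cis (- (a n j * (real j * t n)))) = cis (- (t n * (\<Sum>j=1..m n. real j / (exp (s n * real j) - 1))))"
      by (simp add: prod_cis sum_negf a_def sum_distrib_left mult_ac)
    moreover have "(\<Prod>j=1..m n. fac n j) = geo_char (s n) (m n) (t n)"
      by (simp only: geo_char_def fac_def)
    moreover have "(\<Prod>j=1..m n. z n j) = (\<Prod>j=1..m n. fac n j) * (\<Prod>j=1..m n. cis (- (a n j * (real j * t n))))"
      by (simp only: z_def prod.distrib)
    ultimately show ?thesis by (simp only: t_def)
  qed
  ultimately show ?thesis by simp
qed

lemma gaussian_fourier:
  fixes V \<nu> :: real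
  assumes V: "V > 0"
  shows "(LINT y|lborel. complex_of_real (exp (- (V * y\<^sup>2 / 2))) * cis (- (\<nu> * y))) =
    complex_of_real (sqrt (2 * pi / V) * exp (- (\<nu>\<^sup>2 / (2 * V))))"
proof -
  have "complex_of_real (exp (- ((- \<nu> / sqrt V)\<^sup>2) / 2)) = char std_normal_distribution (- \<nu> / sqrt V)"
    by (simp add: char_std_normal_distribution)
  also have "\<dots> = (LINT x|lborel. std_normal_density x *\<^sub>R iexp (- \<nu> / sqrt V * x))"
    unfolding char_def by (subst integral_density) (auto simp: normal_density_nonneg)
  also have "\<dots> = sqrt V *\<^sub>R (LINT y|lborel. std_normal_density (sqrt V * y) *\<^sub>R iexp (- \<nu> / sqrt V * (sqrt V * y)))"
    using V by (subst lborel_integral_real_affine[of "sqrt V" _ 0]) auto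
  also have "(\<lambda>y. std_normal_density (sqrt V * y) *\<^sub>R iexp (- \<nu> / sqrt V * (sqrt V * y))) =
     (\<lambda>y. complex_of_real (1 / sqrt (2 * pi)) * (complex_of_real (exp (- (V * y\<^sup>2 / 2))) * cis (- (\<nu> * y))))"
    using V by (auto simp: fun_eq_iff std_normal_density_def scaleR_conv_of_real power_mult_distrib cis_conv_exp)
  finally have "complex_of_real (exp (- ((- \<nu> / sqrt V)\<^sup>2) / 2)) = complex_of_real (sqrt V / sqrt (2 * pi)) *
     (LINT y|lborel. complex_of_real (exp (- (V * y\<^sup>2 / 2))) * cis (- (\<nu> * y)))"
    by (simp add: scaleR_conv_of_real)
  then have "(LINT y|lborel. complex_of_real (exp (- (V * y\<^sup>2 / 2))) * cis (- (\<nu> * y))) =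
     complex_of_real (sqrt (2 * pi) / sqrt V) * complex_of_real (exp (- ((- \<nu> / sqrt V)\<^sup>2) / 2))"
    using V by (simp add: field_simps)
  also have "(- \<nu> / sqrt V)\<^sup>2 = \<nu>\<^sup>2 / V" using V by (simp add: power_divide)
  finally show ?thesis by (simp add: real_sqrt_divide mult.commute)
qed

section \<open>Local limit theorem for a fixed number of parts\<close>

text \<open>For s = pi/sqrt (5n) this is (n - m(m+1)/2)/2, the target after removal of the
  staircase; n enters only through s.\<close>

definition saddle_N :: "real \<Rightarrow> nat \<Rightarrow> real" where
  "saddle_N s m = pi\<^sup>2 / (10 * s\<^sup>2) - real m * (real m + 1) / 4"

text \<open>Fourier inversion: at an integer \<open>N\<close> this is the probability that the
  geometric sum equals \<open>N\<close>.\<close>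

definition local_coeff :: "real \<Rightarrow> nat \<Rightarrow> real \<Rightarrow> complex" where
  "local_coeff s m N =
     (LINT t:{-pi..pi}|lborel. cis (- (N * t)) * geo_char s m t) / complex_of_real (2 * pi)"

lemma continuous_on_geo_char [continuous_intros]:
  assumes "s > 0" "continuous_on A f"
  shows "continuous_on A (\<lambda>x. geo_char s m (f x))"
proof -
  have "1 - complex_of_real (exp (- (s * real j))) * cis \<alpha> \<noteq> 0" if "j \<in> {1..m}" for j \<alpha>
  proof
    assume "1 - complex_of_real (exp (- (s * real j))) * cis \<alpha> = 0"
    then have "norm (complex_of_real (exp (- (s * real j))) * cis \<alpha>) = 1" by (metis eq_iff_diff_eq_0 norm_one)
    then show False using assms(1) that by (simp add: norm_mult del: of_real_exp)
  qed
  then show ?thesis unfolding geo_char_def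
    by (intro continuous_on_prod continuous_on_divide continuous_intros assms(2)) auto
qed

lemma qfac_eq_geo_char:
  assumes s: "s > 0"
  shows "exp (- of_real N * Complex (- s) t) / qfac m (Complex (- s) t) =
    complex_of_real (exp (s * N) / (\<Prod>j=1..m. 1 - exp (- (s * real j)))) * (cis (- (N * t)) * geo_char s m t)"
proof -
  have "exp (- of_real N * Complex (- s) t) = complex_of_real (exp (s * N)) * cis (- (N * t))"
    by (simp add: Complex_eq cis_conv_exp algebra_simps exp_of_real[symmetric] flip: exp_add)
  moreover have "qfac m (Complex (- s) t) = (\<Prod>j=1..m. 1 - complex_of_real (exp (- (s * real j))) * cis (real j * t))"
    unfolding qfac_def
    by (intro prod.cong refl) (simp add: Complex_eq cis_conv_exp algebra_simps exp_of_real[symmetric] flip: exp_add)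
  moreover have "geo_char s m t = (\<Prod>j=1..m. 1 - complex_of_real (exp (- (s * real j)))) /
      (\<Prod>j=1..m. 1 - complex_of_real (exp (- (s * real j))) * cis (real j * t))"
    by (simp add: geo_char_def prod_dividef)
  moreover have "(\<Prod>j=1..m. 1 - complex_of_real (exp (- (s * real j)))) \<noteq> 0"
  proof -
    have "1 - complex_of_real (exp (- (s * real j))) \<noteq> 0" if "j \<in> {1..m}" for j
    proof -
      have "1 - exp (- (s * real j)) \<noteq> 0" using s that by simp
      then show ?thesis by (metis of_real_1 of_real_diff of_real_eq_0_iff)
    qed
    then show ?thesis by simp
  qed
  moreover have "complex_of_real (exp (s * N) / (\<Prod>j=1..m. 1 - exp (- (s * real j)))) =
      complex_of_real (exp (s * N)) / (\<Prod>j=1..m. 1 - complex_of_real (exp (- (s * real j))))"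
    by (simp only: of_real_divide of_real_prod of_real_diff of_real_1)
  moreover have "e * c / Q = e / P * (c * (P / Q))" if "P \<noteq> 0" for e c P Q :: complex
    using that by simp
  ultimately show ?thesis by (simp only:)
qed

text \<open>Besides extracting the value at t = 0, this passes from Henstock-Kurzweil to Lebesgue
  integrals, for which dominated convergence is applied.\<close>

lemma circle_coeff_eq_local:
  assumes s: "s > 0"
  shows "circle_coeff s m (saddle_N s m) = complex_of_real (weight s m) * local_coeff s m (saddle_N s m)"
proof -
  define N where "N = saddle_N s m"
  define g where "g t = cis (- (N * t)) * geo_char s m t" for t
  have "continuous_on {-pi..pi} g"
    unfolding g_def by (intro continuous_intros s)
  then have "set_integrable lborel {-pi..pi} g"
    by (rule borel_integrable_atLeastAtMost')
  then have "(LINT t:{-pi..pi}|lborel. g t) = integral {-pi..pi} g"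
    by (rule set_borel_integral_eq_integral(2))
  moreover have "exp (s * N) / (\<Prod>j=1..m. 1 - exp (- (s * real j))) = weight s m"
    using s by (simp add: weight_def N_def saddle_N_def right_diff_distrib power2_eq_square)
  ultimately show ?thesis
    unfolding circle_coeff_def local_coeff_def N_def[symmetric] qfac_eq_geo_char[OF s] g_def[abs_def]
    by simp
qed

lemma integrable_inverse_1_plus_sq: "integrable lborel (\<lambda>y::real. 1 / (1 + y\<^sup>2))"
  using integrable_inverse_1_plus_square by (simp add: set_integrable_def inverse_eq_divide)

text \<open>Substitution t = s^(3/2) y, the scale of the inverse standard deviation.\<close>

lemma local_coeff_scaled:
  assumes s: "s > 0"
  shows "local_coeff s m N = complex_of_real (s * sqrt s / (2 * pi)) *
    (LINT y|lborel. indicator {y. \<bar>s * sqrt s * y\<bar> \<le> pi} y *\<^sub>R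
      (cis (- (N * (s * sqrt s * y))) * geo_char s m (s * sqrt s * y)))"
proof -
  have c: "s * sqrt s > 0" using s by simp
  have "(LINT t:{-pi..pi}|lborel. cis (- (N * t)) * geo_char s m t) = (s * sqrt s) *\<^sub>R
    (LINT y|lborel. indicator {-pi..pi} (0 + s * sqrt s * y) *\<^sub>R
      (cis (- (N * (0 + s * sqrt s * y))) * geo_char s m (0 + s * sqrt s * y)))"
    unfolding set_lebesgue_integral_def using c by (subst lborel_integral_real_affine[of "s * sqrt s" _ 0]) auto
  moreover have "indicator {-pi..pi} (0 + s * sqrt s * y) = (indicator {y. \<bar>s * sqrt s * y\<bar> \<le> pi} y :: real)" for y
    by (auto simp: indicator_def)
  ultimately show ?thesis by (simp add: local_coeff_def scaleR_conv_of_real)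
qed

lemma measurable_geo_integrand:
  assumes s: "s > 0"
  shows "(\<lambda>y. indicator {y. \<bar>s * sqrt s * y\<bar> \<le> pi} y *\<^sub>R
      (cis (- (N * (s * sqrt s * y))) * geo_char s m (s * sqrt s * y))) \<in> borel_measurable borel"
proof (intro borel_measurable_scaleR borel_measurable_indicator)
  have "closed {y. \<bar>s * sqrt s * y\<bar> \<le> pi}"
    by (intro closed_Collect_le continuous_intros)
  then show "{y. \<bar>s * sqrt s * y\<bar> \<le> pi} \<in> sets borel" by simp
  show "(\<lambda>y. cis (- (N * (s * sqrt s * y))) * geo_char s m (s * sqrt s * y)) \<in> borel_measurable borel"
    by (intro borel_measurable_continuous_onI continuous_intros s)
qed

text \<open>Serves the range s m < 1/2, where the decay bound for \<open>geo_char\<close> does not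
  apply.\<close>

lemma local_coeff_norm_le_1:
  assumes s: "s > 0"
  shows "norm (local_coeff s m N) \<le> 1"
proof -
  have "norm (LINT t:{-pi..pi}|lborel. cis (- (N * t)) * geo_char s m t) \<le>
      (LINT t:{-pi..pi}|lborel. (1 :: real))"
    unfolding set_lebesgue_integral_def
  proof (rule Bochner_Integration.integral_norm_bound_integral)
    show "integrable lborel (\<lambda>t. indicator {-pi..pi} t *\<^sub>R (cis (- (N * t)) * geo_char s m t))"
      using borel_integrable_atLeastAtMost'[of "-pi" pi "\<lambda>t. cis (- (N * t)) * geo_char s m t"] s
      by (simp add: set_integrable_def continuous_intros)
    show "norm (indicator {-pi..pi} t *\<^sub>R (cis (- (N * t)) * geo_char s m t)) \<le> indicator {-pi..pi} t *\<^sub>R (1::real)" for t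
      using geo_char_norm_le_1[OF s, of m t] by (auto simp: norm_mult indicator_def)
  qed simp
  also have "\<dots> = 2 * pi" by (simp add: set_lebesgue_integral_def)
  finally show ?thesis by (simp add: local_coeff_def norm_divide)
qed

text \<open>In the scaled variable t^2/s^3 = y^2, so the majorant is independent of s, m and
  N.\<close>

lemma geo_char_scaled_bound:
  assumes s: "0 < s" "s \<le> 1 / 8" and m: "1 / 2 \<le> s * real m"
  shows "norm (indicator {y. \<bar>s * sqrt s * y\<bar> \<le> pi} y *\<^sub>R
      (cis (- (N * (s * sqrt s * y))) * geo_char s m (s * sqrt s * y))) \<le>
     27 * 32 ^ 3 * (1 + pi\<^sup>2) * (1 / (1 + y\<^sup>2))"
proof (cases "\<bar>s * sqrt s * y\<bar> \<le> pi")
  case True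
  have "(s * sqrt s * y)\<^sup>2 / s ^ 3 = y\<^sup>2"
    using s by (simp add: power_mult_distrib) (simp add: power2_eq_square power3_eq_cube)
  then show ?thesis using geo_char_bound[OF s m True] True by (simp add: norm_mult)
qed (auto simp: add_nonneg_nonneg)

lemma local_coeff_bound:
  "\<exists>B>0. \<forall>s m N. 0 < s \<longrightarrow> s \<le> 1 / 8 \<longrightarrow> 1 / 2 \<le> s * real m \<longrightarrow> norm (local_coeff s m N) \<le> B * (s * sqrt s)"
proof -
  define A where "A = 27 * 32 ^ 3 * (1 + pi\<^sup>2)"
  define I where "I = (LINT y|lborel. A * (1 / (1 + y\<^sup>2)))"
  have A: "A > 0" by (auto simp: A_def intro!: mult_pos_pos add_pos_nonneg)
  have I: "I \<ge> 0" unfolding I_def using A by (intro Bochner_Integration.integral_nonneg) auto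
  have "norm (local_coeff s m N) \<le> (I + 1) / (2 * pi) * (s * sqrt s)"
    if s: "0 < s" "s \<le> 1 / 8" and m: "1 / 2 \<le> s * real m" for s m N
  proof -
    have bnd: "norm (LINT y|lborel. indicator {y. \<bar>s * sqrt s * y\<bar> \<le> pi} y *\<^sub>R
      (cis (- (N * (s * sqrt s * y))) * geo_char s m (s * sqrt s * y))) \<le> I"
    proof -
      show ?thesis unfolding I_def
      proof (rule Bochner_Integration.integral_norm_bound_integral)
        show int: "integrable lborel (\<lambda>y. A * (1 / (1 + y\<^sup>2)))"
          by (intro integrable_mult_right integrable_inverse_1_plus_sq)
        show "integrable lborel (\<lambda>y. indicator {y. \<bar>s * sqrt s * y\<bar> \<le> pi} y *\<^sub>R
          (cis (- (N * (s * sqrt s * y))) * geo_char s m (s * sqrt s * y)))"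
          by (rule Bochner_Integration.integrable_bound[OF int])
             (use geo_char_scaled_bound[OF s m] A measurable_geo_integrand[OF s(1)] in \<open>auto simp: A_def\<close>)
      qed (use geo_char_scaled_bound[OF s m] in \<open>auto simp: A_def\<close>)
    qed
    have "norm (local_coeff s m N) \<le> (s * sqrt s / (2 * pi)) * I"
    proof -
      have "norm (complex_of_real (s * sqrt s / (2 * pi))) = s * sqrt s / (2 * pi)"
        using s by (simp only: norm_of_real) simp
      then show ?thesis
        unfolding local_coeff_scaled[OF s(1)] norm_mult using s
        by (simp only:) (rule mult_left_mono[OF bnd], simp)
    qed
    also have "\<dots> \<le> (s * sqrt s / (2 * pi)) * (I + 1)" using s by (intro mult_left_mono) auto
    finally show ?thesis by (simp add: mult.commute)
  qed
  moreover have "(I + 1) / (2 * pi) > 0" using I by simp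
  ultimately show ?thesis by blast
qed

text \<open>The phase of N is split into mean and deviation: the mean centres the characteristic
  function, the deviation tends to the phase \<nu> y, and the Gaussian Fourier integral turns it
  into a second Gaussian in x.\<close>

lemma local_coeff_limit:
  fixes s :: "nat \<Rightarrow> real" and m :: "nat \<Rightarrow> nat"
  assumes s: "\<And>n. s n > 0" "s \<longlonglongrightarrow> 0" and m: "\<And>n. m n > 0"
    and u: "(\<lambda>n. (s n * real (m n) - saddle) / sqrt (s n)) \<longlonglongrightarrow> x"
  shows "(\<lambda>n. local_coeff (s n) (m n) (saddle_N (s n) (m n)) / (s n * sqrt (s n))) \<longlonglongrightarrow>
    complex_of_real (exp (- ((saddle * sqrt 5 / 2 * x)\<^sup>2 / (2 * var_lim))) / sqrt (2 * pi * var_lim))"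
proof -
  define \<nu> where "\<nu> = - (saddle * sqrt 5 / 2) * x"
  define S where "S n = (\<Sum>j=1..m n. real j / (exp (s n * real j) - 1))" for n
  define N where "N n = saddle_N (s n) (m n)" for n
  define c where "c n = s n * sqrt (s n)" for n
  have U: "(\<lambda>n. s n * real (m n)) \<longlonglongrightarrow> saddle"
    by (rule scaled_seq_tendsto[OF s u])
  have c: "c n > 0" for n using s(1) by (simp add: c_def)
  have c0: "c \<longlonglongrightarrow> 0" using tendsto_mult[OF s(2) tendsto_real_sqrt[OF s(2)]] by (simp add: c_def[abs_def])
  have mean: "(\<lambda>n. (N n - S n) * c n) \<longlonglongrightarrow> \<nu>"
    using mean_asymp[OF s m u] by (simp add: N_def S_def c_def saddle_N_def \<nu>_def)
  define F where "F n y = indicator {y. \<bar>c n * y\<bar> \<le> pi} y *\<^sub>R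
      (cis (- (N n * (c n * y))) * geo_char (s n) (m n) (c n * y))" for n y
  have ptw: "(\<lambda>n. F n y) \<longlonglongrightarrow> complex_of_real (exp (- (var_lim * y\<^sup>2 / 2))) * cis (- (\<nu> * y))" for y
  proof -
    have "(\<lambda>n. geo_char (s n) (m n) (c n * y) * cis (- (c n * y * S n))) \<longlonglongrightarrow>
        complex_of_real (exp (- (var_lim * y\<^sup>2 / 2)))"
      using geo_char_centered_limit[OF s U, of y] by (simp add: c_def S_def)
    moreover have "(\<lambda>n. cis (- ((N n - S n) * c n * y))) \<longlonglongrightarrow> cis (- (\<nu> * y))"
      by (intro tendsto_intros mean)
    ultimately have "(\<lambda>n. geo_char (s n) (m n) (c n * y) * cis (- (c n * y * S n)) * cis (- ((N n - S n) * c n * y)))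
        \<longlonglongrightarrow> complex_of_real (exp (- (var_lim * y\<^sup>2 / 2))) * cis (- (\<nu> * y))"
      by (rule tendsto_mult)
    moreover have "eventually (\<lambda>n. geo_char (s n) (m n) (c n * y) * cis (- (c n * y * S n)) * cis (- ((N n - S n) * c n * y)) = F n y) sequentially"
    proof -
      have "(\<lambda>n. \<bar>c n * y\<bar>) \<longlonglongrightarrow> \<bar>0 * y\<bar>" by (intro tendsto_intros c0)
      then have "eventually (\<lambda>n. \<bar>c n * y\<bar> < pi) sequentially"
        by (rule order_tendstoD(2)) simp
      then show ?thesis
      proof eventually_elim
        case (elim n)
        have "cis (- (c n * y * S n)) * cis (- ((N n - S n) * c n * y)) = cis (- (N n * (c n * y)))"
          by (simp add: cis_mult algebra_simps)
        then show ?case using elim by (simp add: F_def mult.commute mult.left_commute)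
      qed
    qed
    ultimately show ?thesis by (rule Lim_transform_eventually)
  qed
  \<comment> \<open>The majorant is valid only from some index on; dominated convergence is applied
    to the shifted sequence.\<close>
  obtain n0 where n0: "\<And>n. n \<ge> n0 \<Longrightarrow> s n \<le> 1 / 8 \<and> 1 / 2 \<le> s n * real (m n)"
  proof -
    have "eventually (\<lambda>n. s n < 1 / 8) sequentially" by (rule order_tendstoD(2)[OF s(2)]) simp
    moreover have "eventually (\<lambda>n. 1 / 2 < s n * real (m n)) sequentially"
      by (rule order_tendstoD(1)[OF U saddle_gt])
    ultimately have "eventually (\<lambda>n. s n \<le> 1 / 8 \<and> 1 / 2 \<le> s n * real (m n)) sequentially"
      by eventually_elim auto
    then show ?thesis using that by (auto simp: eventually_sequentially)
  qed
  have "(\<lambda>n. LINT y|lborel. F (n + n0) y) \<longlonglongrightarrow>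
     (LINT y|lborel. complex_of_real (exp (- (var_lim * y\<^sup>2 / 2))) * cis (- (\<nu> * y)))"
  proof (rule integral_dominated_convergence[where w = "\<lambda>y. 27 * 32 ^ 3 * (1 + pi\<^sup>2) * (1 / (1 + y\<^sup>2))"])
    show "F (n + n0) \<in> borel_measurable lborel" for n
      unfolding F_def c_def using measurable_geo_integrand[OF s(1)] by simp
    show "integrable lborel (\<lambda>y. 27 * 32 ^ 3 * (1 + pi\<^sup>2) * (1 / (1 + y\<^sup>2)))"
      by (intro integrable_mult_right integrable_inverse_1_plus_sq)
    show "AE y in lborel. (\<lambda>n. F (n + n0) y) \<longlonglongrightarrow> complex_of_real (exp (- (var_lim * y\<^sup>2 / 2))) * cis (- (\<nu> * y))"
      using LIMSEQ_ignore_initial_segment[OF ptw] by simp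
    show "AE y in lborel. norm (F (n + n0) y) \<le> 27 * 32 ^ 3 * (1 + pi\<^sup>2) * (1 / (1 + y\<^sup>2))" for n
      unfolding F_def c_def using n0[of "n + n0"] s(1) by (intro AE_I2 geo_char_scaled_bound) auto
    show "(\<lambda>y. complex_of_real (exp (- (var_lim * y\<^sup>2 / 2))) * cis (- (\<nu> * y))) \<in> borel_measurable lborel"
    proof -
      have "(\<lambda>y. complex_of_real (exp (- (var_lim * y\<^sup>2 / 2))) * cis (- (\<nu> * y))) \<in> borel_measurable borel"
        by (intro borel_measurable_continuous_onI continuous_intros) auto
      then show ?thesis by simp
    qed
  qed
  then have "(\<lambda>n. LINT y|lborel. F n y) \<longlonglongrightarrow>
     (LINT y|lborel. complex_of_real (exp (- (var_lim * y\<^sup>2 / 2))) * cis (- (\<nu> * y)))"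
    by (rule LIMSEQ_offset)
  then have "(\<lambda>n. complex_of_real (1 / (2 * pi)) * (LINT y|lborel. F n y)) \<longlonglongrightarrow>
      complex_of_real (1 / (2 * pi)) * complex_of_real (sqrt (2 * pi / var_lim) * exp (- (\<nu>\<^sup>2 / (2 * var_lim))))"
    unfolding gaussian_fourier[OF var_lim_pos] by (intro tendsto_intros)
  moreover have "complex_of_real (1 / (2 * pi)) * (LINT y|lborel. F n y) = local_coeff (s n) (m n) (N n) / c n" for n
  proof -
    have "s n \<noteq> 0" using s(1)[of n] by simp
    then show ?thesis using c[of n] by (simp add: local_coeff_scaled[OF s(1)] F_def c_def)
  qed
  moreover have "complex_of_real (1 / (2 * pi)) * complex_of_real (sqrt (2 * pi / var_lim) * exp (- (\<nu>\<^sup>2 / (2 * var_lim)))) =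
      complex_of_real (exp (- ((saddle * sqrt 5 / 2 * x)\<^sup>2 / (2 * var_lim))) / sqrt (2 * pi * var_lim))"
  proof -
    have "1 / (2 * pi) * sqrt (2 * pi / var_lim) = 1 / sqrt (2 * pi * var_lim)"
    proof -
      have "2 * pi = sqrt (2 * pi) * sqrt (2 * pi)" by simp
      then show ?thesis using var_lim_pos by (simp add: real_sqrt_divide real_sqrt_mult field_simps)
    qed
    moreover have "\<nu>\<^sup>2 = (saddle * sqrt 5 / 2 * x)\<^sup>2" by (simp add: \<nu>_def power_mult_distrib)
    ultimately show ?thesis
      by (simp only: of_real_mult[symmetric] mult.assoc[symmetric]) simp
  qed
  ultimately show ?thesis by (simp add: N_def c_def)
qed

section \<open>Summation over the number of parts\<close>

lemma weight_Suc:
  assumes s: "s > 0"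
  shows "weight s (Suc k) = weight s k * exp (- (s * real (Suc k)) / 2 - ln (1 - exp (- (s * real (Suc k)))))"
proof -
  define u where "u = s * real (Suc k)"
  have u: "1 - exp (- u) > 0" using s by (simp add: u_def)
  have "weight s (Suc k) = exp (pi\<^sup>2 / (10 * s) - s * real (Suc k) * (real (Suc k) + 1) / 4) /
      ((\<Prod>j=1..k. 1 - exp (- (s * real j))) * (1 - exp (- u)))"
    by (simp add: weight_def u_def)
  also have "pi\<^sup>2 / (10 * s) - s * real (Suc k) * (real (Suc k) + 1) / 4 =
      (pi\<^sup>2 / (10 * s) - s * real k * (real k + 1) / 4) + - u / 2"
    by (simp add: u_def field_simps)
  finally show ?thesis using u by (simp only: exp_add exp_diff exp_ln weight_def u_def[symmetric]) simp
qed

text \<open>The logarithm of the ratio of consecutive weights, -u/2 - ln (1 - e^(-u)), vanishes at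
  \<open>saddle\<close> and decreases with slope at most -1/2. No asymptotics enter, as domination
  over all m requires.\<close>

lemma weight_ratio:
  assumes s: "s > 0"
  defines "u \<equiv> \<lambda>k. s * real (Suc k)"
  shows "u k \<ge> saddle \<Longrightarrow> weight s (Suc k) \<le> weight s k * exp (- (u k - saddle) / 2)"
    and "u k \<le> saddle \<Longrightarrow> weight s k \<le> weight s (Suc k) * exp (- (saddle - u k) / 2)"
proof -
  have uk: "u k > 0" using s by (simp add: u_def)
  have w: "weight s (Suc k) = weight s k * exp (- u k / 2 - ln (1 - exp (- u k)))"
    using weight_Suc[OF s] by (simp add: u_def)
  have wk: "weight s k \<ge> 0" "weight s (Suc k) \<ge> 0" using weight_pos[OF s] by (auto intro: less_imp_le)
  show "weight s (Suc k) \<le> weight s k * exp (- (u k - saddle) / 2)" if "u k \<ge> saddle"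
  proof -
    have "ln (1 - exp (- saddle)) \<le> ln (1 - exp (- u k))"
      using that saddle_pos by (subst ln_le_cancel_iff) auto
    then have "- u k / 2 - ln (1 - exp (- u k)) \<le> - (u k - saddle) / 2"
      by (simp add: ln_saddle field_simps)
    then show ?thesis unfolding w using wk by (intro mult_left_mono) auto
  qed
  show "weight s k \<le> weight s (Suc k) * exp (- (saddle - u k) / 2)" if "u k \<le> saddle"
  proof -
    have "ln (1 - exp (- u k)) \<le> ln (1 - exp (- saddle))"
      using that uk by (subst ln_le_cancel_iff) auto
    then have "0 \<le> (- u k / 2 - ln (1 - exp (- u k))) + - (saddle - u k) / 2"
      by (simp add: ln_saddle field_simps)
    then have "weight s k * 1 \<le> weight s k * exp ((- u k / 2 - ln (1 - exp (- u k))) + - (saddle - u k) / 2)"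
      using wk by (intro mult_left_mono) auto
    then show ?thesis unfolding w by (simp only: exp_add mult.assoc mult_1_right)
  qed
qed

text \<open>Iterating the ratio bound from the peak multiplies factors e^(-s e/2) for e < d, whose
  exponents sum to s d(d - 1)/4. Rounding the peak to the integer p is the reason for d(d - 1) in
  place of d^2.\<close>

lemma weight_gaussian_bound:
  assumes s: "s > 0"
  defines "p \<equiv> nat \<lfloor>saddle / s\<rfloor>"
  defines "d \<equiv> \<lambda>m. \<bar>real m - real p\<bar>"
  shows "weight s m \<le> weight s p * exp (- (s / 4) * (d m * (d m - 1)))"
proof -
  have p0: "real p = of_int \<lfloor>saddle / s\<rfloor>"
    unfolding p_def using s saddle_pos by (subst of_nat_nat) auto
  have "real p \<le> saddle / s" "saddle / s < real p + 1" unfolding p0 by linarith+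
  then have p: "s * real p \<le> saddle" "saddle < s * real (Suc p)"
    using s by (auto simp: field_simps)
  have up: "weight s (p + e) \<le> weight s p * exp (- (s / 4) * (real e * (real e - 1)))" for e
  proof (induction e)
    case (Suc e)
    have u: "s * real (Suc (p + e)) - saddle \<ge> s * real e" using p by (simp add: algebra_simps)
    have "saddle \<le> s * real (Suc (p + e))" using u s by (smt (verit) of_nat_0_le_iff mult_nonneg_nonneg)
    from weight_ratio(1)[OF s this]
    have "weight s (Suc (p + e)) \<le> weight s (p + e) * exp (- (s * real (Suc (p + e)) - saddle) / 2)" .
    also have "\<dots> \<le> (weight s p * exp (- (s / 4) * (real e * (real e - 1)))) * exp (- (s * real e) / 2)"
      using u weight_pos[OF s, of p] by (intro mult_mono Suc.IH) auto
    also have "\<dots> = weight s p * exp (- (s / 4) * (real (Suc e) * (real (Suc e) - 1)))"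
      by (simp only: mult.assoc exp_add[symmetric]) (simp add: field_simps)
    finally show ?case by simp
  qed simp
  have down: "e \<le> p \<Longrightarrow> weight s (p - e) \<le> weight s p * exp (- (s / 4) * (real e * (real e - 1)))" for e
  proof (induction e)
    case (Suc e)
    define k where "k = p - Suc e"
    have k: "Suc k = p - e" "real (Suc k) = real p - real e" using Suc.prems by (auto simp: k_def)
    have u: "saddle - s * real (Suc k) \<ge> s * real e"
    proof -
      have "s * real (Suc k) = s * real p - s * real e" by (simp only: k(2) right_diff_distrib)
      then show ?thesis using p by linarith
    qed
    have "s * real (Suc k) \<le> saddle" using u s by (smt (verit) of_nat_0_le_iff mult_nonneg_nonneg)
    from weight_ratio(2)[OF s this]
    have "weight s k \<le> weight s (p - e) * exp (- (saddle - s * real (Suc k)) / 2)" unfolding k(1) .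
    also have "\<dots> \<le> (weight s p * exp (- (s / 4) * (real e * (real e - 1)))) * exp (- (s * real e) / 2)"
      using u weight_pos[OF s, of p] Suc.prems by (intro mult_mono Suc.IH) auto
    also have "\<dots> = weight s p * exp (- (s / 4) * (real (Suc e) * (real (Suc e) - 1)))"
      by (simp only: mult.assoc exp_add[symmetric]) (simp add: field_simps)
    finally show ?case by (simp add: k_def)
  qed simp
  show ?thesis
  proof (cases "p \<le> m")
    case True
    then show ?thesis using up[of "m - p"] by (simp add: d_def of_nat_diff)
  next
    case False
    then show ?thesis using down[of "p - m"] by (simp add: d_def of_nat_diff)
  qed
qed

text \<open>The power s^2 is sqrt s from the weight times s^(3/2) from the local
  probability.\<close>

definition scaled_term :: "real \<Rightarrow> nat \<Rightarrow> real" where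
  "scaled_term s m = Re (circle_coeff s m (saddle_N s m)) * exp (- (pi\<^sup>2 / (5 * s))) / s\<^sup>2"

lemma scaled_term_eq:
  assumes s: "s > 0"
  shows "scaled_term s m = (weight s m * exp (- (pi\<^sup>2 / (5 * s))) / sqrt s) *
    Re (local_coeff s m (saddle_N s m) / (s * sqrt s))"
proof -
  have "s\<^sup>2 = sqrt s * (s * sqrt s)" using s by (simp add: power2_eq_square)
  then show ?thesis using s
    by (simp add: scaled_term_def circle_coeff_eq_local Re_divide_of_real flip: of_real_mult)
qed

definition limit_density :: "real \<Rightarrow> real" where
  "limit_density x = exp (- (sqrt 5 / 4 * x\<^sup>2)) / sqrt (2 * pi) *
     (exp (- ((saddle * sqrt 5 / 2 * x)\<^sup>2 / (2 * var_lim))) / sqrt (2 * pi * var_lim))"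

lemma scaled_term_limit:
  fixes s :: "nat \<Rightarrow> real" and m :: "nat \<Rightarrow> nat"
  assumes s: "\<And>n. s n > 0" "s \<longlonglongrightarrow> 0"
    and u: "(\<lambda>n. (s n * real (m n) - saddle) / sqrt (s n)) \<longlonglongrightarrow> x"
  shows "(\<lambda>n. scaled_term (s n) (m n)) \<longlonglongrightarrow> limit_density x"
proof -
  have "(\<lambda>n. s n * real (m n)) \<longlonglongrightarrow> saddle" by (rule scaled_seq_tendsto[OF s u])
  then have "eventually (\<lambda>n. s n * real (m n) > 0) sequentially"
    by (rule order_tendstoD(1)[OF _ saddle_pos])
  then obtain n0 where n0: "\<And>n. n \<ge> n0 \<Longrightarrow> m n > 0"
    by (auto simp: eventually_sequentially) (metis of_nat_0_less_iff s(1) zero_less_mult_pos)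
  define s' m' where "s' n = s (n + n0)" and "m' n = m (n + n0)" for n
  have s': "\<And>n. s' n > 0" "s' \<longlonglongrightarrow> 0" and m': "\<And>n. m' n > 0"
    and u': "(\<lambda>n. (s' n * real (m' n) - saddle) / sqrt (s' n)) \<longlonglongrightarrow> x"
    using s n0 LIMSEQ_ignore_initial_segment[OF s(2), of n0] LIMSEQ_ignore_initial_segment[OF u, of n0]
    by (auto simp: s'_def[abs_def] m'_def)
  have "(\<lambda>n. Re (local_coeff (s' n) (m' n) (saddle_N (s' n) (m' n)) / (s' n * sqrt (s' n)))) \<longlonglongrightarrow>
      Re (complex_of_real (exp (- ((saddle * sqrt 5 / 2 * x)\<^sup>2 / (2 * var_lim))) / sqrt (2 * pi * var_lim)))"
    by (intro tendsto_Re local_coeff_limit s' m' u')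
  from tendsto_mult[OF weight_asymp[OF s' m' u'] this]
  have "(\<lambda>n. scaled_term (s' n) (m' n)) \<longlonglongrightarrow> limit_density x"
    using s' by (simp add: scaled_term_eq limit_density_def)
  then show ?thesis unfolding s'_def m'_def by (rule LIMSEQ_offset)
qed

text \<open>Combined with the majorant around the peak, this control of one weight per s bounds the
  weights for all m at once.\<close>

lemma peak_weight_bounded:
  fixes s :: "nat \<Rightarrow> real"
  assumes s: "\<And>n. s n > 0" "s \<longlonglongrightarrow> 0"
  obtains W where "W > 0"
    "eventually (\<lambda>n. weight (s n) (nat \<lfloor>saddle / s n\<rfloor>) * exp (- (pi\<^sup>2 / (5 * s n))) / sqrt (s n) \<le> W) sequentially"
proof -
  define p where "p n = nat \<lfloor>saddle / s n\<rfloor>" for n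
  have p: "\<bar>s n * real (p n) - saddle\<bar> \<le> s n" for n
  proof -
    have "real (p n) = of_int \<lfloor>saddle / s n\<rfloor>"
      unfolding p_def using s(1)[of n] saddle_pos by (subst of_nat_nat) auto
    then have "real (p n) \<le> saddle / s n" "saddle / s n \<le> real (p n) + 1" by linarith+
    then show ?thesis using s(1)[of n] by (simp add: field_simps abs_le_iff)
  qed
  have u: "(\<lambda>n. (s n * real (p n) - saddle) / sqrt (s n)) \<longlonglongrightarrow> 0"
  proof (rule Lim_null_comparison)
    show "eventually (\<lambda>n. norm ((s n * real (p n) - saddle) / sqrt (s n)) \<le> sqrt (s n)) sequentially"
    proof (intro always_eventually allI)
      fix n
      have "\<bar>s n * real (p n) - saddle\<bar> / sqrt (s n) \<le> s n / sqrt (s n)"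
        using p[of n] s(1)[of n] by (intro divide_right_mono) auto
      then show "norm ((s n * real (p n) - saddle) / sqrt (s n)) \<le> sqrt (s n)"
        using s(1)[of n] by (simp add: real_div_sqrt)
    qed
    show "(\<lambda>n. sqrt (s n)) \<longlonglongrightarrow> 0" using tendsto_real_sqrt[OF s(2)] by simp
  qed
  have "eventually (\<lambda>n. s n < saddle) sequentially" by (rule order_tendstoD(2)[OF s(2) saddle_pos])
  then obtain n0 where n0: "\<And>n. n \<ge> n0 \<Longrightarrow> s n < saddle" by (auto simp: eventually_sequentially)
  have pp: "p (n + n0) > 0" for n
    using n0[of "n + n0"] s(1)[of "n + n0"] by (simp add: p_def le_divide_eq)
  have "(\<lambda>n. weight (s (n + n0)) (p (n + n0)) * exp (- (pi\<^sup>2 / (5 * s (n + n0)))) / sqrt (s (n + n0)))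
    \<longlonglongrightarrow> exp (- (sqrt 5 / 4 * 0\<^sup>2)) / sqrt (2 * pi)"
    using s(1) pp LIMSEQ_ignore_initial_segment[OF s(2), of n0] LIMSEQ_ignore_initial_segment[OF u, of n0]
    by (intro weight_asymp) auto
  then have "(\<lambda>n. weight (s n) (p n) * exp (- (pi\<^sup>2 / (5 * s n))) / sqrt (s n)) \<longlonglongrightarrow>
      exp (- (sqrt 5 / 4 * 0\<^sup>2)) / sqrt (2 * pi)"
    by (rule LIMSEQ_offset)
  then have "eventually (\<lambda>n. weight (s n) (p n) * exp (- (pi\<^sup>2 / (5 * s n))) / sqrt (s n) <
      exp (- (sqrt 5 / 4 * 0\<^sup>2)) / sqrt (2 * pi) + 1) sequentially"
    by (rule order_tendstoD(2)) simp
  then have "eventually (\<lambda>n. weight (s n) (p n) * exp (- (pi\<^sup>2 / (5 * s n))) / sqrt (s n) \<le>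
      exp (- (sqrt 5 / 4 * 0\<^sup>2)) / sqrt (2 * pi) + 1) sequentially"
    by eventually_elim simp
  then show ?thesis unfolding p_def by (rule that[rotated]) (simp add: add_pos_pos)
qed

text \<open>The polynomial is the price of the trivial local bound for small m; 1/(1 + q) remains
  integrable. The number 24 = 3 * 8 makes e^(q/8) a cube.\<close>

lemma polynomial_times_gaussian:
  fixes q B :: real
  assumes q: "q \<ge> 0" and B: "B \<ge> 0"
  shows "(B + B * q\<^sup>2) * exp (- (q / 8)) \<le> 24 ^ 3 * B / (1 + q)"
proof -
  have "1 + q / 24 \<le> exp (q / 24)" by (rule exp_ge_add_one_self)
  then have "(1 + q / 24) ^ 3 \<le> exp (q / 24) ^ 3" using q by (intro power_mono) auto
  also have "\<dots> = exp (q / 8)" by (simp flip: exp_of_nat_mult)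
  finally have e: "(1 + q / 24) ^ 3 \<le> exp (q / 8)" .
  have "(1 + q) ^ 3 \<le> (24 * (1 + q / 24)) ^ 3" using q by (intro power_mono) auto
  also have "\<dots> = 24 ^ 3 * (1 + q / 24) ^ 3" by (simp only: power_mult_distrib)
  also have "\<dots> \<le> 24 ^ 3 * exp (q / 8)" using e by (intro mult_left_mono) auto
  finally have e2: "(1 + q) ^ 3 \<le> 24 ^ 3 * exp (q / 8)" .
  have "(B + B * q\<^sup>2) * (1 + q) \<le> (B * (1 + q)\<^sup>2) * (1 + q)"
    using q B by (intro mult_right_mono) (auto simp: power2_eq_square algebra_simps)
  also have "\<dots> = B * (1 + q) ^ 3" by (simp add: power2_eq_square power3_eq_cube)
  also have "\<dots> \<le> B * (24 ^ 3 * exp (q / 8))" using e2 B by (intro mult_left_mono)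
  finally have "(B + B * q\<^sup>2) * (1 + q) * exp (- (q / 8)) \<le> B * (24 ^ 3 * exp (q / 8)) * exp (- (q / 8))"
    by (intro mult_right_mono) auto
  also have "\<dots> = 24 ^ 3 * B" by (simp add: exp_minus)
  finally show ?thesis using q by (simp add: le_divide_eq mult_ac)
qed

lemma scaled_term_bound:
  fixes s :: "nat \<Rightarrow> real"
  assumes s: "\<And>n. s n > 0" "s \<longlonglongrightarrow> 0"
  obtains C where "C > 0" "eventually (\<lambda>n. \<forall>m. \<bar>scaled_term (s n) m\<bar> \<le>
      C / (1 + s n * (real m - real (nat \<lfloor>saddle / s n\<rfloor>))\<^sup>2)) sequentially"
proof -
  obtain W where W: "W > 0"
    "eventually (\<lambda>n. weight (s n) (nat \<lfloor>saddle / s n\<rfloor>) * exp (- (pi\<^sup>2 / (5 * s n))) / sqrt (s n) \<le> W) sequentially"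
    using peak_weight_bounded[OF s] by blast
  obtain B where B: "B > 0" "\<And>s m N. 0 < s \<Longrightarrow> s \<le> 1 / 8 \<Longrightarrow> 1 / 2 \<le> s * real m \<Longrightarrow>
      norm (local_coeff s m N) \<le> B * (s * sqrt s)"
    using local_coeff_bound by blast
  \<comment> \<open>Half the gap between the peak and the threshold: once s < \<delta>, any m with s
    m < 1/2 has s(p - m) >= \<delta>.\<close>
  define \<delta> where "\<delta> = (saddle - 1 / 2) / 2"
  have \<delta>: "\<delta> > 0" using saddle_gt by (simp add: \<delta>_def)
  define D where "D = B + 1 / \<delta> ^ 4"
  have D: "D > 0" "B \<le> D" "1 / \<delta> ^ 4 \<le> D" using B \<delta> by (auto simp: D_def intro: add_pos_pos)
  define C where "C = 2 * (24 ^ 3 * (D * W))"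
  have C: "C > 0" using D W by (simp add: C_def)
  have "eventually (\<lambda>n. s n < 1 / 8) sequentially" by (rule order_tendstoD(2)[OF s(2)]) simp
  moreover have "eventually (\<lambda>n. s n < \<delta>) sequentially" by (rule order_tendstoD(2)[OF s(2) \<delta>])
  ultimately have "eventually (\<lambda>n. \<forall>m. \<bar>scaled_term (s n) m\<bar> \<le>
      C / (1 + s n * (real m - real (nat \<lfloor>saddle / s n\<rfloor>))\<^sup>2)) sequentially"
    using W(2)
  proof eventually_elim
    case (elim n)
    show ?case
    proof
      fix m
      define \<sigma> where "\<sigma> = s n"
      have \<sigma>: "\<sigma> > 0" "\<sigma> \<le> 1 / 8" "\<sigma> < \<delta>" using s(1)[of n] elim by (auto simp: \<sigma>_def)
      define p where "p = nat \<lfloor>saddle / \<sigma>\<rfloor>"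
      define d where "d = \<bar>real m - real p\<bar>"
      define q where "q = \<sigma> * d\<^sup>2"
      have q: "q \<ge> 0" using \<sigma> by (simp add: q_def)
      have d: "d \<ge> 0" by (simp add: d_def)
      have rp: "real p = of_int \<lfloor>saddle / \<sigma>\<rfloor>"
        unfolding p_def using \<sigma>(1) saddle_pos by (subst of_nat_nat) auto
      have "saddle / \<sigma> < real p + 1" unfolding rp by linarith
      then have sp: "saddle - \<sigma> < \<sigma> * real p" using \<sigma> by (simp add: field_simps)
      have loc: "norm (local_coeff \<sigma> m (saddle_N \<sigma> m) / (\<sigma> * sqrt \<sigma>)) \<le> D + D * q\<^sup>2"
      proof (cases "1 / 2 \<le> \<sigma> * real m")
        case True
        have "norm (local_coeff \<sigma> m (saddle_N \<sigma> m) / (\<sigma> * sqrt \<sigma>)) \<le> B"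
          using B(2)[OF \<sigma>(1,2) True] \<sigma> by (simp add: norm_divide norm_mult divide_le_eq)
        also have "B \<le> D + D * q\<^sup>2"
        proof -
          have "0 \<le> D * q\<^sup>2" using D(1) by simp
          then show ?thesis using D(2) by linarith
        qed
        finally show ?thesis .
      next
        case False
        \<comment> \<open>So far from the peak d >= \<delta>/\<sigma>, and the missing factor
          \<sigma>^(3/2) is bought with powers of q = \<sigma> d^2.\<close>
        have "\<delta> \<le> \<sigma> * (real p - real m)" using False sp \<sigma>(3) by (simp add: \<delta>_def right_diff_distrib)
        also have "\<dots> \<le> \<sigma> * d" using \<sigma> by (intro mult_left_mono) (auto simp: d_def)
        finally have "\<delta> ^ 4 \<le> (\<sigma> * d) ^ 4" using \<delta> by (intro power_mono) auto
        also have "\<dots> = \<sigma>\<^sup>2 * q\<^sup>2" by (simp add: q_def power_mult_distrib flip: power_mult power_add)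
        finally have "1 \<le> \<sigma>\<^sup>2 * (q\<^sup>2 / \<delta> ^ 4)" using \<delta> by (simp add: le_divide_eq)
        also have "\<dots> \<le> (\<sigma> * sqrt \<sigma>) * (q\<^sup>2 / \<delta> ^ 4)"
        proof (intro mult_right_mono)
          have "\<sigma> \<le> sqrt \<sigma>" using \<sigma> by (intro real_le_rsqrt) (auto simp: power2_eq_square mult_left_le)
          then show "\<sigma>\<^sup>2 \<le> \<sigma> * sqrt \<sigma>" using \<sigma> by (simp add: power2_eq_square)
        qed (use \<delta> in auto)
        finally have "1 / (\<sigma> * sqrt \<sigma>) \<le> q\<^sup>2 / \<delta> ^ 4" using \<sigma> by (simp add: divide_le_eq mult.commute)
        moreover have "norm (local_coeff \<sigma> m (saddle_N \<sigma> m) / (\<sigma> * sqrt \<sigma>)) \<le> 1 / (\<sigma> * sqrt \<sigma>)"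
          using local_coeff_norm_le_1[OF \<sigma>(1), of m "saddle_N \<sigma> m"] \<sigma>
          by (simp add: norm_divide norm_mult divide_right_mono)
        moreover have "q\<^sup>2 / \<delta> ^ 4 \<le> D * q\<^sup>2" using mult_right_mono[OF D(3), of "q\<^sup>2"] by simp
        ultimately show ?thesis using D by linarith
      qed
      \<comment> \<open>AM-GM trades the linear term of d(d - 1) for half of the quadratic
        one.\<close>
      have "\<sigma> * d \<le> (q + \<sigma>) / 2"
      proof -
        have "0 \<le> \<sigma> * (d - 1)\<^sup>2" using \<sigma> by simp
        then show ?thesis by (simp add: q_def power2_eq_square algebra_simps)
      qed
      then have lin: "- (q / 4) + \<sigma> * d / 4 \<le> 1 / 8 + - (q / 8)"
        using \<sigma>(1,2) by (simp add: field_simps)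
      have "- (\<sigma> / 4) * (d * (d - 1)) = - (q / 4) + \<sigma> * d / 4"
        by (simp add: q_def power2_eq_square right_diff_distrib diff_divide_distrib)
      with lin have "- (\<sigma> / 4) * (d * (d - 1)) \<le> 1 / 8 + - (q / 8)"
        by (simp only:)
      then have "exp (- (\<sigma> / 4) * (d * (d - 1))) \<le> exp (1 / 8) * exp (- (q / 8))"
        by (simp flip: exp_add)
      also have "\<dots> \<le> 2 * exp (- (q / 8))"
        using exp_half_le2 by (intro mult_right_mono order_trans[OF _ exp_half_le2]) auto
      finally have ex: "exp (- (\<sigma> / 4) * (d * (d - 1))) \<le> 2 * exp (- (q / 8))" .
      have "weight \<sigma> m * exp (- (pi\<^sup>2 / (5 * \<sigma>))) / sqrt \<sigma> \<le>
          (weight \<sigma> p * exp (- (\<sigma> / 4) * (d * (d - 1)))) * exp (- (pi\<^sup>2 / (5 * \<sigma>))) / sqrt \<sigma>"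
        using weight_gaussian_bound[OF \<sigma>(1), of m] \<sigma>(1)
        by (intro divide_right_mono mult_right_mono) (auto simp: p_def d_def)
      also have "\<dots> = (weight \<sigma> p * exp (- (pi\<^sup>2 / (5 * \<sigma>))) / sqrt \<sigma>) * exp (- (\<sigma> / 4) * (d * (d - 1)))"
        by simp
      also have "\<dots> \<le> W * (2 * exp (- (q / 8)))"
        using elim(3) ex W(1) by (intro mult_mono) (auto simp: p_def \<sigma>_def)
      finally have we: "weight \<sigma> m * exp (- (pi\<^sup>2 / (5 * \<sigma>))) / sqrt \<sigma> \<le> W * (2 * exp (- (q / 8)))" .
      have "\<bar>scaled_term \<sigma> m\<bar> = (weight \<sigma> m * exp (- (pi\<^sup>2 / (5 * \<sigma>))) / sqrt \<sigma>) *
          \<bar>Re (local_coeff \<sigma> m (saddle_N \<sigma> m) / (\<sigma> * sqrt \<sigma>))\<bar>"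
        unfolding scaled_term_eq[OF \<sigma>(1)] abs_mult using \<sigma> weight_pos[OF \<sigma>(1), of m] by simp
      also have "\<dots> \<le> (W * (2 * exp (- (q / 8)))) * (D + D * q\<^sup>2)"
        using W(1) we order_trans[OF abs_Re_le_cmod loc] by (intro mult_mono) auto
      also have "\<dots> = 2 * W * ((D + D * q\<^sup>2) * exp (- (q / 8)))" by simp
      also have "\<dots> \<le> 2 * W * (24 ^ 3 * D / (1 + q))"
        using W(1) D(1) q by (intro mult_left_mono polynomial_times_gaussian) auto
      also have "\<dots> = C / (1 + q)" by (simp add: C_def)
      finally show "\<bar>scaled_term (s n) m\<bar> \<le> C / (1 + s n * (real m - real (nat \<lfloor>saddle / s n\<rfloor>))\<^sup>2)"
        by (simp add: q_def d_def p_def \<sigma>_def)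
    qed
  qed
  with C show ?thesis by (rule that)
qed

section \<open>From sums over residue classes to an integral\<close>

lemma integral_floor_step:
  fixes f :: "nat \<Rightarrow> real"
  shows "integrable lborel (\<lambda>u. indicator {0..<real K} u * f (nat \<lfloor>u\<rfloor>))"
    and "(LINT u|lborel. indicator {0..<real K} u * f (nat \<lfloor>u\<rfloor>)) = (\<Sum>k<K. f k)"
proof -
  have "has_bochner_integral lborel (\<lambda>u. \<Sum>k<K. indicator {real k..<real k + 1} u *\<^sub>R f k)
      (\<Sum>k<K. measure lborel {real k..<real k + 1} *\<^sub>R f k)"
    by (intro has_bochner_integral_sum has_bochner_integral_indicator) auto
  also have "(\<lambda>u. \<Sum>k<K. indicator {real k..<real k + 1} u *\<^sub>R f k) = (\<lambda>u. indicator {0..<real K} u * f (nat \<lfloor>u\<rfloor>))"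
  proof
    fix u :: real
    show "(\<Sum>k<K. indicator {real k..<real k + 1} u *\<^sub>R f k) = indicator {0..<real K} u * f (nat \<lfloor>u\<rfloor>)"
    proof (cases "u \<in> {0..<real K}")
      case True
      have eq: "real k \<le> u \<and> u < real k + 1 \<longleftrightarrow> k = nat \<lfloor>u\<rfloor>" for k
        using True by (auto simp: nat_eq_iff) linarith+
      have "nat \<lfloor>u\<rfloor> < K" using True by (simp add: nat_less_iff floor_less_iff)
      have "(\<Sum>k<K. indicator {real k..<real k + 1} u *\<^sub>R f k) = (\<Sum>k<K. if k = nat \<lfloor>u\<rfloor> then f k else 0)"
        by (intro sum.cong refl) (auto simp: indicator_def eq)
      then show ?thesis using True \<open>nat \<lfloor>u\<rfloor> < K\<close> by (simp add: sum.delta)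
    next
      case False
      have "u \<notin> {real k..<real k + 1}" if "k < K" for k
      proof -
        have "real k + 1 \<le> real K" using that by linarith
        then show ?thesis using False by auto
      qed
      then have "(\<Sum>k<K. indicator {real k..<real k + 1} u *\<^sub>R f k) = 0"
        by (intro sum.neutral) (auto simp: indicator_def)
      moreover have "indicator {0..<real K} u = (0 :: real)" using False by simp
      ultimately show ?thesis by (simp only: mult_zero_left)
    qed
  qed
  also have "(\<Sum>k<K. measure lborel {real k..<real k + 1} *\<^sub>R f k) = (\<Sum>k<K. f k)"
    by simp
  finally have *: "has_bochner_integral lborel (\<lambda>u. indicator {0..<real K} u * f (nat \<lfloor>u\<rfloor>)) (\<Sum>k<K. f k)" .
  show "integrable lborel (\<lambda>u. indicator {0..<real K} u * f (nat \<lfloor>u\<rfloor>))"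
    "(LINT u|lborel. indicator {0..<real K} u * f (nat \<lfloor>u\<rfloor>)) = (\<Sum>k<K. f k)"
    using * by (auto simp: has_bochner_integral_iff)
qed

text \<open>The sum is the integral of a step function in the scaled deviation x from the peak. The
  assumption on \<open>K\<close> pushes the cut-off of the sum past every fixed x.\<close>

lemma scaled_sum_limit:
  fixes s :: "nat \<Rightarrow> real" and K :: "nat \<Rightarrow> nat" and a :: nat
  assumes s: "\<And>n. s n > 0" "s \<longlonglongrightarrow> 0" and K: "filterlim (\<lambda>n. s n * real (K n)) at_top sequentially"
    and a: "a < 4"
  shows "(\<lambda>n. sqrt (s n) * (\<Sum>k<K n. scaled_term (s n) (4 * k + a))) \<longlonglongrightarrow>
     (LINT x|lborel. limit_density x) / 4"
proof -
  \<comment> \<open>Chosen so that 4 s U = saddle + x sqrt s; the Jacobian 1/(4 sqrt s) is the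
    source of the quarter, for every residue a.\<close>
  define U where "U n x = saddle / (4 * s n) + 1 / (4 * sqrt (s n)) * x" for n x
  define M where "M n x = 4 * nat \<lfloor>U n x\<rfloor> + a" for n x
  define h where "h n x = indicator {0..<real (K n)} (U n x) * scaled_term (s n) (M n x)" for n x
  have int: "integrable lborel (h n)"
    and sum: "sqrt (s n) * (\<Sum>k<K n. scaled_term (s n) (4 * k + a)) = (LINT x|lborel. h n x) / 4" for n
  proof -
    have c: "1 / (4 * sqrt (s n)) \<noteq> 0" "1 / (4 * sqrt (s n)) > 0" using s(1)[of n] by auto
    let ?f = "\<lambda>u. indicator {0..<real (K n)} u * scaled_term (s n) (4 * nat \<lfloor>u\<rfloor> + a)"
    note step = integral_floor_step[of "K n" "\<lambda>k. scaled_term (s n) (4 * k + a)"]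
    have h: "h n = (\<lambda>x. ?f (saddle / (4 * s n) + 1 / (4 * sqrt (s n)) * x))"
      by (simp add: h_def U_def M_def fun_eq_iff)
    show "integrable lborel (h n)"
      unfolding h by (rule lborel_integrable_real_affine[OF step(1) c(1)])
    have "(\<Sum>k<K n. scaled_term (s n) (4 * k + a)) = (LINT u|lborel. ?f u)"
      by (rule step(2)[symmetric])
    also have "\<dots> = \<bar>1 / (4 * sqrt (s n))\<bar> *\<^sub>R (LINT x|lborel. h n x)"
      unfolding h by (rule lborel_integral_real_affine[OF c(1)])
    finally show "sqrt (s n) * (\<Sum>k<K n. scaled_term (s n) (4 * k + a)) = (LINT x|lborel. h n x) / 4"
      using s(1)[of n] by simp
  qed
  \<comment> \<open>Rounding and the residue a <= 3 move the index by at most 4, which is O(sqrt s)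
    in terms of x.\<close>
  have near: "\<bar>real (M n x) - 4 * U n x\<bar> \<le> 4" if "U n x \<ge> 0" for n x
  proof -
    have "real (nat \<lfloor>U n x\<rfloor>) = of_int \<lfloor>U n x\<rfloor>" using that by simp
    then have "real (nat \<lfloor>U n x\<rfloor>) \<le> U n x" "U n x < real (nat \<lfloor>U n x\<rfloor>) + 1" by linarith+
    moreover have "real a \<le> 3" "0 \<le> real a" using a by auto
    moreover have "real (M n x) = 4 * real (nat \<lfloor>U n x\<rfloor>) + real a"
      by (simp only: M_def of_nat_add of_nat_mult of_nat_numeral)
    ultimately show ?thesis by linarith
  qed
  have U4: "4 * U n x = saddle / s n + x / sqrt (s n)" for n x
    by (simp add: U_def)
  have sU: "s n * (4 * U n x) = saddle + sqrt (s n) * x" for n x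
    using s(1)[of n] unfolding U4 by (simp add: distrib_left real_divide_square_eq) (metis real_div_sqrt less_imp_le mult.commute times_divide_eq_left)
  have s0: "(\<lambda>n. sqrt (s n)) \<longlonglongrightarrow> 0" using tendsto_real_sqrt[OF s(2)] by simp
  have ptw: "(\<lambda>n. h n x) \<longlonglongrightarrow> limit_density x" for x
  proof -
    have lim: "(\<lambda>n. saddle + sqrt (s n) * x) \<longlonglongrightarrow> saddle + 0 * x"
      by (intro tendsto_intros s0)
    have "eventually (\<lambda>n. saddle + sqrt (s n) * x > 0) sequentially"
      by (rule order_tendstoD(1)[OF lim]) (simp add: saddle_pos)
    moreover have "eventually (\<lambda>n. saddle + sqrt (s n) * x < saddle + 1) sequentially"
      by (rule order_tendstoD(2)[OF lim]) simp
    moreover have "eventually (\<lambda>n. s n * real (K n) \<ge> saddle + 1) sequentially"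
      using K by (simp add: filterlim_at_top)
    ultimately have ev: "eventually (\<lambda>n. 0 \<le> U n x \<and> U n x < real (K n)) sequentially"
    proof eventually_elim
      case (elim n)
      have "0 < s n * (4 * U n x)" "s n * (4 * U n x) < s n * (4 * real (K n))"
        using elim s(1)[of n] saddle_pos unfolding sU by auto
      then show ?case using s(1)[of n] by (auto simp: zero_less_mult_iff)
    qed
    have "(\<lambda>n. (s n * real (M n x) - saddle) / sqrt (s n)) \<longlonglongrightarrow> x"
    proof (rule Lim_transform2)
      show "(\<lambda>n. x) \<longlonglongrightarrow> x" by simp
      show "(\<lambda>n. x - (s n * real (M n x) - saddle) / sqrt (s n)) \<longlonglongrightarrow> 0"
      proof (rule Lim_null_comparison)
        show "(\<lambda>n. 4 * sqrt (s n)) \<longlonglongrightarrow> 0" using tendsto_mult_right_zero[OF s0] by simp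
        show "eventually (\<lambda>n. norm (x - (s n * real (M n x) - saddle) / sqrt (s n)) \<le> 4 * sqrt (s n)) sequentially"
          using ev
        proof eventually_elim
          case (elim n)
          have r: "sqrt (s n) > 0" "s n = sqrt (s n) * sqrt (s n)" using s(1)[of n] by auto
          have "x - (s n * real (M n x) - saddle) / sqrt (s n) = (s n * (4 * U n x) - s n * real (M n x)) / sqrt (s n)"
            unfolding sU using r(1) by (simp add: field_simps)
          also have "\<dots> = sqrt (s n) * (4 * U n x - real (M n x))"
            using r by (metis (no_types, opaque_lifting) mult.assoc mult.left_commute nonzero_mult_div_cancel_left order_less_irrefl right_diff_distrib)
          finally have "norm (x - (s n * real (M n x) - saddle) / sqrt (s n)) = sqrt (s n) * \<bar>4 * U n x - real (M n x)\<bar>"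
            using r(1) by (simp add: abs_mult)
          also have "\<dots> \<le> sqrt (s n) * 4"
            using near[of n x] elim r(1) by (intro mult_left_mono) auto
          finally show ?case by simp
        qed
      qed
    qed
    then have "(\<lambda>n. scaled_term (s n) (M n x)) \<longlonglongrightarrow> limit_density x"
      by (rule scaled_term_limit[OF s])
    then show ?thesis
      by (rule Lim_transform_eventually) (use ev in \<open>auto simp: h_def elim!: eventually_mono\<close>)
  qed
  obtain C where C: "C > 0" "eventually (\<lambda>n. \<forall>m. \<bar>scaled_term (s n) m\<bar> \<le>
      C / (1 + s n * (real m - real (nat \<lfloor>saddle / s n\<rfloor>))\<^sup>2)) sequentially"
    using scaled_term_bound[OF s] by blast
  have "eventually (\<lambda>n. s n < 1) sequentially" by (rule order_tendstoD(2)[OF s(2)]) simp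
  with C(2) have "eventually (\<lambda>n. \<forall>x. \<bar>h n x\<bar> \<le> 51 * C * (1 / (1 + x\<^sup>2))) sequentially"
  proof eventually_elim
    case (elim n)
    show ?case
    proof
      fix x
      show "\<bar>h n x\<bar> \<le> 51 * C * (1 / (1 + x\<^sup>2))"
      proof (cases "0 \<le> U n x \<and> U n x < real (K n)")
        case True
        define p where "p = nat \<lfloor>saddle / s n\<rfloor>"
        define d where "d = \<bar>real (M n x) - real p\<bar>"
        define q where "q = s n * d\<^sup>2"
        have sn: "s n > 0" by (rule s)
        have q: "q \<ge> 0" using sn by (simp add: q_def)
        have "real p = of_int \<lfloor>saddle / s n\<rfloor>"
          unfolding p_def using sn saddle_pos by (subst of_nat_nat) auto
        then have "\<bar>real p - saddle / s n\<bar> \<le> 1" by linarith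
        \<comment> \<open>Here 5 is 4 from rounding the index plus 1 from rounding the peak; (d +
          5)^2 <= 2 d^2 + 50 then leads to 51.\<close>
        then have "\<bar>x / sqrt (s n)\<bar> \<le> d + 5" using near[of n x] True unfolding U4 d_def by linarith
        then have "\<bar>x / sqrt (s n)\<bar>\<^sup>2 \<le> (d + 5)\<^sup>2" by (intro power_mono) auto
        then have "x\<^sup>2 \<le> s n * (d + 5)\<^sup>2" using sn by (simp add: power_divide divide_le_eq mult.commute)
        also have "\<dots> \<le> s n * (2 * d\<^sup>2 + 50)"
        proof (rule mult_left_mono)
          have "0 \<le> (d - 5)\<^sup>2" by simp
          then show "(d + 5)\<^sup>2 \<le> 2 * d\<^sup>2 + 50" by (simp add: power2_eq_square algebra_simps)
        qed (use sn in simp)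
        also have "\<dots> \<le> 2 * q + 50" using elim(2) by (simp add: q_def algebra_simps)
        finally have "1 + x\<^sup>2 \<le> 51 * (1 + q)" using q by simp
        then have "51 * C / (51 * (1 + q)) \<le> 51 * C / (1 + x\<^sup>2)"
          using q C(1) by (intro divide_left_mono mult_pos_pos add_pos_nonneg) auto
        then have "C / (1 + q) \<le> 51 * C / (1 + x\<^sup>2)"
          by (simp only: mult_divide_mult_cancel_left[of "51 :: real"])
        moreover have "\<bar>h n x\<bar> \<le> C / (1 + q)"
          using True elim(1)[rule_format, of "M n x"] by (simp add: h_def q_def d_def p_def)
        ultimately show ?thesis by simp
      next
        case False
        then show ?thesis using C(1) by (auto simp: h_def indicator_def)
      qed
    qed
  qed
  then obtain n0 where n0: "\<And>n x. n \<ge> n0 \<Longrightarrow> \<bar>h n x\<bar> \<le> 51 * C * (1 / (1 + x\<^sup>2))"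
    by (auto simp: eventually_sequentially)
  have "(\<lambda>n. LINT x|lborel. h (n + n0) x) \<longlonglongrightarrow> (LINT x|lborel. limit_density x)"
  proof (rule integral_dominated_convergence[where w = "\<lambda>x. 51 * C * (1 / (1 + x\<^sup>2))"])
    show "limit_density \<in> borel_measurable lborel"
    proof -
      have "limit_density \<in> borel_measurable borel"
        unfolding limit_density_def[abs_def] using var_lim_pos
        by (intro borel_measurable_continuous_onI continuous_intros) auto
      then show ?thesis by simp
    qed
    show "h (n + n0) \<in> borel_measurable lborel" for n using int by (rule borel_measurable_integrable)
    show "integrable lborel (\<lambda>x. 51 * C * (1 / (1 + x\<^sup>2)))"
      by (intro integrable_mult_right integrable_inverse_1_plus_sq)
    show "AE x in lborel. (\<lambda>n. h (n + n0) x) \<longlonglongrightarrow> limit_density x"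
      using LIMSEQ_ignore_initial_segment[OF ptw] by simp
    show "AE x in lborel. norm (h (n + n0) x) \<le> 51 * C * (1 / (1 + x\<^sup>2))" for n
      using n0[of "n + n0"] by simp
  qed
  then have "(\<lambda>n. LINT x|lborel. h n x) \<longlonglongrightarrow> (LINT x|lborel. limit_density x)"
    by (rule LIMSEQ_offset)
  then show ?thesis unfolding sum by (intro tendsto_intros) auto
qed

text \<open>The two Gaussians multiply to one with inverse variance \<open>V\<close>, and V times
  \<open>var_lim\<close> is sqrt 5 pi^2/10: the terms with \<open>saddle\<close> cancel, so no
  logarithm of the golden ratio survives.\<close>

lemma integral_limit_density:
  "(LINT x|lborel. limit_density x) = sqrt (20 / (sqrt 5 * pi)) / (2 * pi)"
proof -
  define V where "V = sqrt 5 / 2 + 5 * saddle\<^sup>2 / (4 * var_lim)"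
  have vp: "var_lim > 0" by (rule var_lim_pos)
  have V: "V = (sqrt 5 * pi\<^sup>2 / 10) / var_lim"
  proof -
    have "sqrt 5 * (sqrt 5 * z) = 5 * z" for z :: real
      by (simp flip: mult.assoc)
    then have "sqrt 5 / 2 * var_lim + 5 * saddle\<^sup>2 / 4 = sqrt 5 * pi\<^sup>2 / 10"
      by (simp add: var_lim_def algebra_simps)
    moreover have "V = (sqrt 5 / 2 * var_lim + 5 * saddle\<^sup>2 / 4) / var_lim"
      using vp by (simp add: V_def field_simps)
    ultimately show ?thesis by (simp only:)
  qed
  have Vpos: "V > 0" using vp by (simp add: V)
  have "(LINT x|lborel. complex_of_real (exp (- (V * x\<^sup>2 / 2)))) = complex_of_real (sqrt (2 * pi / V))"
    using gaussian_fourier[OF Vpos, of 0] by simp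
  then have g: "(LINT x|lborel. exp (- (V * x\<^sup>2 / 2))) = sqrt (2 * pi / V)"
    by (simp only: integral_complex_of_real of_real_eq_iff)
  have "limit_density x = 1 / (sqrt (2 * pi) * sqrt (2 * pi * var_lim)) * exp (- (V * x\<^sup>2 / 2))" for x
  proof -
    have "- (sqrt 5 / 4 * x\<^sup>2) + - ((saddle * sqrt 5 / 2 * x)\<^sup>2 / (2 * var_lim)) = - (V * x\<^sup>2 / 2)"
      using vp by (simp add: V_def power_mult_distrib power_divide field_simps)
    then have "exp (- (V * x\<^sup>2 / 2)) = exp (- (sqrt 5 / 4 * x\<^sup>2)) * exp (- ((saddle * sqrt 5 / 2 * x)\<^sup>2 / (2 * var_lim)))"
      by (metis exp_add)
    then show ?thesis by (simp add: limit_density_def)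
  qed
  then have "(LINT x|lborel. limit_density x) = 1 / (sqrt (2 * pi) * sqrt (2 * pi * var_lim)) * sqrt (2 * pi / V)"
    by (simp add: g)
  also have "sqrt (2 * pi) * sqrt (2 * pi * var_lim) = 2 * pi * sqrt var_lim"
    by (simp only: real_sqrt_mult[of "2 * pi" var_lim] mult.assoc[symmetric] real_sqrt_mult_self) simp
  also have "sqrt (2 * pi / V) = sqrt var_lim * sqrt (20 / (sqrt 5 * pi))"
  proof -
    have "2 * pi / V = var_lim * (20 / (sqrt 5 * pi))"
      using vp by (simp add: V power2_eq_square field_simps)
    then show ?thesis by (simp only: real_sqrt_mult)
  qed
  finally show ?thesis using vp by simp
qed

section \<open>Assembly of the count\<close>

lemma OE_eq_sum_groups:
  "real (OE n) = (\<Sum>k<n + 1. \<Sum>a<4. if even n \<longleftrightarrow> a \<in> {0, 3}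
      then real (card (odd_even_lists (4 * k + a) (int n))) else 0)"
proof -
  define F where "F m = (if even n \<longleftrightarrow> m mod 4 \<in> {0, 3} then real (card (odd_even_lists m (int n))) else 0)" for m
  have empty: "odd_even_lists m (int n) = {}" if "m > n" for m
    using that length_le_sum_list by (fastforce simp: odd_even_lists_def)
  have "real (OE n) = (\<Sum>m | m \<le> n \<and> (even n \<longleftrightarrow> m mod 4 \<in> {0, 3}). F m)"
    unfolding OE_eq_sum_card of_nat_sum by (intro sum.cong refl) (simp add: F_def)
  \<comment> \<open>Complete blocks of four may be used because m positive parts sum to at least m,
    so indices beyond n contribute 0.\<close>
  also have "\<dots> = (\<Sum>m<(n + 1) * 4. F m)"
  proof -
    have "F i = 0" if "i \<in> {..<(n + 1) * 4} - {m. m \<le> n \<and> (even n \<longleftrightarrow> m mod 4 \<in> {0, 3})}" for i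
      using that by (cases "i \<le> n") (auto simp: F_def empty)
    then show ?thesis by (intro sum.mono_neutral_left) auto
  qed
  also have "\<dots> = (\<Sum>k<n + 1. \<Sum>m=k * 4..<k * 4 + 4. F m)"
    by (rule sum.nat_group[symmetric])
  also have "\<dots> = (\<Sum>k<n + 1. \<Sum>a<4. F (4 * k + a))"
  proof (rule sum.cong[OF refl])
    fix k
    have "(\<Sum>m=0 + k * 4..<4 + k * 4. F m) = (\<Sum>a=0..<4. F (a + k * 4))"
      by (rule sum.shift_bounds_nat_ivl)
    then show "(\<Sum>m=k * 4..<k * 4 + 4. F m) = (\<Sum>a<4. F (4 * k + a))"
      by (simp add: add.commute mult.commute atLeast0LessThan)
  qed
  also have "\<dots> = (\<Sum>k<n + 1. \<Sum>a<4. if even n \<longleftrightarrow> a \<in> {0, 3}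
      then real (card (odd_even_lists (4 * k + a) (int n))) else 0)"
    by (intro sum.cong refl) (auto simp: F_def)
  finally show ?thesis .
qed

text \<open>This s makes pi^2/(10 s^2) equal to n/2, and the parity condition makes
  \<open>saddle_N\<close> an integer, so the coefficient identity applies.\<close>

lemma card_eq_scaled_term:
  assumes n: "n > 0" and parity: "even n \<longleftrightarrow> a \<in> {0, 3}" and a: "a < 4"
  defines "s \<equiv> pi / sqrt (5 * real n)"
  shows "real (card (odd_even_lists (4 * k + a) (int n))) = scaled_term s (4 * k + a) * (s\<^sup>2 * exp (pi\<^sup>2 / (5 * s)))"
proof -
  define m where "m = 4 * k + a"
  have s: "s > 0" using n by (simp add: s_def)
  have "even (int n - int (m * (m + 1) div 2))"
  proof -
    have "m * (m + 1) div 2 = 8 * k\<^sup>2 + 4 * k * a + 2 * k + a * (a + 1) div 2"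
    proof -
      have "m * (m + 1) = 2 * (8 * k\<^sup>2 + 4 * k * a + 2 * k) + a * (a + 1)"
        by (simp add: m_def power2_eq_square algebra_simps)
      then show ?thesis by simp
    qed
    moreover have "a \<in> {0, 1, 2, 3}" using a by auto
    ultimately show ?thesis using parity by auto
  qed
  then obtain N where N: "int n - int (m * (m + 1) div 2) = 2 * N" by (elim evenE)
  have "real (m * (m + 1) div 2) = real m * (real m + 1) / 2"
    by (subst real_of_nat_div) (auto simp: algebra_simps)
  then have "2 * real_of_int N = real n - real m * (real m + 1) / 2"
    using arg_cong[OF N, of real_of_int] by simp
  moreover have "pi\<^sup>2 / (10 * s\<^sup>2) = real n / 2"
    using n by (simp add: s_def power_divide)
  ultimately have sN: "saddle_N s m = of_int N" by (simp add: saddle_N_def)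
  have "of_nat (card (odd_even_lists m (int n))) = circle_coeff s m (of_int N)"
    using card_eq_circle_coeff[OF s, of m N] by (simp flip: N)
  then have "Re (circle_coeff s m (saddle_N s m)) = real (card (odd_even_lists m (int n)))"
    unfolding sN by (metis Re_complex_of_real of_real_of_nat_eq)
  then show ?thesis using s
    by (simp add: scaled_term_def m_def exp_minus)
qed

theorem theorem1p1:
  shows "(\<lambda>n. real (OE n)) \<sim>[at_top]
         (\<lambda>n. 1 / (2 * sqrt 5 * real n powr (3/4)) * exp (pi * sqrt (real n / 5)))"
proof (rule asymp_equivI')
  \<comment> \<open>The value at 0 is a placeholder that keeps the whole sequence positive.\<close>
  define s where "s n = (if n = 0 then 1 else pi / sqrt (5 * real n))" for n
  define I where "I = (LINT x|lborel. limit_density x)"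
  define S where "S a n = sqrt (s n) * (\<Sum>k<n + 1. scaled_term (s n) (4 * k + a))" for a n
  have s: "\<And>n. s n > 0" by (simp add: s_def)
  have s0: "s \<longlonglongrightarrow> 0"
  proof (rule Lim_transform_eventually)
    show "(\<lambda>n. pi / sqrt (5 * real n)) \<longlonglongrightarrow> 0" by real_asymp
    show "eventually (\<lambda>n. pi / sqrt (5 * real n) = s n) sequentially"
      using eventually_gt_at_top[of 0] by eventually_elim (simp add: s_def)
  qed
  have K: "filterlim (\<lambda>n. s n * real (n + 1)) at_top sequentially"
  proof (rule filterlim_cong[THEN iffD1, rotated 3])
    show "filterlim (\<lambda>n. pi / sqrt (5 * real n) * real (n + 1)) at_top sequentially" by real_asymp
    show "eventually (\<lambda>n. pi / sqrt (5 * real n) * real (n + 1) = s n * real (n + 1)) sequentially"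
      using eventually_gt_at_top[of 0] by eventually_elim (simp add: s_def)
  qed auto
  have S: "S a \<longlonglongrightarrow> I / 4" if "a < 4" for a
    unfolding S_def I_def by (rule scaled_sum_limit[OF s s0 K that])
  \<comment> \<open>Either parity of n selects two of the four residue classes. All four limits
    agree, so E converges without oscillation.\<close>
  define E where "E n = (if even n then S 0 n + S 3 n else S 1 n + S 2 n)" for n
  have "E \<longlonglongrightarrow> I / 2"
    unfolding E_def
  proof (rule filterlim_If)
    have "(\<lambda>n. S 0 n + S 3 n) \<longlonglongrightarrow> I / 4 + I / 4" "(\<lambda>n. S 1 n + S 2 n) \<longlonglongrightarrow> I / 4 + I / 4"
      by (intro tendsto_add S; simp)+
    then show "((\<lambda>n. S 0 n + S 3 n) \<longlongrightarrow> I / 2) (inf sequentially (principal {n. even n}))"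
      "((\<lambda>n. S 1 n + S 2 n) \<longlongrightarrow> I / 2) (inf sequentially (principal {n. odd n}))"
      by (auto intro: tendsto_mono[OF inf_le1])
  qed
  then have "(\<lambda>n. 2 / I * E n) \<longlonglongrightarrow> 2 / I * (I / 2)" by (intro tendsto_intros)
  moreover have Ipos: "I > 0" by (simp add: I_def integral_limit_density)
  ultimately have "(\<lambda>n. 2 / I * E n) \<longlonglongrightarrow> 1" by simp
  then show "(\<lambda>n. real (OE n) / (1 / (2 * sqrt 5 * real n powr (3/4)) * exp (pi * sqrt (real n / 5)))) \<longlonglongrightarrow> 1"
  proof (rule Lim_transform_eventually)
    show "eventually (\<lambda>n. 2 / I * E n = real (OE n) / (1 / (2 * sqrt 5 * real n powr (3/4)) *
        exp (pi * sqrt (real n / 5)))) sequentially"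
      using eventually_gt_at_top[of 0]
    proof eventually_elim
      case (elim n)
      define \<sigma> where "\<sigma> = s n"
      have \<sigma>: "\<sigma> = pi / sqrt (5 * real n)" "\<sigma> > 0" using elim by (auto simp: \<sigma>_def s_def)
      define A where "A = \<sigma>\<^sup>2 * exp (pi\<^sup>2 / (5 * \<sigma>))"
      have tm: "real (card (odd_even_lists (4 * k + a) (int n))) = scaled_term \<sigma> (4 * k + a) * A"
        if "even n \<longleftrightarrow> a \<in> {0, 3}" "a < 4" for k a
        using card_eq_scaled_term[OF elim that] by (simp add: \<sigma>(1) A_def)
      have four: "(\<Sum>a<4. f a) = f 0 + f 1 + f 2 + f 3" for f :: "nat \<Rightarrow> real"
        by (simp add: numeral_eq_Suc)
      have "sqrt \<sigma> * real (OE n) = A * E n"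
      proof (cases "even n")
        case True
        have "real (OE n) = (\<Sum>k<n + 1. scaled_term \<sigma> (4 * k + 0) * A + scaled_term \<sigma> (4 * k + 3) * A)"
          unfolding OE_eq_sum_groups four using True tm[of 0] tm[of 3] by simp
        then show ?thesis using True
          by (simp add: E_def S_def \<sigma>_def sum.distrib sum_distrib_left sum_distrib_right algebra_simps)
      next
        case False
        have "real (OE n) = (\<Sum>k<n + 1. scaled_term \<sigma> (4 * k + 1) * A + scaled_term \<sigma> (4 * k + 2) * A)"
          unfolding OE_eq_sum_groups four using False tm[of 1] tm[of 2] by simp
        then show ?thesis using False
          by (simp add: E_def S_def \<sigma>_def sum.distrib sum_distrib_left sum_distrib_right algebra_simps)
      qed
      then have En: "E n = sqrt \<sigma> * real (OE n) / A" using \<sigma>(2) by (simp add: A_def)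
      have expo: "pi\<^sup>2 / (5 * \<sigma>) = pi * sqrt (real n / 5)"
      proof -
        have "sqrt (5 * real n) / 5 = sqrt (real n / 5)"
          by (simp add: real_sqrt_mult real_sqrt_divide) (simp add: field_simps)
        then show ?thesis using elim by (simp add: \<sigma>(1) power2_eq_square field_simps)
      qed
      \<comment> \<open>Compared through fourth powers, which turn sqrt \<sigma> and n^(3/4) into
        integer powers: with I^4 = 5/pi^6 and \<sigma>^6 = pi^6/(125 n^3) both sides become 400
        n^3.\<close>
      have const: "2 / I * (sqrt \<sigma> / \<sigma>\<^sup>2) = 2 * sqrt 5 * real n powr (3/4)"
      proof (rule power_eq_imp_eq_base)
        have "I\<^sup>2 = 20 / (sqrt 5 * pi) / (2 * pi)\<^sup>2"
          by (simp add: I_def integral_limit_density power_divide)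
        then have "(I\<^sup>2)\<^sup>2 = 5 / pi ^ 6"
          by (simp add: power_divide power_mult_distrib flip: power_mult power_add power_Suc)
        then have I4: "I ^ 4 = 5 / pi ^ 6" by (simp flip: power_mult)
        have "\<sigma>\<^sup>2 = pi\<^sup>2 / (5 * real n)"
          using elim by (simp add: \<sigma>(1) power_divide)
        then have "(\<sigma>\<^sup>2) ^ 3 = pi ^ 6 / (125 * real n ^ 3)"
          by (simp only: power_divide power_mult_distrib) (simp flip: power_mult)
        then have s6: "\<sigma> ^ 6 = pi ^ 6 / (125 * real n ^ 3)" by (simp flip: power_mult)
        have "sqrt \<sigma> ^ 4 = (sqrt \<sigma> ^ 2) ^ 2" by (simp flip: power_mult)
        then have "sqrt \<sigma> ^ 4 / (\<sigma>\<^sup>2) ^ 4 = 1 / \<sigma> ^ 6"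
          using \<sigma>(2) by (simp add: field_simps power2_eq_square numeral_eq_Suc)
        then have "(2 / I * (sqrt \<sigma> / \<sigma>\<^sup>2)) ^ 4 = 16 / I ^ 4 * (1 / \<sigma> ^ 6)"
          by (simp only: power_mult_distrib power_divide) simp
        also have "\<dots> = 400 * real n ^ 3"
          unfolding I4 s6 using elim by simp
        also have "\<dots> = (2 * sqrt 5 * real n powr (3/4)) ^ 4"
        proof -
          have "(real n powr (3/4)) ^ 4 = real n ^ 3"
          proof -
            have "(real n powr (3/4)) ^ 4 = real n powr (real 4 * (3/4))"
              by (rule powr_power) (use elim in auto)
            also have "real 4 * (3/4) = (3 :: real)" by simp
            also have "real n powr 3 = real n ^ 3" using elim by (simp add: powr_numeral)
            finally show ?thesis .
          qed
          moreover have "sqrt 5 ^ 4 = (25 :: real)"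
          proof -
            have "sqrt 5 ^ 4 = (sqrt 5 * sqrt 5) * (sqrt 5 * sqrt (5 :: real))"
              by (simp only: power4_eq_xxxx mult.assoc)
            then show ?thesis by simp
          qed
          ultimately show ?thesis by (simp only: power_mult_distrib) simp
        qed
        finally show "(2 / I * (sqrt \<sigma> / \<sigma>\<^sup>2)) ^ 4 = (2 * sqrt 5 * real n powr (3/4)) ^ 4" .
      qed (use Ipos \<sigma>(2) in auto)
      have "2 / I * E n = 2 / I * (sqrt \<sigma> / \<sigma>\<^sup>2) * real (OE n) / exp (pi * sqrt (real n / 5))"
        unfolding En A_def expo by simp
      then show ?case unfolding const by simp
    qed
  qed
qed

end
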